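(* Let $G$ be a finite nonabelian group, let $x,y\in G$ not commute, let $\alpha=xy$, and let $T$ be the unique component of $\hat Y(G)$ corresponding to the triangle $[(x,1),(y,1),(xy,2)]$, with its cell structure extended by a formal smallest (empty) face and a formal greatest $3$-face. All $2$-cells of $T$ are $n$-gons for a fixed $n$. Then: (1) This cell structure of $T$ forms an abstract $3$-polytope with $2$-face and edge transitive automorphism group. (2) The abstract $3$-polytope is equivar if and only if all vertices have the same valency $\lambda$. This happens when the sizes of the $x$-conjugacy class and of the $y$-conjugacy class of $\alpha=xy$ are the same. The Schläfli index of this equivar $3$-polytope is $\{n,\lambda\}$. (3) The abstract $3$-polytope has $2$-face, edge and vertex transitive automorphism group if $x$ and $y$ are $\alpha$-conjugate. (4) The abstract $3$-polytope has flag-transitive automorphism group (i.e. is regular) if $x$ and $y$ are $\alpha$-conjugate and there is an automorphism of the group $G$ taking $x$ to $y^{-1}$ and $y$ to $x^{-1}$. (5) The conclusions of (3) and (4) (i.e. $2$-face, edge and vertex transitivity, and flag-transitivity) still hold when $x$ and $y$ are not $\alpha$-conjugate, as long as there exist an automorphism of $G$ taking $x$ to $y$ and $y$ to $y^{-1}xy$ and another automorphism of $G$ taking $x$ to $y^{-1}$ and $y$ to $x^{-1}$.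
   Context: For a finite nonabelian group $G$ with center $Z(G)$, $X(G)$ is the $2$-dimensional simplicial complex with vertex set $\{(x,1): x\in G-Z(G)\}\sqcup\{(x,2): x\in G-Z(G)\}$ (type 1 and type 2 vertices), whose edges are $[(x,1),(y,1)]$ and $[(x,1),(y,2)]$ for all $x,y$ with $xy\ne yx$, and whose $2$-faces are $[(x,1),(y,1),(xy,2)]$ for all ordered pairs with $xy\neq yx$, oriented by the vertex order indicated. The link of every vertex is a disjoint union of finitely many circles. The desingularization $Y(G)$ is obtained by removing all vertices of $X(G)$ and filling in distinct punctures by distinct points (one new vertex, again labelled by $v$ and of the same type, for each vertex $v$ and each circle in the link of $v$); it has the same triangles as $X(G)$ and is a finite disjoint union of compact connected oriented triangulated surfaces, its components. In $Y(G)$ the closed star of each vertex is a single triangulated disk (its sheet). $\hat Y(G)$ is the same collection of surfaces with the cell structure whose vertices are the type 1 vertices, whose edges are those joining two type 1 vertices, and whose $2$-faces are the polygons formed by the sheets about type 2 vertices. Valency of a vertex means the number of incident edges in this cell structure. From a component $T$ one forms the poset $F_{-1}\cup F_0\cup F_1\cup F_2\cup F_3$ ordered by inclusion, where $F_0,F_1,F_2$ are the sets of vertices, edges and $2$-faces of $T$, $F_{-1}=\{\emptyset\}$ is a smallest element and $F_3=\{D\}$ is a formal greatest element. An abstract $3$-polytope is a ranked poset with ranks $-1,\dots,3$, with a least element (rank $-1$) and a greatest element (rank $3$), such that all flags (maximal chains) have $5$ elements; it satisfies the diamond condition (whenever $a<b$ have ranks differing by $2$ there are exactly two elements strictly between them);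 and it is strongly connected (every section $S(a,b)=\{c: a\le c\le b\}$, including the whole poset, is connected, meaning that it has rank difference at most $2$ or that any two elements other than $a,b$ are joined by a finite sequence of elements other than $a,b$ in which consecutive elements are comparable). It is equivar if all sections $S(\emptyset,f)$, $f$ a $2$-face, are (face lattices of) $n$-gons for one fixed $n$ and all sections $S(v,D)$, $v$ a vertex, are $\lambda$-gons for one fixed $\lambda$; its Schläfli index is then $\{n,\lambda\}$. Automorphisms are order automorphisms of the poset (equivalently, bijections of the vertex set carrying edges to edges and faces to faces); it is regular if the automorphism group is transitive on flags. For $\alpha\in G$, the $\alpha$-conjugacy classes are the orbits of $\langle\alpha\rangle$ acting on $G$ by conjugation; two elements are $\alpha$-conjugate if they lie in the same $\alpha$-conjugacy class. *)

theory Defs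
  imports "HOL-Algebra.Algebra"
begin

section \<open>Abstract simplicial complexes\<close>

text \<open>A complex is the set of its nonempty simplices, and a simplex is the set of its vertices.\<close>

type_synonym 'v complex = "'v set set"

definition closed_simplex :: "'v set \<Rightarrow> 'v complex" where
  "closed_simplex \<sigma> = {\<tau>. \<tau> \<noteq> {} \<and> \<tau> \<subseteq> \<sigma>}"

definition link :: "'v complex \<Rightarrow> 'v \<Rightarrow> 'v complex" where
  "link K v = {\<sigma>. \<sigma> \<noteq> {} \<and> v \<notin> \<sigma> \<and> insert v \<sigma> \<in> K}"

definition closed_star :: "'v complex \<Rightarrow> 'v \<Rightarrow> 'v complex" where
  "closed_star K v = {\<sigma> \<in> K. insert v \<sigma> \<in> K}"

definition edge_rel :: "'v complex \<Rightarrow> 'v rel" where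
  "edge_rel K = {(u, v). {u, v} \<in> K}"

text \<open>The connected component, as a subcomplex, that contains the simplex \<open>\<sigma>\<close>.\<close>

definition component_of :: "'v complex \<Rightarrow> 'v set \<Rightarrow> 'v complex" where
  "component_of K \<sigma> = {\<tau> \<in> K. \<exists>u\<in>\<sigma>. \<exists>v\<in>\<tau>. (u, v) \<in> (edge_rel K)\<^sup>*}"

definition components :: "'v complex \<Rightarrow> 'v complex set" where
  "components K = component_of K ` K"

text \<open>Desingularization: a vertex \<open>v\<close> is replaced by the pairs \<open>(v, C)\<close>, where \<open>C\<close> runs over the
  components of the link of \<open>v\<close> (for the complexes of interest, the circles). A simplex \<open>\<sigma>\<close> of
  positive dimension survives as one simplex; near its corner \<open>v\<close> it lies on the sheet given by
  the component of the link that contains \<open>\<sigma> - {v}\<close>.\<close>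

type_synonym 'v sheet_vertex = "'v \<times> 'v complex"

definition lift_simplex :: "'v complex \<Rightarrow> 'v set \<Rightarrow> 'v sheet_vertex set" where
  "lift_simplex K \<sigma> = (\<lambda>v. (v, component_of (link K v) (\<sigma> - {v}))) ` \<sigma>"

definition desingularization :: "'v complex \<Rightarrow> 'v sheet_vertex complex" where
  "desingularization K =
     {{(v, C)} | v C. {v} \<in> K \<and> C \<in> components (link K v)}
     \<union> lift_simplex K ` {\<sigma> \<in> K. card \<sigma> \<ge> 2}"


section \<open>The complex of a group and its surfaces\<close>

definition group_center :: "('a, 'b) monoid_scheme \<Rightarrow> 'a set" where
  "group_center G = {z \<in> carrier G. \<forall>g\<in>carrier G. z \<otimes>\<^bsub>G\<^esub> g = g \<otimes>\<^bsub>G\<^esub> z}"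

definition noncommuting :: "('a, 'b) monoid_scheme \<Rightarrow> 'a \<Rightarrow> 'a \<Rightarrow> bool" where
  "noncommuting G x y \<longleftrightarrow>
     x \<in> carrier G \<and> y \<in> carrier G \<and> x \<otimes>\<^bsub>G\<^esub> y \<noteq> y \<otimes>\<^bsub>G\<^esub> x"

text \<open>The second component of a vertex is its type, \<open>1\<close> or \<open>2\<close>.\<close>

definition X_complex :: "('a, 'b) monoid_scheme \<Rightarrow> ('a \<times> nat) complex" where
  "X_complex G =
     {{(x, i)} | x i. x \<in> carrier G - group_center G \<and> i \<in> {1, 2}}
     \<union> {{(x, 1), (y, 1)} | x y. noncommuting G x y}
     \<union> {{(x, 1), (y, 2)} | x y. noncommuting G x y}
     \<union> {{(x, 1), (y, 1), (x \<otimes>\<^bsub>G\<^esub> y, 2)} | x y. noncommuting G x y}"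

definition Y_complex :: "('a, 'b) monoid_scheme \<Rightarrow> ('a \<times> nat) sheet_vertex complex" where
  "Y_complex G = desingularization (X_complex G)"

definition Y_component ::
  "('a, 'b) monoid_scheme \<Rightarrow> 'a \<Rightarrow> 'a \<Rightarrow> ('a \<times> nat) sheet_vertex complex" where
  "Y_component G x y =
     component_of (Y_complex G) (lift_simplex (X_complex G) {(x, 1), (y, 1), (x \<otimes>\<^bsub>G\<^esub> y, 2)})"

definition vertex_type :: "('a \<times> nat) sheet_vertex \<Rightarrow> nat" where
  "vertex_type p = snd (fst p)"

text \<open>The cells of the coarser cell structure on a component \<open>T\<close>. A closed cell is represented by
  the subcomplex of \<open>T\<close> that triangulates it, so that inclusion of closed cells is inclusion of
  subcomplexes. Vertex sets would not do: distinct polygons may have the same corners, and an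
  edge joining two corners of a polygon need not be one of its sides.\<close>

type_synonym 'a cell = "('a \<times> nat) sheet_vertex complex"

definition vertex_cells :: "('a \<times> nat) sheet_vertex complex \<Rightarrow> 'a cell set" where
  "vertex_cells T = {closed_simplex {p} | p. {p} \<in> T \<and> vertex_type p = 1}"

definition edge_cells :: "('a \<times> nat) sheet_vertex complex \<Rightarrow> 'a cell set" where
  "edge_cells T = {closed_simplex {p, q} | p q.
     {p, q} \<in> T \<and> p \<noteq> q \<and> vertex_type p = 1 \<and> vertex_type q = 1}"

definition polygon_cells :: "('a \<times> nat) sheet_vertex complex \<Rightarrow> 'a cell set" where
  "polygon_cells T = {closed_star T p | p. {p} \<in> T \<and> vertex_type p = 2}"

definition valency :: "('a \<times> nat) sheet_vertex complex \<Rightarrow> 'a cell \<Rightarrow> nat" where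
  "valency T v = card {e \<in> edge_cells T. v \<subseteq> e}"


section \<open>Ranked posets and abstract 3-polytopes\<close>

text \<open>A poset is given by its reflexive order relation \<open>r\<close>, with underlying set \<open>Field r\<close>.\<close>

definition order_iso :: "'p rel \<Rightarrow> 'q rel \<Rightarrow> ('p \<Rightarrow> 'q) \<Rightarrow> bool" where
  "order_iso r s f \<longleftrightarrow> bij_betw f (Field r) (Field s) \<and>
     (\<forall>a\<in>Field r. \<forall>b\<in>Field r. (a, b) \<in> r \<longleftrightarrow> (f a, f b) \<in> s)"

definition order_automorphisms :: "'p rel \<Rightarrow> ('p \<Rightarrow> 'p) set" where
  "order_automorphisms r = {f. order_iso r r f}"

definition flags :: "'p rel \<Rightarrow> 'p set set" where
  "flags r = {C \<in> Chains r. \<forall>C'\<in>Chains r. C \<subseteq> C' \<longrightarrow> C' = C}"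

definition order_section :: "'p rel \<Rightarrow> 'p \<Rightarrow> 'p \<Rightarrow> 'p rel" where
  "order_section r a b = Restr r {c. (a, c) \<in> r \<and> (c, b) \<in> r}"

definition rank_set :: "'p rel \<Rightarrow> ('p \<Rightarrow> int) \<Rightarrow> int \<Rightarrow> 'p set" where
  "rank_set r rk i = {a \<in> Field r. rk a = i}"

definition ranked_poset :: "'p rel \<Rightarrow> ('p \<Rightarrow> int) \<Rightarrow> bool" where
  "ranked_poset r rk \<longleftrightarrow> Partial_order r \<and>
     (\<forall>a b. (a, b) \<in> r \<and> a \<noteq> b \<longrightarrow> rk a < rk b) \<and>
     (\<forall>a b. (a, b) \<in> r \<and> a \<noteq> b \<and> (\<forall>c. (a, c) \<in> r \<and> (c, b) \<in> r \<longrightarrow> c = a \<or> c = b)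
        \<longrightarrow> rk b = rk a + 1)"

definition diamond_condition :: "'p rel \<Rightarrow> ('p \<Rightarrow> int) \<Rightarrow> bool" where
  "diamond_condition r rk \<longleftrightarrow>
     (\<forall>a b. (a, b) \<in> r \<and> rk b - rk a = 2
        \<longrightarrow> card {c. (a, c) \<in> r \<and> (c, b) \<in> r \<and> c \<noteq> a \<and> c \<noteq> b} = 2)"

definition section_connected :: "'p rel \<Rightarrow> ('p \<Rightarrow> int) \<Rightarrow> 'p \<Rightarrow> 'p \<Rightarrow> bool" where
  "section_connected r rk a b \<longleftrightarrow> rk b - rk a \<le> 2 \<or>
     (let M = Field (order_section r a b) - {a, b} in
      \<forall>c\<in>M. \<forall>d\<in>M. (c, d) \<in> (Restr (r \<union> r\<inverse>) M)\<^sup>*)"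

definition abstract_3_polytope :: "'p rel \<Rightarrow> ('p \<Rightarrow> int) \<Rightarrow> bool" where
  "abstract_3_polytope r rk \<longleftrightarrow>
     ranked_poset r rk \<and> rk ` Field r = {-1..3} \<and>
     (\<exists>l\<in>Field r. rk l = -1 \<and> (\<forall>a\<in>Field r. (l, a) \<in> r)) \<and>
     (\<exists>g\<in>Field r. rk g = 3 \<and> (\<forall>a\<in>Field r. (a, g) \<in> r)) \<and>
     (\<forall>C\<in>flags r. card C = 5) \<and>
     diamond_condition r rk \<and>
     (\<forall>a b. (a, b) \<in> r \<longrightarrow> section_connected r rk a b)"

text \<open>The face lattice of the \<open>n\<close>-gon: edge \<open>j\<close> joins vertices \<open>j\<close> and \<open>j + 1\<close> modulo \<open>n\<close>. Here
  \<open>n = 2\<close> gives the digon, which does occur as a section at a vertex (of valency 2).\<close>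

datatype ngon_face = NEmpty | NVertex nat | NEdge nat | NWhole

definition ngon_order :: "nat \<Rightarrow> ngon_face rel" where
  "ngon_order n =
     (let F = {NEmpty, NWhole} \<union> NVertex ` {..<n} \<union> NEdge ` {..<n} in
      {(a, b). a \<in> F \<and> b \<in> F \<and>
         (a = b \<or> a = NEmpty \<or> b = NWhole \<or>
          (\<exists>j. b = NEdge j \<and> (a = NVertex j \<or> a = NVertex (Suc j mod n))))})"

definition is_ngon :: "nat \<Rightarrow> 'p rel \<Rightarrow> bool" where
  "is_ngon n r \<longleftrightarrow> n \<ge> 2 \<and> (\<exists>f. order_iso r (ngon_order n) f)"

definition has_schlafli_index :: "'p rel \<Rightarrow> ('p \<Rightarrow> int) \<Rightarrow> nat \<Rightarrow> nat \<Rightarrow> bool" where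
  "has_schlafli_index r rk n l \<longleftrightarrow>
     (\<forall>e\<in>rank_set r rk (-1). \<forall>f\<in>rank_set r rk 2. is_ngon n (order_section r e f)) \<and>
     (\<forall>v\<in>rank_set r rk 0. \<forall>d\<in>rank_set r rk 3. is_ngon l (order_section r v d))"

definition equivar :: "'p rel \<Rightarrow> ('p \<Rightarrow> int) \<Rightarrow> bool" where
  "equivar r rk \<longleftrightarrow> (\<exists>n l. has_schlafli_index r rk n l)"

definition rank_transitive :: "'p rel \<Rightarrow> ('p \<Rightarrow> int) \<Rightarrow> int \<Rightarrow> bool" where
  "rank_transitive r rk i \<longleftrightarrow>
     (\<forall>a\<in>rank_set r rk i. \<forall>b\<in>rank_set r rk i. \<exists>f\<in>order_automorphisms r. f a = b)"

definition flag_transitive :: "'p rel \<Rightarrow> bool" where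
  "flag_transitive r \<longleftrightarrow>
     (\<forall>C\<in>flags r. \<forall>D\<in>flags r. \<exists>f\<in>order_automorphisms r. f ` C = D)"


section \<open>The face poset of a component\<close>

datatype 'c face = Cell 'c | Greatest

fun face_le :: "'s set face \<Rightarrow> 's set face \<Rightarrow> bool" where
  "face_le _ Greatest \<longleftrightarrow> True"
| "face_le Greatest (Cell _) \<longleftrightarrow> False"
| "face_le (Cell A) (Cell B) \<longleftrightarrow> A \<subseteq> B"

definition faces :: "('a \<times> nat) sheet_vertex complex \<Rightarrow> 'a cell face set" where
  "faces T = {Cell {}} \<union> Cell ` vertex_cells T \<union> Cell ` edge_cells T \<union> Cell ` polygon_cells T
     \<union> {Greatest}"

definition face_poset :: "('a \<times> nat) sheet_vertex complex \<Rightarrow> 'a cell face rel" where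
  "face_poset T = {(a, b). a \<in> faces T \<and> b \<in> faces T \<and> face_le a b}"

definition face_rank :: "('a \<times> nat) sheet_vertex complex \<Rightarrow> 'a cell face \<Rightarrow> int" where
  "face_rank T a =
     (case a of
        Greatest \<Rightarrow> 3
      | Cell A \<Rightarrow>
          if A = {} then -1
          else if A \<in> vertex_cells T then 0
          else if A \<in> edge_cells T then 1
          else 2)"


section \<open>Relative conjugacy classes\<close>

definition rel_conj_class :: "('a, 'b) monoid_scheme \<Rightarrow> 'a \<Rightarrow> 'a \<Rightarrow> 'a set" where
  "rel_conj_class G \<alpha> g =
     orbit (subgroup_generated G {\<alpha>}) (\<lambda>h k. h \<otimes>\<^bsub>G\<^esub> k \<otimes>\<^bsub>G\<^esub> inv\<^bsub>G\<^esub> h) g"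

definition rel_conjugate :: "('a, 'b) monoid_scheme \<Rightarrow> 'a \<Rightarrow> 'a \<Rightarrow> 'a \<Rightarrow> bool" where
  "rel_conjugate G \<alpha> g h \<longleftrightarrow> h \<in> rel_conj_class G \<alpha> g"

end

theory Submission
  imports Defs
begin

text \<open>A noncommuting pair \<open>(a, b)\<close> is a triangle of \<open>Y(G)\<close>, and equally a dart of the coarser cell
  structure, running from \<open>(a, 1)\<close> to \<open>(b, 1)\<close> along the polygon about \<open>(ab, 2)\<close>. The dart is
  reversed by \<open>\<sigma>(a, b) = (b, a)\<close>, moved along its polygon by \<open>\<rho>(a, b) = (b, b\<inverse>ab)\<close>, and turned
  about its initial vertex by \<open>\<tau>(a, b) = (a, aba\<inverse>)\<close>. Edges, polygons and vertices of a component are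
  the orbits of \<open>\<sigma>\<close>, \<open>\<rho>\<close> and \<open>\<tau>\<close> inside one orbit of \<open>\<langle>\<sigma>, \<rho>\<rangle>\<close>, and two cells are incident iff they
  share a dart; the polytope axioms follow since an edge has two different ends and two different
  sides, and a vertex occurs only once on a polygon.

  Conjugation by \<open>b\<inverse>\<close> carries \<open>(a, b)\<close> to \<open>\<sigma>(\<rho>(a, b))\<close>, which gives edge and polygon transitivity
  for free. If \<open>x\<close> and \<open>y\<close> are \<open>xy\<close>-conjugate, or in the situation of (5), some automorphism
  carries \<open>(x, y)\<close> to \<open>\<rho>(x, y)\<close> as well, and then all darts are equivalent. The antiautomorphism
  \<open>g \<mapsto> \<phi>(g)\<inverse>\<close> fixes the triangle of \<open>(x, y)\<close> and exchanges \<open>x\<close> and \<open>y\<close>: it is the reflection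
  needed for flag transitivity.\<close>

section \<open>Orders, automorphisms and polygons\<close>

text \<open>The obstacle is the passage from the given cells, which are subcomplexes of a
  desingularization, to orbits of darts. It rests on reading the links: the circle in the link of
  \<open>(a, 1)\<close> through \<open>(b, 1)\<close> runs b, ab, aba^-1, ..., with types 1 and 2
  alternating, and the circle in the link of \<open>(ab, 2)\<close> runs a, b, b^-1ab, .... All
  order theory is kept apart from the group, in a setting where the rotations are tied together only
  by \<open>\<tau> (\<rho> d) = \<sigma> d\<close>. Since the darts are finite in number, forward
  iterates fill whole orbits and no inverse rotation has to be named. Noncommutativity is what gives
  an edge two sides: the triangles of \<open>(a, b)\<close> and \<open>(b, a)\<close> meet along it,
  and their polygons have the different centres ab and ba. Conjugation makes \<open>d\<close>
  equivalent to \<open>\<sigma> (\<rho> d)\<close>, which leaves at most two classes of darts, those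
  of \<open>(x, y)\<close> and \<open>(y, x)\<close>; hence there are at most two valencies, and
  these are the class sizes compared in (2). A reflection reverses the rotations, so it moves
  vertices by a different dart map than edges and polygons.\<close>

lemma order_iso_comp:
  assumes "order_iso r s f" and "order_iso s t g"
  shows "order_iso r t (g \<circ> f)"
  using assms bij_betw_trans[of f "Field r" "Field s" g "Field t"]
  by (auto simp: order_iso_def bij_betw_apply)

lemma order_iso_inv_into:
  assumes "order_iso r s f"
  shows "order_iso s r (inv_into (Field r) f)"
proof -
  have b: "bij_betw f (Field r) (Field s)"
    using assms by (simp add: order_iso_def)
  then have b': "bij_betw (inv_into (Field r) f) (Field s) (Field r)"
    by (rule bij_betw_inv_into)
  have "(u, v) \<in> s \<longleftrightarrow> (inv_into (Field r) f u, inv_into (Field r) f v) \<in> r"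
    if "u \<in> Field s" "v \<in> Field s" for u v
  proof -
    have "inv_into (Field r) f u \<in> Field r" "inv_into (Field r) f v \<in> Field r"
      using bij_betw_apply[OF b'] that by blast+
    moreover have "f (inv_into (Field r) f u) = u" "f (inv_into (Field r) f v) = v"
      using bij_betw_inv_into_right[OF b] that by blast+
    ultimately show ?thesis
      using assms by (auto simp: order_iso_def)
  qed
  with b' show ?thesis
    by (simp add: order_iso_def)
qed

lemma order_automorphisms_comp:
  assumes "f \<in> order_automorphisms r" and "g \<in> order_automorphisms r"
  shows "g \<circ> f \<in> order_automorphisms r"
  using assms order_iso_comp by (auto simp: order_automorphisms_def)

lemma order_automorphisms_inv_into:
  assumes "f \<in> order_automorphisms r"
  shows "inv_into (Field r) f \<in> order_automorphisms r"
  using assms order_iso_inv_into by (auto simp: order_automorphisms_def)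

text \<open>On a finite poset reflection of the order is free: \<open>map_prod f f\<close> maps the
  finite set \<open>r\<close> injectively into itself, hence onto, so a related pair of values comes
  from a related pair.\<close>

lemma order_automorphismI:
  assumes "finite (Field r)" and surj: "f ` Field r = Field r"
    and mono: "\<And>a b. (a, b) \<in> r \<Longrightarrow> (f a, f b) \<in> r"
  shows "f \<in> order_automorphisms r"
proof -
  have inj: "inj_on f (Field r)"
    using assms by (simp add: eq_card_imp_inj_on)
  have sub: "r \<subseteq> Field r \<times> Field r"
    by (auto simp: Field_def)
  then have "finite r"
    using assms(1) finite_subset by blast
  moreover have "inj_on (map_prod f f) r"
    using map_prod_inj_on[OF inj inj] sub inj_on_subset by blast
  moreover have "map_prod f f ` r \<subseteq> r"
    using mono by auto
  ultimately have "map_prod f f ` r = r"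
    by (simp add: endo_inj_surj)
  then have refl: "(a, b) \<in> r" if "(f a, f b) \<in> r" "a \<in> Field r" "b \<in> Field r" for a b
  proof -
    have "(f a, f b) \<in> map_prod f f ` r"
      using that \<open>map_prod f f ` r = r\<close> by simp
    then obtain a' b' where "(a', b') \<in> r" "f a = f a'" "f b = f b'"
      by auto
    then show ?thesis
      using inj_onD[OF inj] that sub by blast
  qed
  show ?thesis
    using inj surj mono refl
    unfolding order_automorphisms_def order_iso_def bij_betw_def by blast
qed

text \<open>Working with sets treats points (as singletons) and flags uniformly.\<close>

definition aut_equiv :: "'p rel \<Rightarrow> 'p set \<Rightarrow> 'p set \<Rightarrow> bool" where
  "aut_equiv r A B \<longleftrightarrow> (\<exists>f\<in>order_automorphisms r. f ` A = B)"

lemma aut_equiv_trans: "aut_equiv r A B \<Longrightarrow> aut_equiv r B C \<Longrightarrow> aut_equiv r A C"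
  unfolding aut_equiv_def
proof (elim bexE)
  fix f g assume "f \<in> order_automorphisms r" "f ` A = B" "g \<in> order_automorphisms r" "g ` B = C"
  then show "\<exists>h\<in>order_automorphisms r. h ` A = C"
    by (intro bexI[of _ "g \<circ> f"] order_automorphisms_comp) auto
qed

text \<open>An order automorphism is an arbitrary function off \<open>Field r\<close>, so it is
  inverted only on sets inside the field.\<close>

lemma aut_equiv_sym:
  assumes "aut_equiv r A B" and "A \<subseteq> Field r"
  shows "aut_equiv r B A"
proof -
  obtain f where f: "f \<in> order_automorphisms r" "f ` A = B"
    using assms(1) by (auto simp: aut_equiv_def)
  then have "inj_on f (Field r)"
    by (auto simp: order_automorphisms_def order_iso_def bij_betw_def)
  then have "inv_into (Field r) f ` B = A"
    using inv_into_image_cancel[of f "Field r" A] f(2) assms(2) by simp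
  then show ?thesis
    using order_automorphisms_inv_into[OF f(1)] by (auto simp: aut_equiv_def)
qed

lemma rank_transitiveI:
  assumes "\<And>a. a \<in> rank_set r rk i \<Longrightarrow> aut_equiv r {c} {a}" and "c \<in> Field r"
  shows "rank_transitive r rk i"
  unfolding rank_transitive_def
proof (intro ballI)
  fix a b assume "a \<in> rank_set r rk i" "b \<in> rank_set r rk i"
  then have "aut_equiv r {a} {b}"
    using assms aut_equiv_trans aut_equiv_sym by (metis empty_subsetI insert_subset)
  then show "\<exists>f\<in>order_automorphisms r. f a = b"
    by (auto simp: aut_equiv_def)
qed

lemma Field_order_section:
  assumes "Partial_order r"
  shows "Field (order_section r a b) = {c. (a, c) \<in> r \<and> (c, b) \<in> r}"
proof -
  have "(c, c) \<in> r" if "(a, c) \<in> r" for c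
    using assms that
    by (auto simp: partial_order_on_def preorder_on_def refl_on_def Field_def)
  then show ?thesis
    by (auto simp: order_section_def Field_def)
qed

lemma order_iso_order_section:
  assumes "Partial_order r" and f: "f \<in> order_automorphisms r"
    and "a \<in> Field r" "b \<in> Field r"
  shows "order_iso (order_section r a b) (order_section r (f a) (f b)) f"
proof -
  have bij: "bij_betw f (Field r) (Field r)"
    and ord: "\<And>u v. u \<in> Field r \<Longrightarrow> v \<in> Field r \<Longrightarrow> (u, v) \<in> r \<longleftrightarrow> (f u, f v) \<in> r"
    using f by (auto simp: order_automorphisms_def order_iso_def)
  let ?A = "{c. (a, c) \<in> r \<and> (c, b) \<in> r}" and ?B = "{c. (f a, c) \<in> r \<and> (c, f b) \<in> r}"
  have sub: "?A \<subseteq> Field r" "?B \<subseteq> Field r"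
    by (auto simp: Field_def)
  have "?B \<subseteq> f ` ?A"
  proof
    fix c assume c: "c \<in> ?B"
    then obtain c' where "c' \<in> Field r" "c = f c'"
      using sub(2) bij_betw_imp_surj_on[OF bij] by blast
    with c ord[of a c'] ord[of c' b] assms(3,4) show "c \<in> f ` ?A"
      by simp
  qed
  moreover have "f ` ?A \<subseteq> ?B"
    using ord assms(3,4) sub by blast
  ultimately have "bij_betw f ?A ?B"
    using inj_on_subset[OF bij_betw_imp_inj_on[OF bij] sub(1)] unfolding bij_betw_def by blast
  moreover have "(u, v) \<in> order_section r a b \<longleftrightarrow> (f u, f v) \<in> order_section r (f a) (f b)"
    if "u \<in> ?A" "v \<in> ?A" for u v
  proof -
    have "f u \<in> ?B" "f v \<in> ?B"
      using that \<open>f ` ?A \<subseteq> ?B\<close> by blast+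
    with that ord[of u v] sub(1) show ?thesis
      by (auto simp: order_section_def)
  qed
  ultimately show ?thesis
    by (simp add: order_iso_def Field_order_section[OF assms(1)])
qed

lemma is_ngon_automorphism:
  assumes "Partial_order r" "f \<in> order_automorphisms r" "a \<in> Field r" "b \<in> Field r"
    and "is_ngon n (order_section r a b)"
  shows "is_ngon n (order_section r (f a) (f b))"
  using assms order_iso_order_section order_iso_inv_into order_iso_comp
  unfolding is_ngon_def by metis

section \<open>Face lattices of polygons\<close>

lemma Field_ngon_order:
  "Field (ngon_order n) = {NEmpty, NWhole} \<union> NVertex ` {..<n} \<union> NEdge ` {..<n}"
  by (auto simp: ngon_order_def Field_def)

text \<open>Counting faces decides, since a k-gon has \<open>2 + 2 * k\<close> of them. This is what
  later identifies the second Schlaefli entry with the valency.\<close>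

lemma is_ngon_unique:
  assumes "is_ngon m r" and "is_ngon n r"
  shows "m = n"
proof -
  have "card (Field (ngon_order k)) = 2 + 2 * k" for k
  proof -
    have "card (NVertex ` {..<k} \<union> NEdge ` {..<k}) = k + k"
      by (subst card_Un_disjoint) (auto simp: card_image inj_on_def)
    then show ?thesis
      unfolding Field_ngon_order Un_assoc by (subst card_Un_disjoint) auto
  qed
  then have "card (Field r) = 2 + 2 * k" if "is_ngon k r" for k
    using that bij_betw_same_card by (fastforce simp: is_ngon_def order_iso_def)
  from this[OF assms(1)] this[OF assms(2)] show ?thesis
    by simp
qed

definition cyclic_order :: "'p \<Rightarrow> 'p \<Rightarrow> (nat \<Rightarrow> 'p) \<Rightarrow> (nat \<Rightarrow> 'p) \<Rightarrow> 'p rel" where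
  "cyclic_order a b lo hi =
     (let M = range lo \<union> range hi in
      insert a M \<times> {b} \<union> {a} \<times> insert b M \<union> Id_on ({a, b} \<union> M)
      \<union> {(lo j, hi j) | j. True} \<union> {(lo (Suc j), hi j) | j. True})"

lemma is_ngon_cyclic_order:
  assumes "k \<ge> 2"
    and lo: "\<And>i j. lo i = lo j \<longleftrightarrow> i mod k = j mod k"
    and hi: "\<And>i j. hi i = hi j \<longleftrightarrow> i mod k = j mod k"
    and ne: "\<And>i j. lo i \<noteq> hi j" "a \<noteq> b" "\<And>i. a \<noteq> lo i" "\<And>i. a \<noteq> hi i"
      "\<And>i. b \<noteq> lo i" "\<And>i. b \<noteq> hi i"
  shows "is_ngon k (cyclic_order a b lo hi)"
proof -
  \<comment> \<open>The recursor is a mere case distinction here, with arguments in the order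
    \<open>NEmpty\<close>, \<open>NVertex\<close>, \<open>NEdge\<close>,
    \<open>NWhole\<close>.\<close>
  define g where "g = rec_ngon_face a lo hi b"
  have g: "g NEmpty = a" "g NWhole = b" "g (NVertex i) = lo i" "g (NEdge i) = hi i" for i
    by (simp_all add: g_def)
  have ne': "lo i \<noteq> hi j" "hi j \<noteq> lo i" "a \<noteq> b" "b \<noteq> a" "a \<noteq> lo i" "a \<noteq> hi i" "b \<noteq> lo i" "b \<noteq> hi i"
    "lo i \<noteq> a" "hi i \<noteq> a" "lo i \<noteq> b" "hi i \<noteq> b" for i j
    by (simp_all add: ne ne[symmetric])
  have img: "range h = h ` {..<k}" if "\<And>i j. h i = h j \<longleftrightarrow> i mod k = j mod k" for h :: "nat \<Rightarrow> 'a"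
  proof -
    have "h i \<in> h ` {..<k}" for i
    proof
      show "h i = h (i mod k)" using that by simp
      show "i mod k \<in> {..<k}" using \<open>k \<ge> 2\<close> by simp
    qed
    then show ?thesis by blast
  qed
  have fld: "Field (cyclic_order a b lo hi) = {a, b} \<union> range lo \<union> range hi"
    by (auto simp: cyclic_order_def Field_def Let_def)
  have "g ` Field (ngon_order k) = Field (cyclic_order a b lo hi)"
    by (simp add: Field_ngon_order fld img[OF lo] img[OF hi] image_Un image_image g insert_commute)
  moreover have "inj_on g (Field (ngon_order k))"
    by (auto simp: inj_on_def Field_ngon_order g ne' lo hi)
  ultimately have bij: "bij_betw g (Field (ngon_order k)) (Field (cyclic_order a b lo hi))"
    by (simp add: bij_betw_def)
  have lohi: "(lo i, hi j) \<in> cyclic_order a b lo hi \<longleftrightarrow> i = j \<or> i = Suc j mod k"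
    if "i < k" "j < k" for i j
  proof -
    have "(lo i, hi j) \<in> cyclic_order a b lo hi \<longleftrightarrow>
        (\<exists>j'. lo i = lo j' \<and> hi j = hi j') \<or> (\<exists>j'. lo i = lo (Suc j') \<and> hi j = hi j')"
      by (auto simp: cyclic_order_def Let_def ne')
    also have "\<dots> \<longleftrightarrow> i = j \<or> i = Suc j mod k"
    proof -
      have "Suc j' mod k = Suc j mod k" if "j mod k = j' mod k" for j'
        using that by (metis mod_Suc_eq)
      then show ?thesis
        using that unfolding lo hi by (metis mod_less)
    qed
    finally show ?thesis .
  qed
  have other: "(hi i, lo j) \<notin> cyclic_order a b lo hi" "(b, lo j) \<notin> cyclic_order a b lo hi"
    "(b, hi j) \<notin> cyclic_order a b lo hi" "(b, a) \<notin> cyclic_order a b lo hi"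
    "(lo j, a) \<notin> cyclic_order a b lo hi" "(hi j, a) \<notin> cyclic_order a b lo hi"
    "(a, a) \<in> cyclic_order a b lo hi" "(a, b) \<in> cyclic_order a b lo hi"
    "(b, b) \<in> cyclic_order a b lo hi" "(a, lo j) \<in> cyclic_order a b lo hi"
    "(a, hi j) \<in> cyclic_order a b lo hi" "(lo j, b) \<in> cyclic_order a b lo hi"
    "(hi j, b) \<in> cyclic_order a b lo hi"
    "(lo i, lo j) \<in> cyclic_order a b lo hi \<longleftrightarrow> lo i = lo j"
    "(hi i, hi j) \<in> cyclic_order a b lo hi \<longleftrightarrow> hi i = hi j" for i j
    by (auto simp: cyclic_order_def Let_def ne')
  have "\<forall>u\<in>Field (ngon_order k). \<forall>v\<in>Field (ngon_order k).
      (u, v) \<in> ngon_order k \<longleftrightarrow> (g u, g v) \<in> cyclic_order a b lo hi"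
    unfolding Field_ngon_order
    by (auto simp: g lohi other lo hi) (auto simp: ngon_order_def Let_def)
  then have "order_iso (ngon_order k) (cyclic_order a b lo hi) g"
    using bij by (simp add: order_iso_def)
  then show ?thesis
    using order_iso_inv_into \<open>k \<ge> 2\<close> by (auto simp: is_ngon_def)
qed

text \<open>The zigzag \<open>lo 0\<close>, \<open>hi 0\<close>, \<open>lo 1\<close>,
  \<open>hi 1\<close>, ... passes through every element of \<open>M\<close>.\<close>

lemma cyclic_order_connected:
  assumes "range lo \<union> range hi \<subseteq> M" "cyclic_order a b lo hi \<subseteq> r"
    and "M \<subseteq> range lo \<union> range hi" "c \<in> M" "d \<in> M"
  shows "(c, d) \<in> (Restr (r \<union> r\<inverse>) M)\<^sup>*"
proof -
  let ?R = "Restr (r \<union> r\<inverse>) M"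
  have "(lo j, hi j) \<in> r" "(lo (Suc j), hi j) \<in> r" for j
    using assms(2) by (auto simp: cyclic_order_def Let_def)
  then have R: "(lo j, hi j) \<in> ?R" "(hi j, lo (Suc j)) \<in> ?R" for j
    using assms(1) by auto
  have lo: "(lo 0, lo j) \<in> ?R\<^sup>*" for j
  proof (induction j)
    case (Suc j)
    then show ?case using R[of j] by (meson rtrancl.rtrancl_into_rtrancl)
  qed simp
  then have hi: "(lo 0, hi j) \<in> ?R\<^sup>*" for j
    using R[of j] by (meson rtrancl.rtrancl_into_rtrancl)
  have "sym ?R" by (auto simp: sym_def)
  then have s: "sym (?R\<^sup>*)" by (rule sym_rtrancl)
  have "(lo 0, c) \<in> ?R\<^sup>*" "(lo 0, d) \<in> ?R\<^sup>*"
    using assms(3-5) lo hi by auto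
  then show ?thesis
    using s by (meson rtrancl_trans symD)
qed

text \<open>If rank \<open>i\<close> were skipped, the two members of \<open>C\<close> closest to it
  from below and above would not form a covering pair. An element strictly between them is
  comparable to all of \<open>C\<close>, so maximality puts it into \<open>C\<close>, closer to rank
  \<open>i\<close> than allowed.\<close>

lemma flag_meets_rank:
  assumes rp: "ranked_poset r rk" and C: "C \<in> flags r"
    and "a \<in> C" "b \<in> C" "rk a \<le> i" "i \<le> rk b"
  shows "\<exists>c\<in>C. rk c = i"
proof (rule ccontr)
  assume no: "\<not> (\<exists>c\<in>C. rk c = i)"
  have po: "Partial_order r" and mono: "\<And>u v. (u, v) \<in> r \<Longrightarrow> u \<noteq> v \<Longrightarrow> rk u < rk v"
    using rp by (auto simp: ranked_poset_def)
  have tr: "trans r" and rf: "\<And>u v. (u, v) \<in> r \<Longrightarrow> (u, u) \<in> r \<and> (v, v) \<in> r"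
    using po by (auto simp: partial_order_on_def preorder_on_def refl_on_def Field_def)
  have ch: "\<And>u v. u \<in> C \<Longrightarrow> v \<in> C \<Longrightarrow> (u, v) \<in> r \<or> (v, u) \<in> r"
    and max: "\<And>C'. C' \<in> Chains r \<Longrightarrow> C \<subseteq> C' \<Longrightarrow> C' = C"
    using C by (auto simp: flags_def Chains_def)
  have cmp: "(u, v) \<in> r" if "u \<in> C" "v \<in> C" "rk u < rk v" for u v
    using ch[OF that(1,2)] mono[of v u] that(3) by force
  \<comment> \<open>Integer ranks need not be bounded; the distance to \<open>i\<close> as a natural
    number guarantees that a closest member exists.\<close>
  define a' where "a' = arg_min (\<lambda>c. nat (i - rk c)) (\<lambda>c. c \<in> C \<and> rk c < i)"
  define b' where "b' = arg_min (\<lambda>c. nat (rk c - i)) (\<lambda>c. c \<in> C \<and> rk c > i)"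
  have "a \<in> C \<and> rk a < i" "b \<in> C \<and> rk b > i"
    using assms no by force+
  then have a': "a' \<in> C \<and> rk a' < i" and b': "b' \<in> C \<and> rk b' > i"
    using arg_min_natI[of "\<lambda>c. c \<in> C \<and> rk c < i" a "\<lambda>c. nat (i - rk c)"]
      arg_min_natI[of "\<lambda>c. c \<in> C \<and> rk c > i" b "\<lambda>c. nat (rk c - i)"]
    unfolding a'_def b'_def by simp_all
  have la: "rk c \<le> rk a'" if "c \<in> C" "rk c < i" for c
    using arg_min_nat_le[of "\<lambda>c. c \<in> C \<and> rk c < i" c "\<lambda>c. nat (i - rk c)"] that a'
    by (auto simp: a'_def[symmetric])
  have lb: "rk c \<ge> rk b'" if "c \<in> C" "rk c > i" for c
    using arg_min_nat_le[of "\<lambda>c. c \<in> C \<and> rk c > i" c "\<lambda>c. nat (rk c - i)"] that b'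
    by (auto simp: b'_def[symmetric])
  have ab: "(a', b') \<in> r" "a' \<noteq> b'" "rk b' \<noteq> rk a' + 1"
    using cmp a' b' by force+
  then obtain c where c: "(a', c) \<in> r" "(c, b') \<in> r" "c \<noteq> a'" "c \<noteq> b'"
    using rp unfolding ranked_poset_def by blast
  have "(u, a') \<in> r \<or> (b', u) \<in> r" if "u \<in> C" for u
  proof -
    have "rk u \<noteq> i" using no that by blast
    then consider "rk u \<le> rk a'" | "rk b' \<le> rk u"
      using la[OF \<open>u \<in> C\<close>] lb[OF \<open>u \<in> C\<close>] by (metis linorder_less_linear)
    then show ?thesis
    proof cases
      case 1
      then have "(a', u) \<notin> r \<or> a' = u"
        using mono[of a' u] by force
      then show ?thesis
        using ch[OF that, of a'] a' by auto
    next
      case 2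
      then have "(u, b') \<notin> r \<or> b' = u"
        using mono[of u b'] by force
      then show ?thesis
        using ch[OF that, of b'] b' by auto
    qed
  qed
  then have "(u, c) \<in> r \<or> (c, u) \<in> r" if "u \<in> C" for u
    using c tr that by (meson transD)
  then have "insert c C \<in> Chains r"
    using ch c(1) rf by (auto simp: Chains_def)
  then have "c \<in> C"
    using max by blast
  moreover have "rk a' < rk c" "rk c < rk b'"
    using mono c by auto
  ultimately show False
    using la[of c] lb[of c] no by force
qed

section \<open>Polytopes from rotation systems\<close>

lemma funpow_periodic:
  assumes "finite S" and "bij_betw f S S" and "s \<in> S"
  obtains k where "k > 0" and "\<And>i j. (f ^^ i) s = (f ^^ j) s \<longleftrightarrow> i mod k = j mod k"
proof -
  have inS: "(f ^^ i) s \<in> S" for i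
    using assms by (induction i) (auto dest: bij_betw_apply)
  \<comment> \<open>By injectivity a repetition can be pulled back to index 0, so the sequence of
    iterates is periodic from the start.\<close>
  have cancel: "(f ^^ i) s = s" if "(f ^^ (i + j)) s = (f ^^ j) s" for i j
    using that
  proof (induction j)
    case (Suc j)
    then have "f ((f ^^ (i + j)) s) = f ((f ^^ j) s)"
      by simp
    then show ?case
      using Suc.IH inS assms(2) by (auto simp: bij_betw_def inj_on_def)
  qed simp
  have "\<not> inj (\<lambda>i. (f ^^ i) s)"
  proof
    assume "inj (\<lambda>i. (f ^^ i) s)"
    moreover have "finite (range (\<lambda>i. (f ^^ i) s))"
      using inS by (intro finite_subset[OF _ assms(1)]) blast
    ultimately show False
      using finite_imageD by blast
  qed
  then obtain i j where "i \<noteq> j" "(f ^^ i) s = (f ^^ j) s"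
    by (auto simp: inj_on_def)
  then have ex: "\<exists>k. k > 0 \<and> (f ^^ k) s = s"
    using cancel[of "j - i" i] cancel[of "i - j" j]
    by (intro exI[of _ "if i < j then j - i else i - j"]) auto
  define k where "k = (LEAST k. k > 0 \<and> (f ^^ k) s = s)"
  have k: "k > 0" "(f ^^ k) s = s"
    using LeastI_ex[OF ex] by (simp_all add: k_def)
  have least: "\<not> (i > 0 \<and> (f ^^ i) s = s)" if "i < k" for i
    using that not_less_Least unfolding k_def by blast
  have red: "(f ^^ i) s = (f ^^ (i mod k)) s" for i
  proof -
    have "(f ^^ (k * m)) s = s" for m
      using k(2) by (induction m) (simp_all add: funpow_add)
    then show ?thesis
      by (metis comp_apply funpow_add mod_mult_div_eq)
  qed
  have eq: "i = j" if "i < k" "j < k" "i \<le> j" "(f ^^ i) s = (f ^^ j) s" for i j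
    using cancel[of "j - i" i] least[of "j - i"] that by fastforce
  have "(f ^^ i) s = (f ^^ j) s \<longleftrightarrow> i mod k = j mod k" for i j
  proof
    assume "(f ^^ i) s = (f ^^ j) s"
    then have "(f ^^ (i mod k)) s = (f ^^ (j mod k)) s"
      using red by simp
    then show "i mod k = j mod k"
      using eq[of "i mod k" "j mod k"] eq[of "j mod k" "i mod k"] k(1)
      by (metis linorder_le_cases mod_less_divisor)
  qed (metis red)
  with k(1) that show ?thesis by blast
qed

text \<open>Only forward iterates are used; for a permutation of a finite set this is nevertheless
  an equivalence relation.\<close>

definition same_orbit :: "('d \<Rightarrow> 'd) \<Rightarrow> 'd \<Rightarrow> 'd \<Rightarrow> bool" where
  "same_orbit f d e \<longleftrightarrow> (\<exists>k. e = (f ^^ k) d)"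

lemma same_orbit_refl: "same_orbit f s s"
  unfolding same_orbit_def by (metis funpow_0)

lemma same_orbit_step: "same_orbit f s (f s)"
  unfolding same_orbit_def by (metis funpow_0 funpow_simps_right(2) comp_apply)

lemma same_orbit_trans: "same_orbit f s t \<Longrightarrow> same_orbit f t u \<Longrightarrow> same_orbit f s u"
  unfolding same_orbit_def by (metis funpow_add comp_apply)

lemma same_orbit_sym:
  assumes "finite S" "bij_betw f S S" "s \<in> S" "same_orbit f s t"
  shows "same_orbit f t s"
proof -
  obtain k where k: "k > 0" "\<And>i j. (f ^^ i) s = (f ^^ j) s \<longleftrightarrow> i mod k = j mod k"
    using funpow_periodic[OF assms(1-3)] by blast
  obtain i where t: "t = (f ^^ i) s"
    using assms(4) by (auto simp: same_orbit_def)
  \<comment> \<open>With \<open>k\<close> the period, \<open>i * (k - 1)\<close> further steps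
    complete \<open>i\<close> full rounds and so undo the first \<open>i\<close> steps.\<close>
  have "(f ^^ (i * (k - 1) + i)) s = (f ^^ 0) s"
  proof -
    have "i * (k - 1) + i = i * k"
      using k(1) by (cases k) simp_all
    then show ?thesis
      unfolding k(2) by simp
  qed
  then have "s = (f ^^ (i * (k - 1))) t"
    by (simp add: t funpow_add)
  then show ?thesis
    by (auto simp: same_orbit_def)
qed

text \<open>The darts of an oriented map are its edges with a chosen initial vertex; \<open>\<sigma>\<close> reverses a
  dart, \<open>\<rho>\<close> moves it one step around the face on one side of it, and \<open>\<tau>\<close> turns it around its
  initial vertex. The cells are the orbits, and two cells are incident if they share a dart.\<close>

locale dart_map =
  fixes D :: "'d set" and \<sigma> \<rho> \<tau> :: "'d \<Rightarrow> 'd" and d0 :: 'd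
    and V E F :: "'d \<Rightarrow> 'p" and lb ub :: 'p and r :: "'p rel" and rk :: "'p \<Rightarrow> int"
  assumes finite_D: "finite D" and d0: "d0 \<in> D"
    and \<sigma>_in: "d \<in> D \<Longrightarrow> \<sigma> d \<in> D" and \<sigma>_\<sigma>: "d \<in> D \<Longrightarrow> \<sigma> (\<sigma> d) = d"
    and bij_\<rho>: "bij_betw \<rho> D D" and bij_\<tau>: "bij_betw \<tau> D D"
    and \<tau>_\<rho>: "d \<in> D \<Longrightarrow> \<tau> (\<rho> d) = \<sigma> d"
    and D_minimal: "d0 \<in> S \<Longrightarrow> S \<subseteq> D \<Longrightarrow> (\<And>d. d \<in> S \<Longrightarrow> \<sigma> d \<in> S) \<Longrightarrow> (\<And>d. d \<in> S \<Longrightarrow> \<rho> d \<in> S) \<Longrightarrow> S = D"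
    and V_eq: "d \<in> D \<Longrightarrow> e \<in> D \<Longrightarrow> V d = V e \<longleftrightarrow> same_orbit \<tau> d e"
    and F_eq: "d \<in> D \<Longrightarrow> e \<in> D \<Longrightarrow> F d = F e \<longleftrightarrow> same_orbit \<rho> d e"
    and E_eq: "d \<in> D \<Longrightarrow> e \<in> D \<Longrightarrow> E d = E e \<longleftrightarrow> e = d \<or> e = \<sigma> d"
    and V_\<sigma>: "d \<in> D \<Longrightarrow> V (\<sigma> d) \<noteq> V d" and F_\<sigma>: "d \<in> D \<Longrightarrow> F (\<sigma> d) \<noteq> F d"
    and VF: "d \<in> D \<Longrightarrow> e \<in> D \<Longrightarrow> V d = V e \<Longrightarrow> F d = F e \<Longrightarrow> d = e"
    and Field_eq: "Field r = {lb, ub} \<union> V ` D \<union> E ` D \<union> F ` D"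
    and r_eq: "r = {lb} \<times> Field r \<union> Field r \<times> {ub} \<union> Id_on (Field r)
        \<union> {(V d, E d) | d. d \<in> D} \<union> {(E d, F d) | d. d \<in> D} \<union> {(V d, F d) | d. d \<in> D}"
    and rk: "rk lb = -1" "d \<in> D \<Longrightarrow> rk (V d) = 0" "d \<in> D \<Longrightarrow> rk (E d) = 1"
      "d \<in> D \<Longrightarrow> rk (F d) = 2" "rk ub = 3"
begin

lemma \<rho>_in: "d \<in> D \<Longrightarrow> \<rho> d \<in> D" and \<tau>_in: "d \<in> D \<Longrightarrow> \<tau> d \<in> D"
  using bij_\<rho> bij_\<tau> by (auto dest: bij_betw_apply)

lemma \<rho>_surj: assumes "d \<in> D" obtains e where "e \<in> D" "d = \<rho> e"
  using assms bij_\<rho> by (metis bij_betw_imp_surj_on imageE)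

lemma \<rho>_inj: "d \<in> D \<Longrightarrow> e \<in> D \<Longrightarrow> \<rho> d = \<rho> e \<Longrightarrow> d = e"
  using bij_\<rho> by (auto simp: bij_betw_def inj_on_def)

lemma funpow_in: "d \<in> D \<Longrightarrow> (\<rho> ^^ k) d \<in> D" "d \<in> D \<Longrightarrow> (\<tau> ^^ k) d \<in> D"
  by (induction k) (auto simp: \<rho>_in \<tau>_in)

lemma distinct_ranks [simp]:
  "lb \<noteq> ub" "ub \<noteq> lb"
  "d \<in> D \<Longrightarrow> V d \<noteq> lb" "d \<in> D \<Longrightarrow> lb \<noteq> V d" "d \<in> D \<Longrightarrow> V d \<noteq> ub" "d \<in> D \<Longrightarrow> ub \<noteq> V d"
  "d \<in> D \<Longrightarrow> E d \<noteq> lb" "d \<in> D \<Longrightarrow> lb \<noteq> E d" "d \<in> D \<Longrightarrow> E d \<noteq> ub" "d \<in> D \<Longrightarrow> ub \<noteq> E d"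
  "d \<in> D \<Longrightarrow> F d \<noteq> lb" "d \<in> D \<Longrightarrow> lb \<noteq> F d" "d \<in> D \<Longrightarrow> F d \<noteq> ub" "d \<in> D \<Longrightarrow> ub \<noteq> F d"
  "d \<in> D \<Longrightarrow> e \<in> D \<Longrightarrow> V d \<noteq> E e" "d \<in> D \<Longrightarrow> e \<in> D \<Longrightarrow> E e \<noteq> V d"
  "d \<in> D \<Longrightarrow> e \<in> D \<Longrightarrow> V d \<noteq> F e" "d \<in> D \<Longrightarrow> e \<in> D \<Longrightarrow> F e \<noteq> V d"
  "d \<in> D \<Longrightarrow> e \<in> D \<Longrightarrow> E d \<noteq> F e" "d \<in> D \<Longrightarrow> e \<in> D \<Longrightarrow> F e \<noteq> E d"
  by (metis rk numeral_eq_iff num.distinct zero_neq_numeral one_neq_zero one_eq_numeral_iff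
      zero_neq_neg_one neg_equal_iff_equal neg_one_neq_numeral numeral_One equal_neg_zero
      zero_neq_one neg_numeral_neq_numeral)+

section \<open>Incidence of cells in terms of darts\<close>

lemma cells_in [simp]:
  "lb \<in> Field r" "ub \<in> Field r"
  "d \<in> D \<Longrightarrow> V d \<in> Field r" "d \<in> D \<Longrightarrow> E d \<in> Field r" "d \<in> D \<Longrightarrow> F d \<in> Field r"
  unfolding Field_eq by simp_all

lemma FieldE:
  assumes "a \<in> Field r"
  obtains "a = lb" | d where "d \<in> D" "a = V d" | d where "d \<in> D" "a = E d"
    | d where "d \<in> D" "a = F d" | "a = ub"
  using assms unfolding Field_eq by blast

lemma mem_r:
  "(a, b) \<in> r \<longleftrightarrow> a = lb \<and> b \<in> Field r \<or> a \<in> Field r \<and> b = ub \<or> a = b \<and> a \<in> Field r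
    \<or> (\<exists>d\<in>D. a = V d \<and> b = E d) \<or> (\<exists>d\<in>D. a = E d \<and> b = F d) \<or> (\<exists>d\<in>D. a = V d \<and> b = F d)"
  by (subst r_eq) blast

lemma r_least [simp]: "(lb, a) \<in> r \<longleftrightarrow> a \<in> Field r" and r_greatest [simp]: "(a, ub) \<in> r \<longleftrightarrow> a \<in> Field r"
  by (auto simp: mem_r Field_eq)

lemma r_refl [simp]: "(a, a) \<in> r \<longleftrightarrow> a \<in> Field r"
  by (auto simp: mem_r)

lemma r_to_least [simp]: "(a, lb) \<in> r \<longleftrightarrow> a = lb" and r_from_greatest [simp]: "(ub, a) \<in> r \<longleftrightarrow> a = ub"
  by (auto simp: mem_r)

lemma r_V [simp]: "d \<in> D \<Longrightarrow> (a, V d) \<in> r \<longleftrightarrow> a = lb \<or> a = V d"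
  by (auto simp: mem_r)

lemma r_F [simp]: "d \<in> D \<Longrightarrow> (F d, a) \<in> r \<longleftrightarrow> a = ub \<or> a = F d"
  by (auto simp: mem_r)

lemma r_E_E [simp]: "d \<in> D \<Longrightarrow> e \<in> D \<Longrightarrow> (E d, E e) \<in> r \<longleftrightarrow> E d = E e"
  by (auto simp: mem_r)

lemma E_\<sigma> [simp]: "d \<in> D \<Longrightarrow> E (\<sigma> d) = E d"
  using E_eq[of d "\<sigma> d"] \<sigma>_in by simp

lemma V_\<tau> [simp]: "d \<in> D \<Longrightarrow> V (\<tau> d) = V d"
proof -
  assume "d \<in> D"
  moreover have "same_orbit \<tau> d (\<tau> d)"
    by (auto simp: same_orbit_def intro: exI[of _ 1])
  ultimately show ?thesis
    using V_eq \<tau>_in by metis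
qed

lemma F_\<rho> [simp]: "d \<in> D \<Longrightarrow> F (\<rho> d) = F d"
proof -
  assume "d \<in> D"
  moreover have "same_orbit \<rho> d (\<rho> d)"
    by (auto simp: same_orbit_def intro: exI[of _ 1])
  ultimately show ?thesis
    using F_eq \<rho>_in by metis
qed

lemma V_\<rho> [simp]: "d \<in> D \<Longrightarrow> V (\<rho> d) = V (\<sigma> d)"
  using V_\<tau>[of "\<rho> d"] by (simp add: \<tau>_\<rho> \<rho>_in)

text \<open>\<open>\<sigma> (\<tau> d)\<close> is the dart before \<open>d\<close> on its face: for
  \<open>d = \<rho> e\<close> the relation between the rotations gives
  \<open>\<tau> d = \<sigma> e\<close>.\<close>

lemma F_\<sigma>\<tau> [simp]: "d \<in> D \<Longrightarrow> F (\<sigma> (\<tau> d)) = F d"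
  by (metis F_\<rho> \<rho>_surj \<sigma>_\<sigma> \<tau>_\<rho>)

lemma
  assumes "d \<in> D" "e \<in> D"
  shows share_dart_V_E: "(V d, E e) \<in> r \<longleftrightarrow> (\<exists>c\<in>D. V d = V c \<and> E e = E c)"
    and share_dart_E_F: "(E d, F e) \<in> r \<longleftrightarrow> (\<exists>c\<in>D. E d = E c \<and> F e = F c)"
    and share_dart_V_F: "(V d, F e) \<in> r \<longleftrightarrow> (\<exists>c\<in>D. V d = V c \<and> F e = F c)"
  using assms by (auto simp: mem_r)

lemma r_V_E: "d \<in> D \<Longrightarrow> e \<in> D \<Longrightarrow> (V d, E e) \<in> r \<longleftrightarrow> V d = V e \<or> V d = V (\<sigma> e)"
  using share_dart_V_E E_eq \<sigma>_in by metis

lemma r_E_F: "d \<in> D \<Longrightarrow> e \<in> D \<Longrightarrow> (E d, F e) \<in> r \<longleftrightarrow> F d = F e \<or> F (\<sigma> d) = F e"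
  using share_dart_E_F E_eq \<sigma>_in by metis

lemma \<rho>_\<tau>_ne: "d \<in> D \<Longrightarrow> \<rho> d \<noteq> d" "d \<in> D \<Longrightarrow> \<tau> d \<noteq> d" "d \<in> D \<Longrightarrow> \<tau> d \<noteq> \<sigma> d"
  by (metis V_\<rho> V_\<sigma>) (metis F_\<sigma>\<tau> F_\<sigma>, metis V_\<tau> V_\<sigma>)

text \<open>The corner of the face at \<open>V d\<close> has one edge leaving and one arriving. For
  an edge between the two cells take its dart \<open>e\<close> starting at \<open>V d\<close>. If
  \<open>e\<close> lies on the face, then \<open>e = d\<close>; if \<open>\<sigma> e\<close> does,
  then \<open>\<rho> (\<sigma> e)\<close> starts at \<open>V d\<close> on that face, so it is
  \<open>d\<close>, and \<open>e = \<tau> d\<close>.\<close>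

lemma between_V_F:
  assumes d: "d \<in> D"
  shows "{c. (V d, c) \<in> r \<and> (c, F d) \<in> r \<and> c \<noteq> V d \<and> c \<noteq> F d} = {E d, E (\<tau> d)}"
proof (intro equalityI subsetI)
  fix c assume c: "c \<in> {c. (V d, c) \<in> r \<and> (c, F d) \<in> r \<and> c \<noteq> V d \<and> c \<noteq> F d}"
  then have "c \<in> Field r"
    by (auto simp: Field_def)
  then obtain e' where e': "e' \<in> D" "c = E e'"
    using c d r_F[of _ "F d"] by (cases rule: FieldE) auto
  then have "V d = V e' \<or> V d = V (\<sigma> e')"
    using c d r_V_E by auto
  then obtain e where e: "e \<in> D" "c = E e" "V d = V e"
    using e' by (metis E_\<sigma> \<sigma>_in)
  then have "F e = F d \<or> F (\<sigma> e) = F d"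
    using c d r_E_F by auto
  then show "c \<in> {E d, E (\<tau> d)}"
  proof
    assume "F (\<sigma> e) = F d"
    moreover have "V (\<rho> (\<sigma> e)) = V e"
      using e(1) by (simp add: \<sigma>_in \<sigma>_\<sigma>)
    ultimately have "\<rho> (\<sigma> e) = d"
      using VF[of "\<rho> (\<sigma> e)" d] d e by (simp add: \<sigma>_in \<rho>_in)
    then have "\<tau> d = e"
      using \<tau>_\<rho>[of "\<sigma> e"] e(1) by (simp add: \<sigma>_in \<sigma>_\<sigma>)
    then show ?thesis
      using e by simp
  qed (use VF[of e d] e d in auto)
qed (use d in \<open>auto simp: r_V_E r_E_F \<tau>_in\<close>)

lemma Partial_order_r: "Partial_order r"
proof -
  have mono: "rk a < rk b \<or> a = b" if "(a, b) \<in> r" for a b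
  proof -
    have "a \<in> Field r" "b \<in> Field r"
      using that by (auto simp: Field_def)
    then show ?thesis
      using that by (elim FieldE) (auto simp: rk)
  qed
  then have "antisym r"
    by (metis antisymI not_less_iff_gr_or_eq)
  moreover have "(a, c) \<in> r" if "(a, b) \<in> r" "(b, c) \<in> r" for a b c
  proof -
    have "a \<in> Field r" "b \<in> Field r" "c \<in> Field r"
      using that by (auto simp: Field_def)
    then show ?thesis
      using that
    proof (elim FieldE)
      fix d e f assume *: "d \<in> D" "e \<in> D" "f \<in> D" "a = V d" "b = E e" "c = F f"
      then obtain e' where e': "e' \<in> D" "E e = E e'" "V d = V e'"
        using \<open>(a, b) \<in> r\<close> share_dart_V_E by auto
      then have "F e' = F f \<or> F (\<sigma> e') = F f"
        using * \<open>(b, c) \<in> r\<close> r_E_F by auto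
      \<comment> \<open>The face may lie on the far side of the edge. Then
        \<open>\<rho> (\<sigma> e')\<close> is the dart that starts at the same vertex as
        \<open>e'\<close> and does lie on that face.\<close>
      moreover have "F (\<rho> (\<sigma> e')) = F (\<sigma> e')" "V (\<rho> (\<sigma> e')) = V e'" "\<rho> (\<sigma> e') \<in> D"
        using e'(1) by (simp_all add: \<sigma>_in \<sigma>_\<sigma> \<rho>_in)
      ultimately have "\<exists>c\<in>D. V d = V c \<and> F f = F c"
        using e' by metis
      then show ?thesis
        using * share_dart_V_F by simp
    qed auto
  qed
  ultimately show ?thesis
    by (auto simp: partial_order_on_def preorder_on_def refl_on_def trans_def intro: FieldI1 FieldI2)
qed

text \<open>Two comparable cells whose ranks differ by more than one are never a covering pair,
  because a suitable dart supplies a cell in between.\<close>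

lemma ranked_poset_r: "ranked_poset r rk"
  unfolding ranked_poset_def
proof (intro conjI Partial_order_r allI impI)
  fix a b assume ab: "(a, b) \<in> r \<and> a \<noteq> b"
  then have "a \<in> Field r" "b \<in> Field r"
    by (auto simp: Field_def)
  then show "rk a < rk b"
    using ab by (elim FieldE) (auto simp: rk)
next
  fix a b assume ab: "(a, b) \<in> r \<and> a \<noteq> b \<and> (\<forall>c. (a, c) \<in> r \<and> (c, b) \<in> r \<longrightarrow> c = a \<or> c = b)"
  then have cov: "\<And>c. (a, c) \<in> r \<Longrightarrow> (c, b) \<in> r \<Longrightarrow> c = a \<or> c = b" and ne: "(a, b) \<in> r" "a \<noteq> b"
    by auto
  have "a \<in> Field r" "b \<in> Field r"
    using ab by (auto simp: Field_def)
  then show "rk b = rk a + 1"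
    using ne
  proof (elim FieldE)
    fix d assume "d \<in> D" "a = lb" "b = E d"
    then show ?thesis using cov[of "V d"] by (auto simp: r_V_E)
  next
    fix d assume "d \<in> D" "a = lb" "b = F d"
    then show ?thesis using cov[of "E d"] by (auto simp: r_E_F)
  next
    assume "a = lb" "b = ub"
    then show ?thesis using cov[of "E d0"] d0 by auto
  next
    fix d e assume "d \<in> D" "e \<in> D" "a = V d" "b = F e"
    moreover from this obtain c where "c \<in> D" "V d = V c" "F e = F c"
      using ne(1) share_dart_V_F by auto
    ultimately show ?thesis using cov[of "E c"] by (auto simp: r_V_E r_E_F)
  next
    fix d assume "d \<in> D" "a = V d" "b = ub"
    then show ?thesis using cov[of "E d"] by (auto simp: r_V_E)
  next
    fix d assume "d \<in> D" "a = E d" "b = ub"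
    then show ?thesis using cov[of "F d"] by (auto simp: r_E_F)
  qed (auto simp: rk)
qed

lemma rank_set_r:
  "rank_set r rk (-1) = {lb}" "rank_set r rk 0 = V ` D" "rank_set r rk 1 = E ` D"
  "rank_set r rk 2 = F ` D" "rank_set r rk 3 = {ub}"
  unfolding rank_set_def Field_eq using rk by auto

lemma diamond_condition_r: "diamond_condition r rk"
  unfolding diamond_condition_def
proof (intro allI impI)
  fix a b assume ab: "(a, b) \<in> r \<and> rk b - rk a = 2"
  let ?M = "{c. (a, c) \<in> r \<and> (c, b) \<in> r \<and> c \<noteq> a \<and> c \<noteq> b}"
  have Mfld: "c \<in> Field r" if "c \<in> ?M" for c
    using that by (auto simp: Field_def)
  have "a \<in> Field r" "b \<in> Field r"
    using ab by (auto simp: Field_def)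
  then show "card ?M = 2"
    using ab
  proof (elim FieldE)
    fix d assume d: "d \<in> D" "a = lb" "b = E d"
    have "?M = {V d, V (\<sigma> d)}"
    proof (intro equalityI subsetI)
      fix c assume "c \<in> ?M"
      with Mfld[OF this] show "c \<in> {V d, V (\<sigma> d)}"
        using d by (elim FieldE) (auto simp: r_V_E)
    qed (use d in \<open>auto simp: r_V_E \<sigma>_in\<close>)
    then show ?thesis
      using V_\<sigma>[of d] d by simp
  next
    fix d e assume de: "d \<in> D" "e \<in> D" "a = V d" "b = F e"
    then obtain c where "c \<in> D" "a = V c" "b = F c"
      using ab share_dart_V_F by auto
    then have "?M = {E c, E (\<tau> c)}"
      using between_V_F by simp
    \<comment> \<open>The darts of an edge are \<open>c\<close> and \<open>\<sigma> c\<close>, and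
      \<open>\<tau> c\<close> is neither: it differs from \<open>c\<close> in the face of its
      reversal, and from \<open>\<sigma> c\<close> in its initial vertex.\<close>
    moreover have "E c \<noteq> E (\<tau> c)"
      using E_eq[of c "\<tau> c"] \<rho>_\<tau>_ne[OF \<open>c \<in> D\<close>] \<open>c \<in> D\<close> \<tau>_in by simp
    ultimately show ?thesis
      by simp
  next
    fix d assume d: "d \<in> D" "a = E d" "b = ub"
    have "?M = {F d, F (\<sigma> d)}"
    proof (intro equalityI subsetI)
      fix c assume "c \<in> ?M"
      with Mfld[OF this] show "c \<in> {F d, F (\<sigma> d)}"
        using d by (elim FieldE) (auto simp: r_E_F)
    qed (use d in \<open>auto simp: r_E_F \<sigma>_in\<close>)
    then show ?thesis
      using F_\<sigma>[of d] d by simp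
  qed (auto simp: rk)
qed

section \<open>Sections at a face and at a vertex\<close>

lemma below_F:
  assumes "d \<in> D"
  shows "(c, F d) \<in> r \<longleftrightarrow> c = lb \<or> c = F d \<or> (\<exists>j. c = V ((\<rho> ^^ j) d)) \<or> (\<exists>j. c = E ((\<rho> ^^ j) d))"
proof -
  have F: "F ((\<rho> ^^ j) d) = F d" for j
    using assms by (induction j) (simp_all add: funpow_in)
  have "(\<exists>e\<in>D. c = cell e \<and> F d = F e) \<longleftrightarrow> (\<exists>j. c = cell ((\<rho> ^^ j) d))" for cell
    using assms F funpow_in(1)[OF assms] F_eq[OF assms] by (fastforce simp: same_orbit_def)
  from this[of V] this[of E] show ?thesis
    using assms unfolding mem_r by auto
qed

lemma above_V:
  assumes "d \<in> D"
  shows "(V d, c) \<in> r \<longleftrightarrow> c = ub \<or> c = V d \<or> (\<exists>j. c = E ((\<tau> ^^ j) d)) \<or> (\<exists>j. c = F ((\<tau> ^^ j) d))"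
proof -
  have V: "V ((\<tau> ^^ j) d) = V d" for j
    using assms by (induction j) (simp_all add: funpow_in)
  have "(\<exists>e\<in>D. V d = V e \<and> c = cell e) \<longleftrightarrow> (\<exists>j. c = cell ((\<tau> ^^ j) d))" for cell
    using assms V funpow_in(2)[OF assms] V_eq[OF assms] by (fastforce simp: same_orbit_def)
  from this[of E] this[of F] show ?thesis
    using assms unfolding mem_r by auto
qed

text \<open>Edge number \<open>j\<close> joins vertex number \<open>j\<close> to the next one,
  because \<open>\<rho> e\<close> starts where \<open>e\<close> ends.\<close>

lemma face_section:
  assumes d: "d \<in> D"
  shows "order_section r lb (F d) =
    cyclic_order lb (F d) (\<lambda>j. V ((\<rho> ^^ j) d)) (\<lambda>j. E ((\<rho> ^^ j) d))" (is "?S = ?C")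
proof (rule Set.set_eqI)
  fix p :: "'p \<times> 'p"
  obtain u v where p: "p = (u, v)" by fastforce
  have VE: "(V ((\<rho> ^^ i) d), E ((\<rho> ^^ j) d)) \<in> r \<longleftrightarrow>
      V ((\<rho> ^^ i) d) = V ((\<rho> ^^ j) d) \<or> V ((\<rho> ^^ i) d) = V ((\<rho> ^^ Suc j) d)" for i j
    using d by (simp add: r_V_E funpow_in)
  have "(u, v) \<in> ?S \<longleftrightarrow> (u, v) \<in> r \<and> (u, F d) \<in> r \<and> (v, F d) \<in> r"
    by (auto simp: order_section_def Field_def)
  also have "\<dots> \<longleftrightarrow> (u, v) \<in> ?C"
  proof
    assume "(u, v) \<in> r \<and> (u, F d) \<in> r \<and> (v, F d) \<in> r"
    then have uv: "(u, v) \<in> r" "(u, F d) \<in> r" "(v, F d) \<in> r" by auto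
    from uv(2,3) show "(u, v) \<in> ?C"
      unfolding below_F[OF d] using uv(1) d
      by (elim disjE exE) (auto simp: cyclic_order_def Let_def VE funpow_in simp del: funpow.simps)
  next
    assume "(u, v) \<in> ?C"
    then have "(u, F d) \<in> r" "(v, F d) \<in> r"
      unfolding below_F[OF d] by (auto simp: cyclic_order_def Let_def simp del: funpow.simps)
    moreover have "(u, v) \<in> r"
      using \<open>(u, v) \<in> ?C\<close> d
      by (auto simp: cyclic_order_def Let_def VE funpow_in below_F simp del: funpow.simps)
    ultimately show "(u, v) \<in> r \<and> (u, F d) \<in> r \<and> (v, F d) \<in> r" by blast
  qed
  finally show "p \<in> ?S \<longleftrightarrow> p \<in> ?C"
    using p by simp
qed

text \<open>At \<open>V d\<close> the face of the dart \<open>\<tau>\<close>-rotated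
  \<open>j\<close> times meets exactly the edges with numbers \<open>j\<close> and
  \<open>Suc j\<close>, which is \<open>between_V_F\<close> applied to that dart.\<close>

lemma vertex_section:
  assumes d: "d \<in> D"
  shows "order_section r (V d) ub =
    cyclic_order (V d) ub (\<lambda>j. E ((\<tau> ^^ j) d)) (\<lambda>j. F ((\<tau> ^^ j) d))" (is "?S = ?C")
proof (rule Set.set_eqI)
  fix p :: "'p \<times> 'p"
  obtain u v where p: "p = (u, v)" by fastforce
  have EF: "(E ((\<tau> ^^ i) d), F ((\<tau> ^^ j) d)) \<in> r \<longleftrightarrow>
      E ((\<tau> ^^ i) d) = E ((\<tau> ^^ j) d) \<or> E ((\<tau> ^^ i) d) = E ((\<tau> ^^ Suc j) d)" for i j
  proof -
    let ?e = "(\<tau> ^^ j) d"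
    have e: "?e \<in> D" and V: "V ((\<tau> ^^ i) d) = V ?e"
      using d V_\<tau> funpow_in above_V[OF d] by (auto simp: V_eq same_orbit_def)
        (metis V_eq d funpow_in(2) same_orbit_def)
    have "(E ((\<tau> ^^ i) d), F ?e) \<in> r \<longleftrightarrow> E ((\<tau> ^^ i) d) \<in> {E ?e, E (\<tau> ?e)}"
      unfolding between_V_F[OF e, symmetric]
      using d e V by (simp add: funpow_in) (metis V mem_r funpow_in(2) d)
    then show ?thesis by simp
  qed
  have "(u, v) \<in> ?S \<longleftrightarrow> (u, v) \<in> r \<and> (V d, u) \<in> r \<and> (V d, v) \<in> r"
    by (auto simp: order_section_def Field_def)
  also have "\<dots> \<longleftrightarrow> (u, v) \<in> ?C"
  proof
    assume "(u, v) \<in> r \<and> (V d, u) \<in> r \<and> (V d, v) \<in> r"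
    then have uv: "(u, v) \<in> r" "(V d, u) \<in> r" "(V d, v) \<in> r" by auto
    from uv(2,3) show "(u, v) \<in> ?C"
      unfolding above_V[OF d] using uv(1) d
      by (elim disjE exE) (auto simp: cyclic_order_def Let_def EF funpow_in simp del: funpow.simps)
  next
    assume "(u, v) \<in> ?C"
    then have "(V d, u) \<in> r" "(V d, v) \<in> r"
      unfolding above_V[OF d] by (auto simp: cyclic_order_def Let_def simp del: funpow.simps)
    moreover have "(u, v) \<in> r"
      using \<open>(u, v) \<in> ?C\<close> d
      by (auto simp: cyclic_order_def Let_def EF funpow_in above_V simp del: funpow.simps)
    ultimately show "(u, v) \<in> r \<and> (V d, u) \<in> r \<and> (V d, v) \<in> r" by blast
  qed
  finally show "p \<in> ?S \<longleftrightarrow> p \<in> ?C"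
    using p by simp
qed

text \<open>The two darts of an edge differ both in initial vertex and in face, so along one orbit
  an edge determines its dart.\<close>

lemma E_inj_on_orbits:
  assumes "d \<in> D" "e \<in> D" "E d = E e" "V d = V e \<or> F d = F e"
  shows "d = e"
  using assms E_eq V_\<sigma> F_\<sigma> by metis

lemma V_funpow: "d \<in> D \<Longrightarrow> V ((\<tau> ^^ j) d) = V d" and F_funpow: "d \<in> D \<Longrightarrow> F ((\<rho> ^^ j) d) = F d"
  by (induction j) (simp_all add: funpow_in)

lemma face_is_ngon:
  assumes d: "d \<in> D"
  obtains k where "is_ngon k (order_section r lb (F d))"
proof -
  obtain k where "k > 0" and k: "\<And>i j. (\<rho> ^^ i) d = (\<rho> ^^ j) d \<longleftrightarrow> i mod k = j mod k"
    using funpow_periodic[OF finite_D bij_\<rho> d] by blast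
  \<comment> \<open>\<open>\<rho>\<close> fixes no dart, as consecutive darts start at different
    ends of an edge; this excludes the 1-gon, which \<open>is_ngon\<close> does not admit.\<close>
  have "k \<noteq> 1"
    using k[of 1 0] \<rho>_\<tau>_ne[OF d] by auto
  then have "is_ngon k (order_section r lb (F d))"
    unfolding face_section[OF d] using d \<open>k > 0\<close>
  proof (intro is_ngon_cyclic_order)
    show "V ((\<rho> ^^ i) d) = V ((\<rho> ^^ j) d) \<longleftrightarrow> i mod k = j mod k" for i j
      unfolding k[symmetric] using VF funpow_in F_funpow d by metis
    show "E ((\<rho> ^^ i) d) = E ((\<rho> ^^ j) d) \<longleftrightarrow> i mod k = j mod k" for i j
      unfolding k[symmetric] using E_inj_on_orbits funpow_in F_funpow d by metis
  qed (auto simp: funpow_in)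
  then show ?thesis by (rule that)
qed

lemma vertex_is_ngon:
  assumes d: "d \<in> D"
  shows "is_ngon (card {e. same_orbit \<tau> d e}) (order_section r (V d) ub)"
proof -
  obtain k where "k > 0" and k: "\<And>i j. (\<tau> ^^ i) d = (\<tau> ^^ j) d \<longleftrightarrow> i mod k = j mod k"
    using funpow_periodic[OF finite_D bij_\<tau> d] by blast
  have "k \<noteq> 1"
    using k[of 1 0] \<rho>_\<tau>_ne[OF d] by auto
  then have "is_ngon k (order_section r (V d) ub)"
    unfolding vertex_section[OF d] using d \<open>k > 0\<close>
  proof (intro is_ngon_cyclic_order)
    show "F ((\<tau> ^^ i) d) = F ((\<tau> ^^ j) d) \<longleftrightarrow> i mod k = j mod k" for i j
      unfolding k[symmetric] using VF funpow_in V_funpow d by metis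
    show "E ((\<tau> ^^ i) d) = E ((\<tau> ^^ j) d) \<longleftrightarrow> i mod k = j mod k" for i j
      unfolding k[symmetric] using E_inj_on_orbits funpow_in V_funpow d by metis
  qed (auto simp: funpow_in)
  moreover have "{e. same_orbit \<tau> d e} = (\<lambda>i. (\<tau> ^^ i) d) ` {..<k}"
  proof -
    have "(\<tau> ^^ i) d = (\<tau> ^^ (i mod k)) d" for i
      using k by simp
    then show ?thesis
      using \<open>k > 0\<close> by (fastforce simp: same_orbit_def)
  qed
  moreover have "inj_on (\<lambda>i. (\<tau> ^^ i) d) {..<k}"
    using k by (auto simp: inj_on_def)
  ultimately show ?thesis
    by (simp add: card_image)
qed

text \<open>No edge is a loop, so each edge at \<open>V d\<close> has exactly one dart starting
  there, and these darts form the \<open>\<tau>\<close>-orbit of \<open>d\<close>.\<close>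

lemma card_edges_at_vertex:
  assumes d: "d \<in> D"
  shows "card {a \<in> E ` D. (V d, a) \<in> r} = card {e. same_orbit \<tau> d e}"
proof -
  have orb: "e \<in> D \<and> V e = V d" if "same_orbit \<tau> d e" for e
    using that d V_funpow funpow_in by (auto simp: same_orbit_def)
  have "{a \<in> E ` D. (V d, a) \<in> r} = E ` {e. same_orbit \<tau> d e}"
  proof (intro equalityI subsetI)
    fix a assume "a \<in> {a \<in> E ` D. (V d, a) \<in> r}"
    then obtain c where "c \<in> D" "V d = V c" "a = E c"
      using d share_dart_V_E by auto
    then show "a \<in> E ` {e. same_orbit \<tau> d e}"
      using d V_eq by blast
  next
    fix a assume "a \<in> E ` {e. same_orbit \<tau> d e}"
    then obtain e where "e \<in> D" "V e = V d" "a = E e"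
      using orb by blast
    then show "a \<in> {a \<in> E ` D. (V d, a) \<in> r}"
      using d by (simp add: r_V_E)
  qed
  moreover have "inj_on E {e. same_orbit \<tau> d e}"
    using orb E_inj_on_orbits by (auto simp: inj_on_def)
  ultimately show ?thesis
    by (simp add: card_image)
qed

text \<open>Only three kinds of section have rank difference above 2. Below a face and above a
  vertex a polygon is walked around; in the whole poset connectedness comes from the minimality of
  \<open>D\<close>.\<close>

lemma section_connected_r:
  assumes "(a, b) \<in> r"
  shows "section_connected r rk a b"
proof -
  have fld: "a \<in> Field r" "b \<in> Field r"
    using assms by (auto simp: Field_def)
  have cyc: "section_connected r rk a b"
    if "order_section r a b = cyclic_order a b lo hi" "a \<notin> range lo \<union> range hi" "b \<notin> range lo \<union> range hi" for lo hi
  proof -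
    have "Field (order_section r a b) - {a, b} = range lo \<union> range hi"
      unfolding that(1) using that(2,3) by (auto simp: cyclic_order_def Field_def Let_def)
    moreover have "cyclic_order a b lo hi \<subseteq> r"
      unfolding that(1)[symmetric] by (auto simp: order_section_def)
    ultimately show ?thesis
      unfolding section_connected_def Let_def using cyclic_order_connected by (metis order_refl)
  qed
  have F: "section_connected r rk a b" if "d \<in> D" "a = lb" "b = F d" for d
    using that by (intro cyc) (auto simp: face_section funpow_in)
  have V: "section_connected r rk a b" if "d \<in> D" "a = V d" "b = ub" for d
    using that by (intro cyc) (auto simp: vertex_section funpow_in)
  have whole: "section_connected r rk lb ub"
  proof -
    let ?M = "Field r - {lb, ub}"
    let ?R = "Restr (r \<union> r\<inverse>) ?M"
    have "sym ?R" by (auto simp: sym_def)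
    then have s: "(v, u) \<in> ?R\<^sup>*" if "(u, v) \<in> ?R\<^sup>*" for u v
      using that sym_rtrancl by (metis symD)
    have VE: "(V d, E d) \<in> ?R" and EF: "(E d, F d) \<in> ?R" if "d \<in> D" for d
      using that by (auto simp: r_V_E r_E_F)
    have "{d \<in> D. (E d0, E d) \<in> ?R\<^sup>*} = D"
    proof (rule D_minimal)
      fix d assume d: "d \<in> {d \<in> D. (E d0, E d) \<in> ?R\<^sup>*}"
      then show "\<sigma> d \<in> {d \<in> D. (E d0, E d) \<in> ?R\<^sup>*}"
        by (simp add: \<sigma>_in)
      \<comment> \<open>The edges of \<open>d\<close> and of \<open>\<rho> d\<close> are joined
        through their common face.\<close>
      have "(E d, F d) \<in> ?R\<^sup>*" "(F d, E (\<rho> d)) \<in> ?R\<^sup>*"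
        using EF[of d] s[OF r_into_rtrancl[OF EF[of "\<rho> d"]]] d by (auto simp: \<rho>_in)
      then show "\<rho> d \<in> {d \<in> D. (E d0, E d) \<in> ?R\<^sup>*}"
        using d \<rho>_in by (auto intro: rtrancl_trans)
    qed (use d0 in auto)
    then have E: "(E d0, E d) \<in> ?R\<^sup>*" if "d \<in> D" for d
      using that by blast
    have base: "(E d0, c) \<in> ?R\<^sup>*" if "c \<in> ?M" for c
    proof -
      from that have "c \<in> Field r" "c \<noteq> lb" "c \<noteq> ub" by auto
      then show ?thesis
        using E rtrancl_into_rtrancl[OF E EF] rtrancl_trans[OF E s[OF r_into_rtrancl[OF VE]]]
        by (elim FieldE) simp_all
    qed
    have "Field (order_section r lb ub) = Field r"
      by (simp add: Field_order_section[OF Partial_order_r])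
    then show ?thesis
      unfolding section_connected_def Let_def by (metis base s rtrancl_trans)
  qed
  show ?thesis
    using fld assms
  proof (elim FieldE)
    assume "a = lb" "b = ub" then show ?thesis using whole by simp
  qed ((rule F; assumption) | (rule V; assumption) | (simp add: section_connected_def rk; fail))+
qed

text \<open>A flag meets every rank exactly once. Its edge and face share a dart, and its vertex
  must be one of the two ends of that dart, so every dart carries two flags.\<close>

lemma flagE:
  assumes C: "C \<in> flags r"
  obtains d where "d \<in> D" "C = {lb, V d, E d, F d, ub} \<or> C = {lb, V (\<sigma> d), E d, F d, ub}"
proof -
  have ch: "\<And>u v. u \<in> C \<Longrightarrow> v \<in> C \<Longrightarrow> (u, v) \<in> r \<or> (v, u) \<in> r"
    and max: "\<And>C'. C' \<in> Chains r \<Longrightarrow> C \<subseteq> C' \<Longrightarrow> C' = C"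
    using C by (auto simp: flags_def Chains_def)
  have sub: "C \<subseteq> Field r"
    using ch by (auto simp: Field_def)
  have "insert lb C \<in> Chains r" "insert ub C \<in> Chains r"
    using ch sub by (auto simp: Chains_def)
  then have bounds: "lb \<in> C" "ub \<in> C"
    using max by blast+
  have uniq: "u = v" if "u \<in> C" "v \<in> C" "rk u = rk v" for u v
    using ch[OF that(1,2)] ranked_poset_r that(3) by (force simp: ranked_poset_def)
  have meet: "\<exists>c\<in>C. rk c = i" if "-1 \<le> i" "i \<le> 3" for i
    using flag_meets_rank[OF ranked_poset_r C bounds] that rk by simp
  obtain a b c where abc: "a \<in> C" "rk a = 0" "b \<in> C" "rk b = 1" "c \<in> C" "rk c = 2"
    using meet[of 0] meet[of 1] meet[of 2] by auto
  have "a \<in> V ` D" "b \<in> E ` D" "c \<in> F ` D"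
    using abc sub rank_set_r by (auto simp: rank_set_def)
  then obtain d e f where def: "d \<in> D" "e \<in> D" "f \<in> D" "a = V d" "b = E e" "c = F f"
    by blast
  then have "(a, b) \<in> r" "(b, c) \<in> r"
    using ch[OF abc(1,3)] ch[OF abc(3,5)] def by auto
  then obtain g where g: "g \<in> D" "b = E g" "c = F g"
    using def share_dart_E_F by auto
  then have "a = V g \<or> a = V (\<sigma> g)"
    using \<open>(a, b) \<in> r\<close> def r_V_E by auto
  moreover have "C = {lb, a, b, c, ub}"
  proof
    show "C \<subseteq> {lb, a, b, c, ub}"
    proof
      fix u assume u: "u \<in> C"
      then have "u \<in> Field r" using sub by blast
      then have "rk u \<in> {-1, 0, 1, 2, 3}"
        by (elim FieldE) (simp_all add: rk)
      then show "u \<in> {lb, a, b, c, ub}"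
        using abc bounds rk(1,5) uniq[OF u, of lb] uniq[OF u, of a] uniq[OF u, of b]
          uniq[OF u, of c] uniq[OF u, of ub] by (simp del: distinct_ranks) metis
    qed
  qed (use abc bounds in auto)
  ultimately show ?thesis
    using that g by blast
qed

lemma card_flag:
  assumes "C \<in> flags r"
  shows "card C = 5"
  using assms by (elim flagE) (auto simp: \<sigma>_in)

lemma abstract_3_polytope_r: "abstract_3_polytope r rk"
proof -
  have "rk ` Field r = {-1..3}"
  proof -
    have "{-1..3::int} = {-1, 0, 1, 2, 3}" by auto
    moreover have "rk ` Field r = {-1, 0, 1, 2, 3}"
      unfolding Field_eq using d0 by (auto simp: image_Un image_image rk cong: image_cong)
    ultimately show ?thesis by simp
  qed
  moreover have "\<exists>l\<in>Field r. rk l = -1 \<and> (\<forall>a\<in>Field r. (l, a) \<in> r)"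
    "\<exists>g\<in>Field r. rk g = 3 \<and> (\<forall>a\<in>Field r. (a, g) \<in> r)"
    by (auto intro: bexI[of _ lb] bexI[of _ ub] simp: rk)
  ultimately show ?thesis
    using ranked_poset_r card_flag diamond_condition_r section_connected_r
    unfolding abstract_3_polytope_def by blast
qed

text \<open>Any nonempty closed set may take the place of one containing \<open>d0\<close>: by
  finiteness the complement of a closed set is closed as well, and a complement containing
  \<open>d0\<close> would be all of \<open>D\<close>.\<close>

lemma subset_eq_D:
  assumes "S \<subseteq> D" "S \<noteq> {}" "\<And>d. d \<in> S \<Longrightarrow> \<sigma> d \<in> S" "\<And>d. d \<in> S \<Longrightarrow> \<rho> d \<in> S"
  shows "S = D"
proof (cases "d0 \<in> S")
  case False
  have "finite S" "inj_on \<rho> S" "\<rho> ` S \<subseteq> S"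
    using assms finite_subset[OF assms(1) finite_D] inj_on_subset[OF bij_betw_imp_inj_on[OF bij_\<rho>] assms(1)]
    by auto
  then have "\<rho> ` S = S"
    by (simp add: endo_inj_surj)
  then have "\<rho> d \<in> D - S" if "d \<in> D - S" for d
  proof -
    have "d \<in> S" if "\<rho> d \<in> S"
    proof -
      obtain e where "e \<in> S" "\<rho> d = \<rho> e"
        using \<open>\<rho> d \<in> S\<close> \<open>\<rho> ` S = S\<close> by (metis imageE)
      then show ?thesis
        using \<rho>_inj[of d e] \<open>d \<in> D - S\<close> assms(1) by blast
    qed
    then show ?thesis
      using that \<rho>_in by blast
  qed
  moreover have "\<sigma> d \<in> D - S" if "d \<in> D - S" for d
    using that \<sigma>_in \<sigma>_\<sigma> assms(3) by (metis DiffD1 DiffD2 DiffI)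
  ultimately have "D - S = D"
    using D_minimal[of "D - S"] False d0 by blast
  then show ?thesis
    using assms(1,2) by blast
qed (use assms D_minimal in blast)

section \<open>Dart maps and the automorphisms they induce\<close>

definition map_aut :: "('d \<Rightarrow> 'd) \<Rightarrow> bool" where
  "map_aut g \<longleftrightarrow> (\<forall>d\<in>D. g d \<in> D \<and> g (\<sigma> d) = \<sigma> (g d) \<and> g (\<rho> d) = \<rho> (g d))"

text \<open>An orientation-reversing symmetry: \<open>g\<close> conjugates \<open>\<rho>\<close>
  into its inverse, and the equation is multiplied out so that the inverse need not be
  mentioned.\<close>

definition map_refl :: "('d \<Rightarrow> 'd) \<Rightarrow> bool" where
  "map_refl g \<longleftrightarrow> (\<forall>d\<in>D. g d \<in> D \<and> g (\<sigma> d) = \<sigma> (g d) \<and> \<rho> (g (\<rho> d)) = g d)"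

lemma map_aut_image:
  assumes "map_aut g"
  shows "g ` D = D"
proof (rule subset_eq_D)
  fix d assume "d \<in> g ` D"
  then obtain e where e: "e \<in> D" "d = g e" by blast
  then have "\<sigma> d = g (\<sigma> e)" "\<rho> d = g (\<rho> e)"
    using assms by (simp_all add: map_aut_def)
  then show "\<sigma> d \<in> g ` D" "\<rho> d \<in> g ` D"
    using e(1) \<sigma>_in \<rho>_in by blast+
qed (use assms d0 in \<open>auto simp: map_aut_def\<close>)

lemma map_refl_image:
  assumes g: "map_refl g"
  shows "g ` D = D"
proof (rule subset_eq_D)
  show "\<sigma> d \<in> g ` D" if "d \<in> g ` D" for d
  proof -
    obtain e where e: "e \<in> D" "d = g e" using \<open>d \<in> g ` D\<close> by blast
    then have "\<sigma> d = g (\<sigma> e)"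
      using g by (simp add: map_refl_def)
    then show ?thesis
      using e(1) \<sigma>_in by blast
  qed
  have sub: "g ` D \<subseteq> D"
    using g by (auto simp: map_refl_def)
  have "inj_on \<rho> (g ` D)"
    using bij_\<rho> sub by (meson bij_betw_def inj_on_subset)
  \<comment> \<open>Here \<open>g d\<close> is the image under \<open>\<rho>\<close> of
    \<open>g (\<rho> d)\<close>. As the image of \<open>g\<close> is finite, this inclusion is an
    equality, and the image is closed under \<open>\<rho>\<close>.\<close>
  moreover have "g ` D \<subseteq> \<rho> ` (g ` D)"
    using g \<rho>_in unfolding map_refl_def by (metis imageI image_subsetI)
  ultimately have "\<rho> ` (g ` D) = g ` D"
    using finite_D by (metis card_image card_subset_eq finite_imageI)
  then show "\<rho> d \<in> g ` D" if "d \<in> g ` D" for d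
    using that by blast
qed (use g d0 in \<open>auto simp: map_refl_def\<close>)

text \<open>Two dart maps are allowed because a reflection sends the initial vertex of
  \<open>d\<close> to the terminal vertex of its image; they only have to agree on edges.\<close>

lemma cell_map_automorphism:
  assumes h: "h ` D = D" and g: "g ` D = D"
    and V: "\<And>d e. d \<in> D \<Longrightarrow> e \<in> D \<Longrightarrow> V d = V e \<Longrightarrow> V (h d) = V (h e)"
    and E: "\<And>d e. d \<in> D \<Longrightarrow> e \<in> D \<Longrightarrow> E d = E e \<Longrightarrow> E (g d) = E (g e)"
    and F: "\<And>d e. d \<in> D \<Longrightarrow> e \<in> D \<Longrightarrow> F d = F e \<Longrightarrow> F (g d) = F (g e)"
    and hg: "\<And>d. d \<in> D \<Longrightarrow> E (h d) = E (g d)"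
  obtains f where "f \<in> order_automorphisms r" "f lb = lb" "f ub = ub"
    "\<And>d. d \<in> D \<Longrightarrow> f (V d) = V (h d)" "\<And>d. d \<in> D \<Longrightarrow> f (E d) = E (g d)"
    "\<And>d. d \<in> D \<Longrightarrow> f (F d) = F (g d)"
proof -
  \<comment> \<open>Each cell is moved through an arbitrarily chosen dart of it; the three
    congruence hypotheses make the choice irrelevant.\<close>
  define f where "f a = (if a \<in> V ` D then V (h (inv_into D V a))
    else if a \<in> E ` D then E (g (inv_into D E a))
    else if a \<in> F ` D then F (g (inv_into D F a)) else a)" for a
  have in_D: "h d \<in> D" "g d \<in> D" if "d \<in> D" for d
    using that h g by blast+
  have inv: "inv_into D c (c d) \<in> D" "c (inv_into D c (c d)) = c d" if "d \<in> D" for c :: "'d \<Rightarrow> 'p" and d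
    using that by (auto simp: inv_into_into f_inv_into_f)
  have fb: "f lb = lb" "f ub = ub"
    by (auto simp: f_def)
  have fV: "f (V d) = V (h d)" if "d \<in> D" for d
    using that V[OF inv(1)[OF that, of V] that] inv(2) by (simp add: f_def)
  have fE: "f (E d) = E (g d)" if "d \<in> D" for d
  proof -
    have "E d \<notin> V ` D" using that by (auto dest: sym)
    then show ?thesis
      using that E[OF inv(1)[OF that, of E] that] inv(2) by (simp add: f_def)
  qed
  have fF: "f (F d) = F (g d)" if "d \<in> D" for d
  proof -
    have "F d \<notin> V ` D" "F d \<notin> E ` D" using that by (auto dest: sym)
    then show ?thesis
      using that F[OF inv(1)[OF that, of F] that] inv(2) by (simp add: f_def)
  qed
  \<comment> \<open>The dart \<open>h d\<close> witnesses the first incidence because its edge is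
    \<open>E (g d)\<close>. It may lie on another face than \<open>g d\<close>, so the incidence of
    vertex and face comes from transitivity.\<close>
  have "(V (h d), E (g d)) \<in> r" "(E (g d), F (g d)) \<in> r" if "d \<in> D" for d
    using that in_D hg[OF that] by (auto simp: share_dart_V_E share_dart_E_F)
  then have inc: "(V (h d), E (g d)) \<in> r" "(E (g d), F (g d)) \<in> r" "(V (h d), F (g d)) \<in> r" if "d \<in> D" for d
    using that Partial_order_r by (auto simp: partial_order_on_def preorder_on_def dest: transD)
  have surj: "f ` Field r = Field r"
  proof -
    have "(\<lambda>d. V (h d)) ` D = V ` D" "(\<lambda>d. E (g d)) ` D = E ` D" "(\<lambda>d. F (g d)) ` D = F ` D"
      using h g by (metis image_image)+
    then show ?thesis
      unfolding Field_eq by (simp add: image_Un image_image fb fV fE fF cong: image_cong)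
  qed
  have mono: "(f a, f b) \<in> r" if "(a, b) \<in> r" for a b
    using that surj unfolding mem_r[of a b]
    by (elim disjE) (auto simp: fb fV fE fF inc)
  have "finite (Field r)"
    unfolding Field_eq using finite_D by simp
  then have "f \<in> order_automorphisms r"
    using surj mono by (rule order_automorphismI)
  then show ?thesis
    using that fb fV fE fF by blast
qed

lemma V_cong:
  assumes "d \<in> D" "e \<in> D" "V d = V e"
    and "\<And>c. c \<in> D \<Longrightarrow> V (h (\<tau> c)) = V (h c)"
  shows "V (h d) = V (h e)"
proof -
  have "V (h ((\<tau> ^^ k) d)) = V (h d)" for k
    using assms(1,4) by (induction k) (simp_all add: funpow_in)
  then show ?thesis
    using assms V_eq by (auto simp: same_orbit_def)
qed

lemma F_cong:
  assumes "d \<in> D" "e \<in> D" "F d = F e"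
    and "\<And>c. c \<in> D \<Longrightarrow> F (h (\<rho> c)) = F (h c)"
  shows "F (h d) = F (h e)"
proof -
  have "F (h ((\<rho> ^^ k) d)) = F (h d)" for k
    using assms(1,4) by (induction k) (simp_all add: funpow_in)
  then show ?thesis
    using assms F_eq by (auto simp: same_orbit_def)
qed

lemma map_aut_automorphism:
  assumes g: "map_aut g"
  obtains f where "f \<in> order_automorphisms r" "f lb = lb" "f ub = ub"
    "\<And>d. d \<in> D \<Longrightarrow> f (V d) = V (g d)" "\<And>d. d \<in> D \<Longrightarrow> f (E d) = E (g d)"
    "\<And>d. d \<in> D \<Longrightarrow> f (F d) = F (g d)"
proof (rule cell_map_automorphism[of g g])
  have g_in: "g d \<in> D" and g_\<sigma>: "g (\<sigma> d) = \<sigma> (g d)" and g_\<rho>: "g (\<rho> d) = \<rho> (g d)" if "d \<in> D" for d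
    using that g by (auto simp: map_aut_def)
  \<comment> \<open>Compatibility with \<open>\<tau>\<close> needs no separate hypothesis: every
    dart is some \<open>\<rho> e\<close>, and \<open>\<tau>\<close> turns it into
    \<open>\<sigma> e\<close>.\<close>
  have "V (g (\<tau> c)) = V (g c)" if c: "c \<in> D" for c
  proof -
    obtain e where e: "e \<in> D" "c = \<rho> e" using \<rho>_surj[OF c] .
    then show ?thesis
      by (simp add: \<tau>_\<rho> g_\<sigma> g_\<rho> g_in)
  qed
  then show "V (g d) = V (g e)" if "d \<in> D" "e \<in> D" "V d = V e" for d e
    using that by (rule V_cong[rotated 3])
  show "F (g d) = F (g e)" if "d \<in> D" "e \<in> D" "F d = F e" for d e
    using that by (rule F_cong) (simp add: g_\<rho> g_in)
  show "E (g d) = E (g e)" if "d \<in> D" "e \<in> D" "E d = E e" for d e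
    using that E_eq[of d e] by (auto simp: g_\<sigma> g_in)
qed (use that map_aut_image[OF g] in auto)

text \<open>Since the face is traversed backwards after the reflection, the start of
  \<open>d\<close> becomes the end of \<open>g d\<close>; hence \<open>\<sigma>\<close> in the
  action on vertices only.\<close>

lemma map_refl_automorphism:
  assumes g: "map_refl g"
  obtains f where "f \<in> order_automorphisms r" "f lb = lb" "f ub = ub"
    "\<And>d. d \<in> D \<Longrightarrow> f (V d) = V (\<sigma> (g d))" "\<And>d. d \<in> D \<Longrightarrow> f (E d) = E (g d)"
    "\<And>d. d \<in> D \<Longrightarrow> f (F d) = F (g d)"
proof (rule cell_map_automorphism[of "\<lambda>d. \<sigma> (g d)" g])
  have g_in: "g d \<in> D" and g_\<sigma>: "g (\<sigma> d) = \<sigma> (g d)" and g_\<rho>: "\<rho> (g (\<rho> d)) = g d" if "d \<in> D" for d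
    using that g by (auto simp: map_refl_def)
  have "V (\<sigma> (g (\<tau> c))) = V (\<sigma> (g c))" if c: "c \<in> D" for c
  proof -
    obtain e where e: "e \<in> D" "c = \<rho> e" using \<rho>_surj[OF c] .
    have "V (\<rho> (g c)) = V (\<sigma> (g c))"
      using c by (simp add: g_in)
    then show ?thesis
      using e g_\<rho>[OF e(1)] by (simp add: \<tau>_\<rho> g_\<sigma> g_in \<sigma>_\<sigma>)
  qed
  then show "V (\<sigma> (g d)) = V (\<sigma> (g e))" if "d \<in> D" "e \<in> D" "V d = V e" for d e
    using V_cong[OF that, of "\<lambda>d. \<sigma> (g d)"] by simp
  show "F (g d) = F (g e)" if "d \<in> D" "e \<in> D" "F d = F e" for d e
  proof (rule F_cong[OF that])
    show "F (g (\<rho> c)) = F (g c)" if "c \<in> D" for c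
      using that F_\<rho>[of "g (\<rho> c)"] by (simp add: g_\<rho> g_in \<rho>_in)
  qed
  show "E (g d) = E (g e)" if "d \<in> D" "e \<in> D" "E d = E e" for d e
    using that E_eq[of d e] by (auto simp: g_\<sigma> g_in)
  show "(\<lambda>d. \<sigma> (g d)) ` D = D"
  proof -
    have "\<sigma> ` D = D"
      using \<sigma>_in \<sigma>_\<sigma> by (intro equalityI image_subsetI subsetI) (metis imageI)+
    then show ?thesis
      using map_refl_image[OF g] by (metis image_image)
  qed
  show "E (\<sigma> (g d)) = E (g d)" if "d \<in> D" for d
    using that by (simp add: g_in)
qed (use that map_refl_image[OF g] in auto)

definition dart_equiv :: "'d \<Rightarrow> 'd \<Rightarrow> bool" where
  "dart_equiv d e \<longleftrightarrow> (\<exists>g. map_aut g \<and> g d = e)"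

lemma dart_equiv_refl: "dart_equiv d d"
  by (auto simp: dart_equiv_def map_aut_def intro: exI[of _ "\<lambda>d. d"])

lemma dart_equiv_trans: "dart_equiv c d \<Longrightarrow> dart_equiv d e \<Longrightarrow> dart_equiv c e"
  unfolding dart_equiv_def
proof (elim exE conjE)
  fix g h assume "map_aut g" "g c = d" "map_aut h" "h d = e"
  then show "\<exists>g. map_aut g \<and> g c = e"
    by (intro exI[of _ "h \<circ> g"]) (auto simp: map_aut_def)
qed

lemma dart_equiv_sym:
  assumes "dart_equiv d e" "d \<in> D"
  shows "dart_equiv e d"
proof -
  obtain g where g: "map_aut g" "g d = e"
    using assms(1) by (auto simp: dart_equiv_def)
  have im: "g ` D = D" using map_aut_image[OF g(1)] .
  then have inj: "inj_on g D"
    using finite_D by (simp add: eq_card_imp_inj_on)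
  let ?h = "inv_into D g"
  have h: "?h c \<in> D" "g (?h c) = c" if "c \<in> D" for c
    using that im by (auto simp: inv_into_into f_inv_into_f)
  have "?h (\<sigma> c) = \<sigma> (?h c)" "?h (\<rho> c) = \<rho> (?h c)" if "c \<in> D" for c
  proof -
    have "\<sigma> c = g (\<sigma> (?h c))" "\<rho> c = g (\<rho> (?h c))"
      using g(1) h[OF that] by (simp_all add: map_aut_def)
    then show "?h (\<sigma> c) = \<sigma> (?h c)" "?h (\<rho> c) = \<rho> (?h c)"
      using inj h(1)[OF that] \<sigma>_in \<rho>_in by (simp_all add: inv_into_f_f)
  qed
  then have "map_aut ?h"
    using h by (simp add: map_aut_def)
  moreover have "?h e = d"
    using g(2) inj assms(2) by auto
  ultimately show ?thesis
    by (auto simp: dart_equiv_def)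
qed

lemma dart_equiv_\<sigma>: "dart_equiv d e \<Longrightarrow> d \<in> D \<Longrightarrow> dart_equiv (\<sigma> d) (\<sigma> e)"
  by (auto simp: dart_equiv_def map_aut_def)

lemma dart_equiv_cells:
  assumes "dart_equiv d e" "d \<in> D"
  shows "aut_equiv r {V d} {V e}" "aut_equiv r {E d} {E e}" "aut_equiv r {F d} {F e}"
proof -
  obtain g where g: "map_aut g" "g d = e"
    using assms(1) by (auto simp: dart_equiv_def)
  obtain f where "f \<in> order_automorphisms r" "f (V d) = V e" "f (E d) = E e" "f (F d) = F e"
    using map_aut_automorphism[OF g(1)] g(2) assms(2) by metis
  then show "aut_equiv r {V d} {V e}" "aut_equiv r {E d} {E e}" "aut_equiv r {F d} {F e}"
    unfolding aut_equiv_def by auto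
qed

lemma is_ngon_vertex_equiv:
  assumes "dart_equiv d e" "d \<in> D" "is_ngon k (order_section r (V d) ub)"
  shows "is_ngon k (order_section r (V e) ub)"
proof -
  obtain g where g: "map_aut g" "g d = e"
    using assms(1) by (auto simp: dart_equiv_def)
  obtain f where f: "f \<in> order_automorphisms r" "f ub = ub" "f (V d) = V e"
    using map_aut_automorphism[OF g(1)] g(2) assms(2) by metis
  show ?thesis
    using is_ngon_automorphism[OF Partial_order_r f(1) _ _ assms(3)] f assms(2) by simp
qed

end

text \<open>On the surface of a group, this turn about the terminal vertex of \<open>d\<close> is realized by
  conjugation with the label of that vertex.\<close>

locale turning_dart_map = dart_map +
  assumes turn: "d \<in> D \<Longrightarrow> dart_equiv d (\<sigma> (\<rho> d))"
begin

text \<open>Applying \<open>\<sigma>\<close> exchanges the two candidate classes, and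
  \<open>\<rho> d\<close> is the reversal of a dart equivalent to \<open>d\<close>, so the union of
  the classes is closed under both maps.\<close>

lemma dart_equiv_base:
  assumes "d \<in> D"
  shows "dart_equiv d0 d \<or> dart_equiv (\<sigma> d0) d"
proof -
  let ?S = "{d \<in> D. dart_equiv d0 d \<or> dart_equiv (\<sigma> d0) d}"
  have \<sigma>: "\<sigma> d \<in> ?S" if "d \<in> ?S" for d
    using that dart_equiv_\<sigma>[of d0 d] dart_equiv_\<sigma>[of "\<sigma> d0" d] d0 by (auto simp: \<sigma>_in \<sigma>_\<sigma>)
  have "?S = D"
  proof (rule D_minimal)
    fix d assume d: "d \<in> ?S"
    then have "\<sigma> (\<rho> d) \<in> ?S"
      using turn[of d] by (auto simp: \<sigma>_in \<rho>_in intro: dart_equiv_trans)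
    from \<sigma>[OF this] show "\<rho> d \<in> ?S"
      using d by (simp add: \<sigma>_\<sigma> \<rho>_in)
  qed (use \<sigma> d0 dart_equiv_refl in auto)
  then show ?thesis
    using assms by blast
qed

text \<open>The turn at \<open>\<sigma> d\<close>, reversed, makes \<open>d\<close> equivalent to
  \<open>\<rho> (\<sigma> d)\<close>, which lies on the face across the edge of \<open>d\<close>.
  Thus neighbouring faces are equivalent.\<close>

lemma face_equiv:
  assumes "d \<in> D"
  shows "aut_equiv r {F d0} {F d}"
proof -
  have step: "dart_equiv d (\<rho> (\<sigma> d))" if "d \<in> D" for d
    using dart_equiv_\<sigma>[OF turn[of "\<sigma> d"]] that by (simp add: \<sigma>_in \<sigma>_\<sigma> \<rho>_in)
  have "{d \<in> D. aut_equiv r {F d0} {F d}} = D"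
  proof (rule D_minimal)
    fix d assume d: "d \<in> {d \<in> D. aut_equiv r {F d0} {F d}}"
    then have "aut_equiv r {F d} {F (\<sigma> d)}"
      using dart_equiv_cells(3)[OF step[of d]] by (simp add: \<sigma>_in)
    then show "\<sigma> d \<in> {d \<in> D. aut_equiv r {F d0} {F d}}"
      using d aut_equiv_trans by (auto simp: \<sigma>_in)
  qed (use d0 dart_equiv_cells(3)[OF dart_equiv_refl] \<rho>_in in auto)
  then show ?thesis
    using assms by blast
qed

lemma face_transitive: "rank_transitive r rk 2"
  using face_equiv d0 by (intro rank_transitiveI[of _ _ _ "F d0"]) (auto simp: rank_set_r)

lemma edge_transitive: "rank_transitive r rk 1"
proof (rule rank_transitiveI)
  fix a assume "a \<in> rank_set r rk 1"
  then obtain d where d: "d \<in> D" "a = E d"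
    by (auto simp: rank_set_r)
  then show "aut_equiv r {E d0} {a}"
    using dart_equiv_base[OF d(1)] dart_equiv_cells(2)[of d0 d] dart_equiv_cells(2)[of "\<sigma> d0" d] d0
    by (auto simp: \<sigma>_in)
qed (use d0 in simp)

lemma faces_ngons: "\<exists>n. \<forall>d\<in>D. is_ngon n (order_section r lb (F d))"
proof -
  obtain n where n: "is_ngon n (order_section r lb (F d0))"
    using face_is_ngon[OF d0] .
  have "is_ngon n (order_section r lb (F d))" if d: "d \<in> D" for d
  proof -
    obtain f where f: "f \<in> order_automorphisms r" "f (F d0) = F d"
      using face_equiv[OF d] by (auto simp: aut_equiv_def)
    have "f ` Field r = Field r" and ord: "\<forall>a\<in>Field r. \<forall>b\<in>Field r. (a, b) \<in> r \<longleftrightarrow> (f a, f b) \<in> r"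
      using f(1) by (auto simp: order_automorphisms_def order_iso_def bij_betw_def)
    \<comment> \<open>An automorphism fixes the least element: \<open>lb\<close> is below the
      preimage \<open>c\<close> of \<open>lb\<close>, so \<open>f lb\<close> is below
      \<open>lb\<close>.\<close>
    then obtain c where "c \<in> Field r" "f c = lb"
      using cells_in(1) by (metis imageE)
    with ord have "f lb = lb"
      using r_to_least r_least cells_in(1) by metis
    with is_ngon_automorphism[OF Partial_order_r f(1) _ _ n] f(2) d0 show ?thesis by simp
  qed
  then show ?thesis by blast
qed

text \<open>Up to automorphism every vertex is one of the two ends of \<open>d0\<close>, so
  comparing these two is enough.\<close>

lemma vertices_ngons:
  assumes "card {e. same_orbit \<tau> d0 e} = card {e. same_orbit \<tau> (\<sigma> d0) e}" "d \<in> D"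
  shows "is_ngon (card {e. same_orbit \<tau> d0 e}) (order_section r (V d) ub)"
  using dart_equiv_base[OF assms(2)] vertex_is_ngon[OF d0] vertex_is_ngon[OF \<sigma>_in[OF d0]]
    is_ngon_vertex_equiv d0 \<sigma>_in assms(1) by metis

text \<open>The hypothesis merges the two classes: reversing it makes \<open>\<sigma> d0\<close>
  equivalent to \<open>\<sigma> (\<rho> d0)\<close>, which the turn makes equivalent to
  \<open>d0\<close>.\<close>

lemma dart_transitive:
  assumes "dart_equiv d0 (\<rho> d0)" "d \<in> D"
  shows "dart_equiv d0 d"
proof -
  have "dart_equiv (\<sigma> d0) (\<sigma> (\<rho> d0))"
    using dart_equiv_\<sigma>[OF assms(1) d0] .
  moreover have "dart_equiv (\<sigma> (\<rho> d0)) d0"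
    using dart_equiv_sym[OF turn[OF d0] d0] .
  ultimately have "dart_equiv d0 (\<sigma> d0)"
    using dart_equiv_trans dart_equiv_sym d0 \<sigma>_in by blast
  then show ?thesis
    using dart_equiv_base[OF assms(2)] dart_equiv_trans by blast
qed

lemma vertex_transitive:
  assumes "dart_equiv d0 (\<rho> d0)"
  shows "rank_transitive r rk 0"
  using dart_equiv_cells(1)[OF dart_transitive[OF assms] d0] d0
  by (intro rank_transitiveI[of _ _ _ "V d0"]) (auto simp: rank_set_r)

text \<open>\<open>\<theta>\<close> keeps the edge and the face of \<open>d0\<close> and exchanges
  the ends of the edge, so it links the two flags of \<open>d0\<close>; dart transitivity reaches
  the flags of all other darts.\<close>

lemma flag_transitive_r:
  assumes "dart_equiv d0 (\<rho> d0)" and "map_refl \<theta>" and "\<theta> d0 = d0"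
  shows "flag_transitive r"
proof -
  let ?C0 = "{lb, V d0, E d0, F d0, ub}"
  have sub: "?C0 \<subseteq> Field r"
    using d0 by simp
  have base: "aut_equiv r ?C0 C" if "C \<in> flags r" for C
    using that
  proof (rule flagE)
    fix d assume d: "d \<in> D" and C: "C = {lb, V d, E d, F d, ub} \<or> C = {lb, V (\<sigma> d), E d, F d, ub}"
    obtain g where g: "map_aut g" "g d0 = d"
      using dart_transitive[OF assms(1) d] by (auto simp: dart_equiv_def)
    then have "g (\<sigma> d0) = \<sigma> d"
      using d0 by (auto simp: map_aut_def)
    obtain f where f: "f \<in> order_automorphisms r" "f lb = lb" "f ub = ub"
      "f (V d0) = V d" "f (V (\<sigma> d0)) = V (\<sigma> d)" "f (E d0) = E d" "f (F d0) = F d"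
      using map_aut_automorphism[OF g(1)] g(2) \<open>g (\<sigma> d0) = \<sigma> d\<close> d0 \<sigma>_in by metis
    obtain f' where f': "f' \<in> order_automorphisms r" "f' lb = lb" "f' ub = ub"
      "f' (V d0) = V (\<sigma> d0)" "f' (E d0) = E d0" "f' (F d0) = F d0"
      using map_refl_automorphism[OF assms(2)] assms(3) d0 by metis
    from C show "aut_equiv r ?C0 C"
    proof
      assume "C = {lb, V d, E d, F d, ub}"
      then show ?thesis
        using f unfolding aut_equiv_def by (intro bexI[of _ f]) auto
    next
      assume "C = {lb, V (\<sigma> d), E d, F d, ub}"
      then have "(f \<circ> f') ` ?C0 = C"
        using f f' by auto
      then show ?thesis
        using order_automorphisms_comp[OF f'(1) f(1)] unfolding aut_equiv_def by blast
    qed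
  qed
  have "aut_equiv r C C'" if "C \<in> flags r" "C' \<in> flags r" for C C'
    using aut_equiv_trans[OF aut_equiv_sym[OF base[OF that(1)] sub] base[OF that(2)]] .
  then show ?thesis
    by (auto simp: flag_transitive_def aut_equiv_def)
qed

end

section \<open>The surfaces of a group\<close>

lemma edge_rel_rtrancl_sym: "(u, v) \<in> (edge_rel L)\<^sup>* \<Longrightarrow> (v, u) \<in> (edge_rel L)\<^sup>*"
proof -
  have "sym (edge_rel L)"
    by (auto simp: sym_def edge_rel_def insert_commute)
  then show "(u, v) \<in> (edge_rel L)\<^sup>* \<Longrightarrow> (v, u) \<in> (edge_rel L)\<^sup>*"
    using sym_rtrancl by (metis symD)
qed

lemma component_of_eq:
  assumes "(u, v) \<in> (edge_rel L)\<^sup>*"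
  shows "component_of L {u} = component_of L {v}"
  using assms edge_rel_rtrancl_sym[OF assms] by (auto simp: component_of_def intro: rtrancl_trans)

lemma component_of_eqD:
  assumes "component_of L {u} = component_of L {v}" and "{v} \<in> L"
  shows "(u, v) \<in> (edge_rel L)\<^sup>*"
proof -
  have "{v} \<in> component_of L {v}"
    using assms(2) by (auto simp: component_of_def)
  then show ?thesis
    unfolding assms(1)[symmetric] by (auto simp: component_of_def)
qed

text \<open>This lets the sheet labels of \<open>lift_simplex\<close>, which refer to a whole
  simplex of the link, be computed from a single vertex of it.\<close>

lemma component_of_simplex:
  assumes "u \<in> \<sigma>" and "\<And>v. v \<in> \<sigma> \<Longrightarrow> {u, v} \<in> L"
  shows "component_of L \<sigma> = component_of L {u}"
proof -
  have "component_of L {v} = component_of L {u}" if "v \<in> \<sigma>" for v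
  proof -
    have "(u, v) \<in> edge_rel L"
      using assms(2)[OF that] by (simp add: edge_rel_def)
    from component_of_eq[OF r_into_rtrancl[OF this]] show ?thesis ..
  qed
  moreover have "component_of L \<sigma> = (\<Union>v\<in>\<sigma>. component_of L {v})"
    by (auto simp: component_of_def)
  ultimately have "component_of L \<sigma> = (\<Union>v\<in>\<sigma>. component_of L {u})"
    by simp
  then show ?thesis
    using assms(1) by auto
qed

lemma closed_simplex_mono_iff: "A \<noteq> {} \<Longrightarrow> closed_simplex A \<subseteq> closed_simplex B \<longleftrightarrow> A \<subseteq> B"
  by (auto simp: closed_simplex_def)

section \<open>Triangles as noncommuting pairs\<close>

definition darts :: "('a, 'b) monoid_scheme \<Rightarrow> ('a \<times> 'a) set" where
  "darts G = {(a, b). noncommuting G a b}"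

definition face_rot :: "('a, 'b) monoid_scheme \<Rightarrow> 'a \<times> 'a \<Rightarrow> 'a \<times> 'a" where
  "face_rot G d = (snd d, inv\<^bsub>G\<^esub> snd d \<otimes>\<^bsub>G\<^esub> fst d \<otimes>\<^bsub>G\<^esub> snd d)"

definition vertex_rot :: "('a, 'b) monoid_scheme \<Rightarrow> 'a \<times> 'a \<Rightarrow> 'a \<times> 'a" where
  "vertex_rot G d = (fst d, fst d \<otimes>\<^bsub>G\<^esub> snd d \<otimes>\<^bsub>G\<^esub> inv\<^bsub>G\<^esub> fst d)"

text \<open>The corner of the triangle at its first type 1 vertex, as a point of the
  desingularization; the circle of the link is named by one point on it, the other type 1
  corner.\<close>

definition vertex_pt :: "('a, 'b) monoid_scheme \<Rightarrow> 'a \<times> 'a \<Rightarrow> ('a \<times> nat) sheet_vertex" where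
  "vertex_pt G d = ((fst d, 1), component_of (link (X_complex G) (fst d, 1)) {(snd d, 1)})"

definition face_pt :: "('a, 'b) monoid_scheme \<Rightarrow> 'a \<times> 'a \<Rightarrow> ('a \<times> nat) sheet_vertex" where
  "face_pt G d = ((fst d \<otimes>\<^bsub>G\<^esub> snd d, 2),
     component_of (link (X_complex G) (fst d \<otimes>\<^bsub>G\<^esub> snd d, 2)) {(fst d, 1)})"

lemma X_complex_cases:
  assumes "\<sigma> \<in> X_complex G"
  obtains (vertex) a i where "\<sigma> = {(a, i)}" "a \<in> carrier G - group_center G" "i \<in> {1, 2}"
    | (edge11) a b where "\<sigma> = {(a, 1), (b, 1)}" "noncommuting G a b"
    | (edge12) a b where "\<sigma> = {(a, 1), (b, 2)}" "noncommuting G a b"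
    | (triangle) a b where "\<sigma> = {(a, 1), (b, 1), (a \<otimes>\<^bsub>G\<^esub> b, 2)}" "noncommuting G a b"
  using assms unfolding X_complex_def by blast

lemma noncommuting_sym: "noncommuting G a b \<Longrightarrow> noncommuting G b a"
  by (auto simp: noncommuting_def)

lemma noncommuting_ne: "noncommuting G a b \<Longrightarrow> a \<noteq> b"
  by (auto simp: noncommuting_def)

lemma noncommuting_not_central: "noncommuting G a b \<Longrightarrow> a \<in> carrier G - group_center G"
  by (auto simp: noncommuting_def group_center_def)

lemma edge12_in_X: "{(a, 1), (c, 2)} \<in> X_complex G \<longleftrightarrow> noncommuting G a c"
proof
  assume "{(a, 1), (c, 2)} \<in> X_complex G"
  then show "noncommuting G a c"
  proof (cases rule: X_complex_cases)
    case (triangle p q)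
    then have "(p, 1) \<in> {(a, 1), (c, 2 :: nat)}" "(q, 1) \<in> {(a, 1), (c, 2 :: nat)}"
      by simp_all
    with noncommuting_ne[OF triangle(2)] show ?thesis by simp
  qed (auto simp: doubleton_eq_iff)
qed (auto simp: X_complex_def)

lemma three_set_in_X:
  assumes "{u, v, w} \<in> X_complex G" "u \<noteq> v" "u \<noteq> w" "v \<noteq> w"
  obtains a b where "noncommuting G a b" "{u, v, w} = {(a, 1), (b, 1), (a \<otimes>\<^bsub>G\<^esub> b, 2)}"
  using assms(1)
proof (cases rule: X_complex_cases)
  case (edge11 a b)
  then have "card {u, v, w} \<le> 2" by (simp add: card_insert_if)
  then show ?thesis using assms by simp
next
  case (edge12 a b)
  then have "card {u, v, w} \<le> 2" by (simp add: card_insert_if)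
  then show ?thesis using assms by simp
qed (use assms that in auto)

text \<open>In a triangle the element \<open>a\<close> is either the left or the right factor of the
  type 2 label, so in the link each \<open>(b, 1)\<close> has the two neighbours ab and ba.\<close>

lemma link_X_vertex_edge:
  assumes "{u, v} \<in> link (X_complex G) (a, 1)" "u \<noteq> v"
  obtains b where "noncommuting G a b"
    "{u, v} = {(b, 1), (a \<otimes>\<^bsub>G\<^esub> b, 2)} \<or> {u, v} = {(b, 1), (b \<otimes>\<^bsub>G\<^esub> a, 2)}"
proof -
  have "{(a, 1), u, v} \<in> X_complex G" and ne: "u \<noteq> (a, 1)" "v \<noteq> (a, 1)"
    using assms by (auto simp: link_def)
  then obtain b c where bc: "noncommuting G b c"
    "{(a, 1), u, v} = {(b, 1), (c, 1), (b \<otimes>\<^bsub>G\<^esub> c, 2)}"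
    using three_set_in_X[of "(a, 1)" u v G] assms(2) by metis
  have uv: "{u, v} = {(b, 1), (c, 1), (b \<otimes>\<^bsub>G\<^esub> c, 2)} - {(a, 1)}"
    unfolding bc(2)[symmetric] using ne by auto
  have "(a, 1) \<in> {(b, 1), (c, 1), (b \<otimes>\<^bsub>G\<^esub> c, 2 :: nat)}"
    unfolding bc(2)[symmetric] by simp
  then have "a = b \<or> a = c" by auto
  then show ?thesis
  proof
    assume "a = b"
    then have "{u, v} = {(c, 1), (a \<otimes>\<^bsub>G\<^esub> c, 2)}"
      using noncommuting_ne[OF bc(1)] unfolding uv \<open>a = b\<close> by auto
    then show ?thesis using that bc(1) \<open>a = b\<close> by blast
  next
    assume "a = c"
    then have "{u, v} = {(b, 1), (b \<otimes>\<^bsub>G\<^esub> a, 2)}"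
      using noncommuting_ne[OF bc(1)] unfolding uv \<open>a = c\<close> by auto
    then show ?thesis using that noncommuting_sym[OF bc(1)] \<open>a = c\<close> by blast
  qed
qed

lemma link_X_face_edge:
  assumes "{u, v} \<in> link (X_complex G) (c, 2)" "u \<noteq> v"
  obtains a b where "noncommuting G a b" "c = a \<otimes>\<^bsub>G\<^esub> b" "{u, v} = {(a, 1), (b, 1)}"
proof -
  have "{(c, 2), u, v} \<in> X_complex G" and ne: "u \<noteq> (c, 2)" "v \<noteq> (c, 2)"
    using assms by (auto simp: link_def)
  then obtain a b where ab: "noncommuting G a b"
    "{(c, 2), u, v} = {(a, 1), (b, 1), (a \<otimes>\<^bsub>G\<^esub> b, 2)}"
    using three_set_in_X[of "(c, 2)" u v G] assms(2) by metis
  have uv: "{u, v} = {(a, 1), (b, 1), (a \<otimes>\<^bsub>G\<^esub> b, 2)} - {(c, 2)}"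
    unfolding ab(2)[symmetric] using ne by auto
  have "(c, 2) \<in> {(a, 1 :: nat), (b, 1), (a \<otimes>\<^bsub>G\<^esub> b, 2)}"
    unfolding ab(2)[symmetric] by simp
  then have c: "c = a \<otimes>\<^bsub>G\<^esub> b" by auto
  have "{u, v} = {(a, 1), (b, 1)}"
    unfolding uv c by auto
  then show ?thesis
    using that ab(1) c by blast
qed

locale finite_group = group +
  assumes finite_carrier: "finite (carrier G)"
begin

lemma noncommuting_carrier: "noncommuting G a b \<Longrightarrow> a \<in> carrier G" "noncommuting G a b \<Longrightarrow> b \<in> carrier G"
  by (auto simp: noncommuting_def)

lemma noncommuting_mult_left:
  "a \<in> carrier G \<Longrightarrow> b \<in> carrier G \<Longrightarrow> noncommuting G a (a \<otimes> b) \<longleftrightarrow> noncommuting G a b"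
  by (auto simp: noncommuting_def m_assoc)

lemma noncommuting_mult_right:
  "a \<in> carrier G \<Longrightarrow> b \<in> carrier G \<Longrightarrow> noncommuting G a (b \<otimes> a) \<longleftrightarrow> noncommuting G a b"
  by (auto simp: noncommuting_def m_assoc[symmetric])

lemma conj_cancel [simp]:
  assumes "a \<in> carrier G" "b \<in> carrier G"
  shows "a \<otimes> (inv a \<otimes> b) = b" "inv a \<otimes> (a \<otimes> b) = b" "b \<otimes> a \<otimes> inv a = b" "b \<otimes> inv a \<otimes> a = b"
    "a \<otimes> (inv a \<otimes> b \<otimes> a) = b \<otimes> a" "inv a \<otimes> (a \<otimes> b \<otimes> inv a) = b \<otimes> inv a"
proof -
  show "a \<otimes> (inv a \<otimes> b) = b" "inv a \<otimes> (a \<otimes> b) = b"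
    using assms by (simp_all add: m_assoc[symmetric])
  show "b \<otimes> a \<otimes> inv a = b" "b \<otimes> inv a \<otimes> a = b"
    using assms by (simp_all add: m_assoc)
  show "a \<otimes> (inv a \<otimes> b \<otimes> a) = b \<otimes> a" "inv a \<otimes> (a \<otimes> b \<otimes> inv a) = b \<otimes> inv a"
    using assms by (simp_all add: m_assoc[symmetric])
qed

lemma conjugation_hom:
  assumes "h \<in> carrier G"
  shows "(\<lambda>a. h \<otimes> a \<otimes> inv h) \<in> hom G G"
proof (rule homI)
  fix a b assume ab: "a \<in> carrier G" "b \<in> carrier G"
  have "h \<otimes> a \<otimes> inv h \<otimes> (h \<otimes> b \<otimes> inv h) = h \<otimes> a \<otimes> (inv h \<otimes> (h \<otimes> b \<otimes> inv h))"
    using assms ab by (simp add: m_assoc del: conj_cancel)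
  also have "\<dots> = h \<otimes> (a \<otimes> b) \<otimes> inv h"
    using assms ab by (simp add: m_assoc)
  finally show "h \<otimes> (a \<otimes> b) \<otimes> inv h = h \<otimes> a \<otimes> inv h \<otimes> (h \<otimes> b \<otimes> inv h)" ..
qed (use assms in simp)

text \<open>Multiplying the second element by \<open>a\<close> on either side does not affect
  commuting with \<open>a\<close>, and it turns the conjugates into ba and ab.\<close>

lemma noncommuting_conj:
  assumes "noncommuting G a b"
  shows "noncommuting G a (inv a \<otimes> b \<otimes> a)" "noncommuting G a (a \<otimes> b \<otimes> inv a)"
proof -
  have c: "a \<in> carrier G" "b \<in> carrier G"
    using assms noncommuting_carrier by auto
  have "noncommuting G a (a \<otimes> (inv a \<otimes> b \<otimes> a))"
    using c assms by (simp add: noncommuting_mult_right)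
  then show "noncommuting G a (inv a \<otimes> b \<otimes> a)"
    using c by (simp add: noncommuting_mult_left del: conj_cancel)
  have "noncommuting G a ((a \<otimes> b \<otimes> inv a) \<otimes> a)"
    using c assms by (simp add: noncommuting_mult_left)
  then show "noncommuting G a (a \<otimes> b \<otimes> inv a)"
    using c by (simp add: noncommuting_mult_right del: conj_cancel)
qed

lemma dart_carrier: "d \<in> darts G \<Longrightarrow> fst d \<in> carrier G" "d \<in> darts G \<Longrightarrow> snd d \<in> carrier G"
  by (auto simp: darts_def noncommuting_def)

lemma finite_darts: "finite (darts G)"
  by (rule finite_subset[of _ "carrier G \<times> carrier G"])
    (auto simp: darts_def noncommuting_def finite_carrier)

lemma swap_darts: "d \<in> darts G \<Longrightarrow> prod.swap d \<in> darts G"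
  by (auto simp: darts_def noncommuting_sym)

lemma face_rot_darts: "d \<in> darts G \<Longrightarrow> face_rot G d \<in> darts G"
  by (auto simp: darts_def face_rot_def intro: noncommuting_conj(1)[OF noncommuting_sym])

lemma vertex_rot_darts: "d \<in> darts G \<Longrightarrow> vertex_rot G d \<in> darts G"
  by (auto simp: darts_def vertex_rot_def intro: noncommuting_conj)

lemma vertex_rot_face_rot: "d \<in> darts G \<Longrightarrow> vertex_rot G (face_rot G d) = prod.swap d"
  using dart_carrier[of d] by (simp add: vertex_rot_def face_rot_def prod.swap_def)

text \<open>The composite of the two rotations is the swap, so the inner rotation is injective and
  the outer one surjective; finiteness gives the rest.\<close>

lemma bij_face_rot: "bij_betw (face_rot G) (darts G) (darts G)"
proof -
  have "inj_on (face_rot G) (darts G)"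
    by (metis (no_types, lifting) inj_onI vertex_rot_face_rot swap_swap)
  moreover have "face_rot G ` darts G \<subseteq> darts G"
    using face_rot_darts by blast
  ultimately show ?thesis
    using finite_darts by (simp add: bij_betw_def endo_inj_surj)
qed

lemma bij_vertex_rot: "bij_betw (vertex_rot G) (darts G) (darts G)"
proof -
  have "darts G \<subseteq> vertex_rot G ` darts G"
  proof
    fix d assume "d \<in> darts G"
    then show "d \<in> vertex_rot G ` darts G"
      using vertex_rot_face_rot[of "prod.swap d"] swap_darts[of d] face_rot_darts
      by (metis imageI swap_swap)
  qed
  then have "vertex_rot G ` darts G = darts G"
    using vertex_rot_darts by blast
  then show ?thesis
    using finite_darts by (simp add: bij_betw_def eq_card_imp_inj_on)
qed

lemma orbit_sym:
  "d \<in> darts G \<Longrightarrow> same_orbit (face_rot G) d e \<Longrightarrow> same_orbit (face_rot G) e d"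
  "d \<in> darts G \<Longrightarrow> same_orbit (vertex_rot G) d e \<Longrightarrow> same_orbit (vertex_rot G) e d"
  using same_orbit_sym[OF finite_darts] bij_face_rot bij_vertex_rot by blast+

section \<open>Circles in the links are orbits of the rotations\<close>

lemma link_vertex_edges:
  assumes "noncommuting G a b"
  shows "{(b, 1), (a \<otimes> b, 2)} \<in> link (X_complex G) (a, 1)" "{(b, 1), (b \<otimes> a, 2)} \<in> link (X_complex G) (a, 1)"
    "{(b, 1)} \<in> link (X_complex G) (a, 1)"
proof -
  have "{(a, 1), (b, 1), (a \<otimes> b, 2)} \<in> X_complex G" "{(b, 1), (a, 1), (b \<otimes> a, 2)} \<in> X_complex G"
    "{(a, 1), (b, 1)} \<in> X_complex G"
    using assms noncommuting_sym[OF assms] unfolding X_complex_def by blast+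
  then show "{(b, 1), (a \<otimes> b, 2)} \<in> link (X_complex G) (a, 1)" "{(b, 1), (b \<otimes> a, 2)} \<in> link (X_complex G) (a, 1)"
    "{(b, 1)} \<in> link (X_complex G) (a, 1)"
    using noncommuting_ne[OF assms] by (auto simp: link_def insert_commute)
qed

lemma link_face_edges:
  assumes "noncommuting G a b"
  shows "{(a, 1), (b, 1)} \<in> link (X_complex G) (a \<otimes> b, 2)" "{(a, 1)} \<in> link (X_complex G) (a \<otimes> b, 2)"
proof -
  have "{(a, 1), (b, 1), (a \<otimes> b, 2)} \<in> X_complex G"
    using assms unfolding X_complex_def by blast
  moreover have "{(a, 1), (a \<otimes> b, 2)} \<in> X_complex G"
    using assms noncommuting_carrier[OF assms] by (simp only: edge12_in_X noncommuting_mult_left)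
  ultimately show "{(a, 1), (b, 1)} \<in> link (X_complex G) (a \<otimes> b, 2)" "{(a, 1)} \<in> link (X_complex G) (a \<otimes> b, 2)"
    by (auto simp: link_def insert_commute)
qed

text \<open>Along a path in the link the type 2 vertex ac is attached to the type 1 vertex c.
  Leaving \<open>(c, 1)\<close> through ca enters the pair attached to a^-1ca, one turn backwards,
  because ca equals a times a^-1ca.\<close>

lemma reach_in_vertex_link:
  assumes ab: "noncommuting G a b" and "((b, 1), u) \<in> (edge_rel (link (X_complex G) (a, 1)))\<^sup>*"
  shows "\<exists>c. (u = (c, 1) \<or> u = (a \<otimes> c, 2)) \<and> same_orbit (vertex_rot G) (a, b) (a, c) \<and> noncommuting G a c"
  using assms(2)
proof (induction rule: rtrancl_induct)
  case base
  show ?case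
    using ab same_orbit_refl by (intro exI[of _ b]) simp
next
  case (step u v)
  show ?case
  \<comment> \<open>\<open>edge_rel\<close> also relates a vertex to itself, since the doubleton
    then collapses to a singleton.\<close>
  proof (cases "u = v")
    case False
    from step.IH obtain c where c: "u = (c, 1) \<or> u = (a \<otimes> c, 2)" "same_orbit (vertex_rot G) (a, b) (a, c)"
      "noncommuting G a c" by blast
    have "{u, v} \<in> link (X_complex G) (a, 1)"
      using step.hyps(2) by (simp add: edge_rel_def)
    then obtain e where e: "noncommuting G a e"
      "{u, v} = {(e, 1), (a \<otimes> e, 2)} \<or> {u, v} = {(e, 1), (e \<otimes> a, 2)}"
      using link_X_vertex_edge False by metis
    have car: "a \<in> carrier G" "c \<in> carrier G" "e \<in> carrier G"
      using c(3) e(1) noncommuting_carrier by auto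
    \<comment> \<open>The predecessor of \<open>e\<close> in the rotation about \<open>a\<close>;
      its type 2 partner is exactly the vertex ea.\<close>
    let ?f = "inv a \<otimes> e \<otimes> a"
    have f: "vertex_rot G (a, ?f) = (a, e)" "a \<otimes> ?f = e \<otimes> a" "noncommuting G a ?f"
      using car noncommuting_conj[OF e(1)] by (simp_all add: vertex_rot_def)
    from e(2) consider "u = (e, 1)" "v = (a \<otimes> e, 2)" | "u = (a \<otimes> e, 2)" "v = (e, 1)"
      | "u = (e, 1)" "v = (e \<otimes> a, 2)" | "u = (e \<otimes> a, 2)" "v = (e, 1)"
      by (auto simp: doubleton_eq_iff)
    then show ?thesis
    proof cases
      case 1
      then have "c = e" using c(1) by auto
      then show ?thesis using c 1 by blast
    next
      case 2
      then have "c = e" using c(1) car by auto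
      then show ?thesis using c 2 by blast
    next
      case 3
      then have "c = e" using c(1) by auto
      have "(a, ?f) \<in> darts G" using f(3) by (simp add: darts_def)
      then have "same_orbit (vertex_rot G) (a, e) (a, ?f)"
        using orbit_sym(2) same_orbit_step f(1) by metis
      then have "same_orbit (vertex_rot G) (a, b) (a, ?f)"
        using c(2) \<open>c = e\<close> same_orbit_trans by metis
      then show ?thesis
        using 3 f by (intro exI[of _ ?f]) simp
    next
      case 4
      then have "c = ?f"
        using c(1) f(2) car by (metis Pair_inject l_cancel m_closed inv_closed numeral_eq_one_iff semiring_norm(85))
      then have "same_orbit (vertex_rot G) (a, b) (a, e)"
        using c(2) f(1) same_orbit_trans same_orbit_step by metis
      then show ?thesis
        using 4 e(1) by blast
    qed
  qed (use step.IH in simp)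
qed

text \<open>The product is constant on the link, so a reached vertex \<open>(c, 1)\<close>
  determines its dart. An edge of the link is one step of \<open>face_rot G\<close>, taken forwards
  or backwards.\<close>

lemma reach_in_face_link:
  assumes ab: "noncommuting G a b" and "((a, 1), u) \<in> (edge_rel (link (X_complex G) (a \<otimes> b, 2)))\<^sup>*"
  shows "\<exists>c e. u = (c, 1) \<and> same_orbit (face_rot G) (a, b) (c, e) \<and> noncommuting G c e \<and> c \<otimes> e = a \<otimes> b"
  using assms(2)
proof (induction rule: rtrancl_induct)
  case base
  show ?case
    using ab same_orbit_refl by (intro exI[of _ a] exI[of _ b]) simp
next
  case (step u v)
  show ?case
  proof (cases "u = v")
    case False
    from step.IH obtain c e where c: "u = (c, 1)" "same_orbit (face_rot G) (a, b) (c, e)"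
      "noncommuting G c e" "c \<otimes> e = a \<otimes> b" by blast
    have "{u, v} \<in> link (X_complex G) (a \<otimes> b, 2)"
      using step.hyps(2) by (simp add: edge_rel_def)
    then obtain f g where fg: "noncommuting G f g" "a \<otimes> b = f \<otimes> g" "{u, v} = {(f, 1), (g, 1)}"
      using link_X_face_edge False by metis
    have car: "c \<in> carrier G" "e \<in> carrier G" "f \<in> carrier G" "g \<in> carrier G"
      using c(3) fg(1) noncommuting_carrier by auto
    have rot: "face_rot G (f, g) = (g, inv g \<otimes> f \<otimes> g)" "g \<otimes> (inv g \<otimes> f \<otimes> g) = f \<otimes> g"
      using car by (simp_all add: face_rot_def)
    from fg(3) consider "u = (f, 1)" "v = (g, 1)" | "u = (g, 1)" "v = (f, 1)"
      by (auto simp: doubleton_eq_iff)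
    then show ?thesis
    proof cases
      case 1
      then have "(c, e) = (f, g)"
        using c fg car by auto
      then have "same_orbit (face_rot G) (a, b) (face_rot G (f, g))"
        using c(2) same_orbit_trans same_orbit_step by metis
      then show ?thesis
        using 1 fg(2) rot noncommuting_conj(1)[OF noncommuting_sym[OF fg(1)]]
        by (intro exI[of _ g] exI[of _ "inv g \<otimes> f \<otimes> g"]) simp
    next
      case 2
      then have "c = g" using c(1) by simp
      then have "g \<otimes> e = g \<otimes> (inv g \<otimes> f \<otimes> g)"
        using c(4) fg(2) rot(2) by simp
      then have "(c, e) = face_rot G (f, g)"
        using \<open>c = g\<close> car rot(1) l_cancel[of g e "inv g \<otimes> f \<otimes> g"] by (simp del: conj_cancel)
      moreover have "(f, g) \<in> darts G"
        using fg(1) by (simp add: darts_def)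
      ultimately have "same_orbit (face_rot G) (c, e) (f, g)"
        using orbit_sym(1) same_orbit_step by metis
      then have "same_orbit (face_rot G) (a, b) (f, g)"
        using c(2) same_orbit_trans by metis
      then show ?thesis
        using 2 fg by (intro exI[of _ f] exI[of _ g]) simp
    qed
  qed (use step.IH in simp)
qed

text \<open>In the link of \<open>(a, 1)\<close> both b and aba^-1 are adjacent to the type 2 vertex
  ab, which equals aba^-1 times a.\<close>

lemma vertex_pt_rot: "d \<in> darts G \<Longrightarrow> vertex_pt G (vertex_rot G d) = vertex_pt G d"
proof -
  assume "d \<in> darts G"
  then obtain a b where d: "d = (a, b)" "noncommuting G a b"
    by (auto simp: darts_def)
  let ?L = "link (X_complex G) (a, 1)" and ?c = "a \<otimes> b \<otimes> inv a"
  have "?c \<otimes> a = a \<otimes> b"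
    using d noncommuting_carrier[OF d(2)] by simp
  then have "{(?c, 1), (a \<otimes> b, 2)} \<in> ?L"
    using link_vertex_edges(2)[OF noncommuting_conj(2)[OF d(2)]] by simp
  moreover have "{(a \<otimes> b, 2), (b, 1)} \<in> ?L"
    using link_vertex_edges(1)[OF d(2)] by (simp add: insert_commute)
  ultimately have "((?c, 1), (a \<otimes> b, 2)) \<in> edge_rel ?L" "((a \<otimes> b, 2), (b, 1)) \<in> edge_rel ?L"
    by (simp_all add: edge_rel_def)
  then have "((?c, 1), (b, 1)) \<in> (edge_rel ?L)\<^sup>*"
    by (metis converse_rtrancl_into_rtrancl r_into_rtrancl)
  from component_of_eq[OF this] show ?thesis
    by (simp add: vertex_pt_def vertex_rot_def d)
qed

lemma face_pt_rot: "d \<in> darts G \<Longrightarrow> face_pt G (face_rot G d) = face_pt G d"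
proof -
  assume "d \<in> darts G"
  then obtain a b where d: "d = (a, b)" "noncommuting G a b"
    by (auto simp: darts_def)
  have "((a, 1), (b, 1)) \<in> (edge_rel (link (X_complex G) (a \<otimes> b, 2)))\<^sup>*"
    using link_face_edges[OF d(2)] by (auto simp: edge_rel_def)
  from component_of_eq[OF this] show ?thesis
    using noncommuting_carrier[OF d(2)] by (simp add: face_pt_def face_rot_def d)
qed

lemma orbit_in_darts:
  assumes "d \<in> darts G"
  shows "(vertex_rot G ^^ k) d \<in> darts G" "(face_rot G ^^ k) d \<in> darts G"
  by (induction k) (auto simp: assms vertex_rot_darts face_rot_darts)

lemma vertex_pt_eq_iff:
  assumes "d \<in> darts G" "e \<in> darts G"
  shows "vertex_pt G d = vertex_pt G e \<longleftrightarrow> same_orbit (vertex_rot G) d e"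
proof
  assume eq: "vertex_pt G d = vertex_pt G e"
  obtain a b where d: "d = (a, b)" "noncommuting G a b"
    using assms(1) by (auto simp: darts_def)
  with eq assms(2) obtain c where e: "e = (a, c)" "noncommuting G a c"
    by (auto simp: darts_def vertex_pt_def)
  let ?L = "link (X_complex G) (a, 1)"
  have "component_of ?L {(b, 1)} = component_of ?L {(c, 1)}"
    using eq by (simp add: vertex_pt_def d e)
  then have "((b, 1), (c, 1)) \<in> (edge_rel ?L)\<^sup>*"
    using component_of_eqD link_vertex_edges(3)[OF e(2)] by metis
  then show "same_orbit (vertex_rot G) d e"
    using reach_in_vertex_link[OF d(2)] d(1) e(1) by fastforce
next
  have "vertex_pt G ((vertex_rot G ^^ k) d) = vertex_pt G d" for k
    by (induction k) (simp_all add: vertex_pt_rot orbit_in_darts assms(1))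
  moreover assume "same_orbit (vertex_rot G) d e"
  ultimately show "vertex_pt G d = vertex_pt G e"
    by (auto simp: same_orbit_def)
qed

lemma face_pt_eq_iff:
  assumes "d \<in> darts G" "e \<in> darts G"
  shows "face_pt G d = face_pt G e \<longleftrightarrow> same_orbit (face_rot G) d e"
proof
  assume eq: "face_pt G d = face_pt G e"
  obtain a b where d: "d = (a, b)" "noncommuting G a b"
    using assms(1) by (auto simp: darts_def)
  obtain a' b' where e: "e = (a', b')" "noncommuting G a' b'"
    using assms(2) by (auto simp: darts_def)
  have prod: "a \<otimes> b = a' \<otimes> b'"
    using eq by (simp add: face_pt_def d e)
  let ?L = "link (X_complex G) (a \<otimes> b, 2)"
  have "component_of ?L {(a, 1)} = component_of ?L {(a', 1)}"
    using eq prod by (simp add: face_pt_def d e)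
  then have "((a, 1), (a', 1)) \<in> (edge_rel ?L)\<^sup>*"
    using component_of_eqD link_face_edges(2)[OF e(2)] prod by metis
  then obtain f where f: "same_orbit (face_rot G) (a, b) (a', f)" "noncommuting G a' f" "a' \<otimes> f = a' \<otimes> b'"
    using reach_in_face_link[OF d(2)] prod by fastforce
  then have "f = b'"
    using noncommuting_carrier e(2) by (metis l_cancel)
  then show "same_orbit (face_rot G) d e"
    using f(1) d(1) e(1) by simp
next
  have "face_pt G ((face_rot G ^^ k) d) = face_pt G d" for k
    by (induction k) (simp_all add: face_pt_rot orbit_in_darts assms(1))
  moreover assume "same_orbit (face_rot G) d e"
  ultimately show "face_pt G d = face_pt G e"
    by (auto simp: same_orbit_def)
qed

end

text \<open>The third side of a triangle, from the terminal vertex to the centre, is not listed: it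
  appears as the side of the rotated dart, once the set is closed under
  \<open>face_rot G\<close>.\<close>

definition dart_complex :: "('a, 'b) monoid_scheme \<Rightarrow> ('a \<times> 'a) set \<Rightarrow> ('a \<times> nat) sheet_vertex complex" where
  "dart_complex G D = (\<Union>d\<in>D. {{vertex_pt G d}, {face_pt G d}, {vertex_pt G d, vertex_pt G (prod.swap d)},
     {vertex_pt G d, face_pt G d}, {vertex_pt G d, vertex_pt G (prod.swap d), face_pt G d}})"

text \<open>Only forward steps are taken; with finitely many darts this already gives the orbit of
  the group generated by both permutations.\<close>

definition dart_orbit :: "('a, 'b) monoid_scheme \<Rightarrow> 'a \<times> 'a \<Rightarrow> ('a \<times> 'a) set" where
  "dart_orbit G d = {e. (d, e) \<in> {(e, f). e \<in> darts G \<and> (f = prod.swap e \<or> f = face_rot G e)}\<^sup>*}"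

lemma vertex_type_pt [simp]:
  "vertex_type (vertex_pt G d) = 1" "vertex_type (face_pt G d) = 2"
  by (simp_all add: vertex_type_def vertex_pt_def face_pt_def)

lemma vertex_pt_ne_face_pt [simp]: "vertex_pt G d \<noteq> face_pt G e" "face_pt G e \<noteq> vertex_pt G d"
  by (simp_all add: vertex_pt_def face_pt_def)

section \<open>The desingularization as a complex of darts\<close>

context finite_group begin

text \<open>The case to check is a triangle: its factors a and b must each fail to commute with ab,
  so that its sides of mixed type are edges of the complex.\<close>

lemma X_complex_subset_closed:
  assumes "\<sigma> \<in> X_complex G" "\<tau> \<subseteq> \<sigma>" "\<tau> \<noteq> {}"
  shows "\<tau> \<in> X_complex G"
proof -
  have vertex: "{(a, i)} \<in> X_complex G" if "noncommuting G a b" "i \<in> {1, 2}" for a b i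
    using noncommuting_not_central[OF that(1)] that(2) unfolding X_complex_def by blast
  have edge11: "{(a, 1), (b, 1)} \<in> X_complex G" if "noncommuting G a b" for a b
    using that unfolding X_complex_def by blast
  have edge12: "{(a, 1), (b, 2)} \<in> X_complex G" if "noncommuting G a b" for a b
    using that unfolding X_complex_def by blast
  from assms(1) show ?thesis
  proof (cases rule: X_complex_cases)
    case (vertex a i)
    then have "\<tau> = \<sigma>" using assms(2,3) by auto
    then show ?thesis using assms(1) by simp
  next
    case (edge11 a b)
    have "\<tau> \<in> Pow {(a, 1), (b, 1)}" using assms(2) edge11(1) by simp
    then have "\<tau> \<in> {{(a, 1)}, {(b, 1)}, \<sigma>}"
      using assms(3) edge11(1) by (auto simp: Pow_insert)
    then show ?thesis
      using vertex[OF edge11(2)] vertex[OF noncommuting_sym[OF edge11(2)]] assms(1) by auto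
  next
    case (edge12 a b)
    have "\<tau> \<in> Pow {(a, 1), (b, 2)}" using assms(2) edge12(1) by simp
    then have "\<tau> \<in> {{(a, 1)}, {(b, 2)}, \<sigma>}"
      using assms(3) edge12(1) by (auto simp: Pow_insert)
    then show ?thesis
      using vertex[OF edge12(2)] vertex[OF noncommuting_sym[OF edge12(2)]] assms(1) by auto
  next
    case (triangle a b)
    have ab: "noncommuting G a (a \<otimes> b)" "noncommuting G b (a \<otimes> b)"
      using triangle(2) noncommuting_carrier[OF triangle(2)] noncommuting_sym[OF triangle(2)]
      by (simp_all add: noncommuting_mult_left noncommuting_mult_right)
    have three: "\<tau> \<in> {{p}, {q}, {s}, {p, q}, {p, s}, {q, s}, {p, q, s}}" if "\<tau> \<subseteq> {p, q, s}" for p q s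
    proof -
      have "\<tau> \<in> Pow {p, q, s}" using that by simp
      then show ?thesis
        using assms(3) by (simp only: Pow_insert Pow_empty image_Un image_insert image_empty
          Un_insert_left Un_insert_right Un_empty_left Un_empty_right insert_iff empty_iff) argo
    qed
    have "\<tau> \<in> {{(a, 1)}, {(b, 1)}, {(a \<otimes> b, 2)}, {(a, 1), (b, 1)},
        {(a, 1), (a \<otimes> b, 2)}, {(b, 1), (a \<otimes> b, 2)}, \<sigma>}"
      using three[OF assms(2)[unfolded triangle(1)]] unfolding triangle(1) .
    moreover have "{(a, 1)} \<in> X_complex G" "{(b, 1)} \<in> X_complex G" "{(a \<otimes> b, 2)} \<in> X_complex G"
      using vertex[OF triangle(2)] vertex[OF noncommuting_sym[OF triangle(2)]]
        vertex[OF noncommuting_sym[OF ab(1)]] by simp_all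
    ultimately show ?thesis
      using assms(1) edge11[OF triangle(2)] edge12[OF ab(1)] edge12[OF ab(2)] by blast
  qed
qed

lemma component_of_link:
  assumes "noncommuting G a b"
  shows "component_of (link (X_complex G) (a, 1)) {(b, 1), (a \<otimes> b, 2)} = component_of (link (X_complex G) (a, 1)) {(b, 1)}"
    "component_of (link (X_complex G) (a, 1)) {(b, 1), (b \<otimes> a, 2)} = component_of (link (X_complex G) (a, 1)) {(b, 1)}"
    "component_of (link (X_complex G) (a \<otimes> b, 2)) {(a, 1), (b, 1)} = component_of (link (X_complex G) (a \<otimes> b, 2)) {(a, 1)}"
    "component_of (link (X_complex G) (a, 1)) {(a \<otimes> b, 2)} = component_of (link (X_complex G) (a, 1)) {(b, 1)}"
proof -
  show "component_of (link (X_complex G) (a, 1)) {(b, 1), (a \<otimes> b, 2)} = component_of (link (X_complex G) (a, 1)) {(b, 1)}"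
    "component_of (link (X_complex G) (a, 1)) {(b, 1), (b \<otimes> a, 2)} = component_of (link (X_complex G) (a, 1)) {(b, 1)}"
    using link_vertex_edges[OF assms] by (intro component_of_simplex; auto)+
  show "component_of (link (X_complex G) (a \<otimes> b, 2)) {(a, 1), (b, 1)} = component_of (link (X_complex G) (a \<otimes> b, 2)) {(a, 1)}"
    using link_face_edges[OF assms] by (intro component_of_simplex; auto)
  show "component_of (link (X_complex G) (a, 1)) {(a \<otimes> b, 2)} = component_of (link (X_complex G) (a, 1)) {(b, 1)}"
    using link_vertex_edges(1)[OF assms]
    by (intro component_of_eq r_into_rtrancl) (simp add: edge_rel_def insert_commute)
qed

text \<open>Seen from the corner \<open>(b, 1)\<close> the rest of the triangle is a with ab, where
  b is now the right factor; this is the other kind of link edge, for the reversed pair, so that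
  corner is the point of \<open>(b, a)\<close>.\<close>

lemma lift_simplices:
  assumes "noncommuting G a b"
  shows "lift_simplex (X_complex G) {(a, 1), (b, 1)} = {vertex_pt G (a, b), vertex_pt G (b, a)}"
    "lift_simplex (X_complex G) {(a, 1), (a \<otimes> b, 2)} = {vertex_pt G (a, b), face_pt G (a, b)}"
    "lift_simplex (X_complex G) {(a, 1), (b, 1), (a \<otimes> b, 2)} =
      {vertex_pt G (a, b), vertex_pt G (b, a), face_pt G (a, b)}"
proof -
  have ne: "a \<noteq> b" "b \<noteq> a"
    using noncommuting_ne[OF assms] by auto
  have diff: "{(a, 1), (b, 1)} - {(a, 1)} = {(b, 1 :: nat)}" "{(a, 1), (b, 1)} - {(b, 1)} = {(a, 1 :: nat)}"
    "{(a, 1), (a \<otimes> b, 2)} - {(a, 1)} = {(a \<otimes> b, 2 :: nat)}"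
    "{(a, 1), (a \<otimes> b, 2)} - {(a \<otimes> b, 2)} = {(a, 1 :: nat)}"
    "{(a, 1), (b, 1), (a \<otimes> b, 2)} - {(a, 1)} = {(b, 1 :: nat), (a \<otimes> b, 2)}"
    "{(a, 1), (b, 1), (a \<otimes> b, 2)} - {(b, 1)} = {(a, 1 :: nat), (a \<otimes> b, 2)}"
    "{(a, 1), (b, 1), (a \<otimes> b, 2)} - {(a \<otimes> b, 2)} = {(a, 1 :: nat), (b, 1)}"
    using ne by auto
  note c = component_of_link[OF assms] component_of_link(2)[OF noncommuting_sym[OF assms]]
  show "lift_simplex (X_complex G) {(a, 1), (b, 1)} = {vertex_pt G (a, b), vertex_pt G (b, a)}"
    "lift_simplex (X_complex G) {(a, 1), (a \<otimes> b, 2)} = {vertex_pt G (a, b), face_pt G (a, b)}"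
    "lift_simplex (X_complex G) {(a, 1), (b, 1), (a \<otimes> b, 2)} =
      {vertex_pt G (a, b), vertex_pt G (b, a), face_pt G (a, b)}"
    by (simp_all only: lift_simplex_def image_insert image_empty diff c vertex_pt_def face_pt_def fst_conv snd_conv)
qed

text \<open>A link component can be named by one vertex \<open>u\<close> of the simplex, and then
  the edge from \<open>v\<close> to \<open>u\<close> belongs to a dart. For an edge of mixed type
  the missing factor is recovered by division.\<close>

lemma link_component_pts:
  assumes "\<sigma> \<in> link (X_complex G) v"
  obtains d where "d \<in> darts G"
    "(v, component_of (link (X_complex G) v) \<sigma>) \<in> {vertex_pt G d, face_pt G d}"
proof -
  let ?L = "link (X_complex G) v"
  have \<sigma>: "insert v \<sigma> \<in> X_complex G" "v \<notin> \<sigma>" "\<sigma> \<noteq> {}"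
    using assms by (auto simp: link_def)
  then obtain u where u: "u \<in> \<sigma>" by blast
  have "{u, w} \<in> ?L" if "w \<in> \<sigma>" for w
  proof -
    have "{v, u, w} \<in> X_complex G"
      using X_complex_subset_closed[OF \<sigma>(1), of "{v, u, w}"] u that by simp
    then show ?thesis
      using \<sigma>(2) u that by (auto simp: link_def)
  qed
  then have comp: "component_of ?L \<sigma> = component_of ?L {u}"
    using component_of_simplex u by metis
  have vu: "{v, u} \<in> X_complex G"
    using X_complex_subset_closed[OF \<sigma>(1), of "{v, u}"] u by simp
  have "v \<noteq> u" using \<sigma>(2) u by auto
  from vu show ?thesis
  proof (cases rule: X_complex_cases)
    case (edge11 a b)
    then have "v = (a, 1) \<and> u = (b, 1) \<or> v = (b, 1) \<and> u = (a, 1)"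
      by (auto simp: doubleton_eq_iff)
    then show ?thesis
    proof
      assume "v = (a, 1) \<and> u = (b, 1)"
      then show ?thesis
        using edge11(2) comp by (intro that[of "(a, b)"]) (simp_all add: darts_def vertex_pt_def)
    next
      assume "v = (b, 1) \<and> u = (a, 1)"
      then show ?thesis
        using noncommuting_sym[OF edge11(2)] comp
        by (intro that[of "(b, a)"]) (simp_all add: darts_def vertex_pt_def)
    qed
  next
    case (edge12 a c)
    have car: "a \<in> carrier G" "c \<in> carrier G"
      using noncommuting_carrier[OF edge12(2)] by auto
    let ?b = "inv a \<otimes> c"
    have b: "a \<otimes> ?b = c" "noncommuting G a ?b"
      using car edge12(2) noncommuting_mult_left[of a ?b] by simp_all
    have "v = (a, 1) \<and> u = (c, 2) \<or> v = (c, 2) \<and> u = (a, 1)"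
      using edge12(1) by (auto simp: doubleton_eq_iff)
    then show ?thesis
    proof
      assume "v = (a, 1) \<and> u = (c, 2)"
      then show ?thesis
        using b comp component_of_link(4)[OF b(2)]
        by (intro that[of "(a, ?b)"]) (simp_all add: darts_def vertex_pt_def)
    next
      assume "v = (c, 2) \<and> u = (a, 1)"
      then show ?thesis
        using b comp by (intro that[of "(a, ?b)"]) (simp_all add: darts_def face_pt_def)
    qed
  next
    case (triangle a b)
    have "(a, 1) \<in> {v, u}" "(b, 1) \<in> {v, u}" "(a \<otimes> b, 2) \<in> {v, u}"
      unfolding triangle(1) by simp_all
    then show ?thesis
      using noncommuting_ne[OF triangle(2)] by auto
  qed (use \<open>v \<noteq> u\<close> in auto)
qed

lemma Y_complex_eq: "Y_complex G = dart_complex G (darts G)"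
proof (intro equalityI subsetI)
  fix \<tau> assume "\<tau> \<in> Y_complex G"
  then consider (single) v C where "\<tau> = {(v, C)}" "C \<in> components (link (X_complex G) v)"
    | (lift) \<sigma> where "\<sigma> \<in> X_complex G" "card \<sigma> \<ge> 2" "\<tau> = lift_simplex (X_complex G) \<sigma>"
    unfolding Y_complex_def desingularization_def by blast
  then show "\<tau> \<in> dart_complex G (darts G)"
  proof cases
    case single
    then obtain \<sigma> where \<sigma>: "\<sigma> \<in> link (X_complex G) v" "C = component_of (link (X_complex G) v) \<sigma>"
      by (auto simp: components_def)
    from link_component_pts[OF \<sigma>(1)] obtain d where "d \<in> darts G" "(v, C) \<in> {vertex_pt G d, face_pt G d}"
      using \<sigma>(2) by metis
    then show ?thesis
      using single(1) by (auto simp: dart_complex_def)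
  next
    case lift
    from lift(1) show ?thesis
    proof (cases rule: X_complex_cases)
      case (vertex a i)
      then show ?thesis using lift(2) by simp
    next
      case (edge11 a b)
      then have "\<tau> = {vertex_pt G (a, b), vertex_pt G (prod.swap (a, b))}" "(a, b) \<in> darts G"
        using lift(3) lift_simplices(1) by (simp_all add: darts_def)
      then show ?thesis
        unfolding dart_complex_def by blast
    next
      case (edge12 a c)
      have "a \<in> carrier G" "c \<in> carrier G"
        using noncommuting_carrier[OF edge12(2)] by auto
      \<comment> \<open>An edge from \<open>(a, 1)\<close> to \<open>(c, 2)\<close> is a side of the
        triangle whose second factor is a^-1c.\<close>
      then have b: "a \<otimes> (inv a \<otimes> c) = c" "noncommuting G a (inv a \<otimes> c)"
        using edge12(2) noncommuting_mult_left[of a "inv a \<otimes> c"] by simp_all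
      then have "\<tau> = {vertex_pt G (a, inv a \<otimes> c), face_pt G (a, inv a \<otimes> c)}" "(a, inv a \<otimes> c) \<in> darts G"
        using lift(3) edge12(1) lift_simplices(2)[OF b(2)] by (simp_all add: darts_def)
      then show ?thesis
        unfolding dart_complex_def by blast
    next
      case (triangle a b)
      then have "\<tau> = {vertex_pt G (a, b), vertex_pt G (prod.swap (a, b)), face_pt G (a, b)}" "(a, b) \<in> darts G"
        using lift(3) lift_simplices(3) by (simp_all add: darts_def)
      then show ?thesis
        unfolding dart_complex_def by blast
    qed
  qed
next
  fix \<tau> assume "\<tau> \<in> dart_complex G (darts G)"
  then obtain a b where ab: "noncommuting G a b" and \<tau>: "\<tau> \<in> {{vertex_pt G (a, b)}, {face_pt G (a, b)},
      {vertex_pt G (a, b), vertex_pt G (b, a)}, {vertex_pt G (a, b), face_pt G (a, b)},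
      {vertex_pt G (a, b), vertex_pt G (b, a), face_pt G (a, b)}}"
    unfolding dart_complex_def darts_def by fastforce
  have tri: "{(a, 1), (b, 1), (a \<otimes> b, 2)} \<in> X_complex G"
    using ab unfolding X_complex_def by blast
  have sub: "{(a, 1)} \<in> X_complex G" "{(a \<otimes> b, 2)} \<in> X_complex G"
    "{(a, 1), (b, 1)} \<in> X_complex G" "{(a, 1), (a \<otimes> b, 2)} \<in> X_complex G"
    by (rule X_complex_subset_closed[OF tri]; simp)+
  have lifts: "lift_simplex (X_complex G) \<sigma> \<in> Y_complex G" if "\<sigma> \<in> X_complex G" "card \<sigma> \<ge> 2" for \<sigma>
    using that unfolding Y_complex_def desingularization_def by blast
  have singles: "{(v, component_of (link (X_complex G) v) \<sigma>)} \<in> Y_complex G"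
    if "{v} \<in> X_complex G" "\<sigma> \<in> link (X_complex G) v" for v \<sigma>
    using that unfolding Y_complex_def desingularization_def components_def by blast
  have "{vertex_pt G (a, b)} \<in> Y_complex G" "{face_pt G (a, b)} \<in> Y_complex G"
    using singles[OF sub(1) link_vertex_edges(3)[OF ab]] singles[OF sub(2) link_face_edges(2)[OF ab]]
    by (simp_all add: vertex_pt_def face_pt_def)
  moreover have "{vertex_pt G (a, b), vertex_pt G (b, a)} \<in> Y_complex G"
    "{vertex_pt G (a, b), face_pt G (a, b)} \<in> Y_complex G"
    "{vertex_pt G (a, b), vertex_pt G (b, a), face_pt G (a, b)} \<in> Y_complex G"
    using lifts[OF sub(3)] lifts[OF sub(4)] lifts[OF tri] noncommuting_ne[OF ab]
    by (simp_all only: lift_simplices[OF ab]) (simp_all add: card_insert_if)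
  ultimately show "\<tau> \<in> Y_complex G"
    using \<tau> by blast
qed

lemma dart_orbit_subset: "d0 \<in> darts G \<Longrightarrow> dart_orbit G d0 \<subseteq> darts G"
proof
  fix d assume "d0 \<in> darts G" "d \<in> dart_orbit G d0"
  from this(2) have "(d0, d) \<in> {(e, f). e \<in> darts G \<and> (f = prod.swap e \<or> f = face_rot G e)}\<^sup>*"
    by (simp add: dart_orbit_def)
  then show "d \<in> darts G"
    by (induction rule: rtrancl_induct) (use \<open>d0 \<in> darts G\<close> swap_darts face_rot_darts in auto)
qed

end

section \<open>The component as an orbit of darts\<close>

locale group_surface = finite_group +
  fixes d0 :: "'a \<times> 'a" and D :: "('a \<times> 'a) set"
  assumes base: "d0 \<in> darts G"
  defines "D \<equiv> dart_orbit G d0"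
begin

lemma D_darts: "d \<in> D \<Longrightarrow> d \<in> darts G"
  using dart_orbit_subset[OF base] by (auto simp: D_def)

lemma base_D: "d0 \<in> D"
  by (simp add: D_def dart_orbit_def)

lemma swap_D: "d \<in> D \<Longrightarrow> prod.swap d \<in> D" and face_rot_D: "d \<in> D \<Longrightarrow> face_rot G d \<in> D"
proof -
  let ?R = "{(e, f). e \<in> darts G \<and> (f = prod.swap e \<or> f = face_rot G e)}"
  assume d: "d \<in> D"
  then have "(d0, d) \<in> ?R\<^sup>*"
    by (simp add: D_def dart_orbit_def)
  moreover have "(d, prod.swap d) \<in> ?R" "(d, face_rot G d) \<in> ?R"
    using D_darts[OF d] by simp_all
  ultimately have "(d0, prod.swap d) \<in> ?R\<^sup>*" "(d0, face_rot G d) \<in> ?R\<^sup>*"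
    by (blast intro: rtrancl_into_rtrancl)+
  then show "prod.swap d \<in> D" "face_rot G d \<in> D"
    by (simp_all add: D_def dart_orbit_def)
qed

lemma swap_D_iff: "prod.swap d \<in> D \<longleftrightarrow> d \<in> D"
  using swap_D[of d] swap_D[of "prod.swap d"] by auto

lemma finite_D: "finite D"
  using finite_subset[OF _ finite_darts] D_darts by blast

lemma D_induct [consumes 1, case_names base swap face_rot]:
  assumes "d \<in> D" "P d0" "\<And>d. d \<in> D \<Longrightarrow> P d \<Longrightarrow> P (prod.swap d)" "\<And>d. d \<in> D \<Longrightarrow> P d \<Longrightarrow> P (face_rot G d)"
  shows "P d"
proof -
  have "(d0, d) \<in> {(e, f). e \<in> darts G \<and> (f = prod.swap e \<or> f = face_rot G e)}\<^sup>*"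
    using assms(1) by (simp add: D_def dart_orbit_def)
  then show ?thesis
  proof (induction rule: rtrancl_induct)
    case (step e f)
    then have "e \<in> D"
      by (simp add: D_def dart_orbit_def)
    then show ?case
      using step(2,3) assms(3)[of e] assms(4)[of e] by auto
  qed (rule assms(2))
qed

lemma bij_face_rot_D: "bij_betw (face_rot G) D D"
proof -
  have "inj_on (face_rot G) D"
    using bij_face_rot D_darts by (meson bij_betw_def inj_on_subset subsetI)
  moreover have "face_rot G ` D \<subseteq> D"
    using face_rot_D by blast
  ultimately show ?thesis
    using finite_D by (simp add: bij_betw_def endo_inj_surj)
qed

lemma vertex_rot_D: "d \<in> D \<Longrightarrow> vertex_rot G d \<in> D"
proof -
  assume "d \<in> D"
  then obtain e where "e \<in> D" "d = face_rot G e"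
    using bij_face_rot_D by (metis bij_betw_imp_surj_on imageE)
  then show ?thesis
    by (simp add: vertex_rot_face_rot D_darts swap_D)
qed

lemma bij_vertex_rot_D: "bij_betw (vertex_rot G) D D"
proof -
  have "inj_on (vertex_rot G) D"
    using bij_vertex_rot D_darts by (meson bij_betw_def inj_on_subset subsetI)
  moreover have "vertex_rot G ` D \<subseteq> D"
    using vertex_rot_D by blast
  ultimately show ?thesis
    using finite_D by (simp add: bij_betw_def endo_inj_surj)
qed

lemma same_orbit_D:
  assumes "e \<in> D" "same_orbit (vertex_rot G) e d \<or> same_orbit (face_rot G) e d"
  shows "d \<in> D"
proof -
  have "(vertex_rot G ^^ k) e \<in> D" "(face_rot G ^^ k) e \<in> D" for k
    by (induction k) (auto simp: assms(1) vertex_rot_D face_rot_D)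
  then show ?thesis
    using assms(2) by (auto simp: same_orbit_def)
qed

text \<open>Sharing a point means lying in a common rotation orbit, and \<open>D\<close> is a union
  of such orbits. Hence no triangle outside \<open>D\<close> touches one inside.\<close>

lemma pt_in_D:
  assumes "d \<in> darts G" "u \<in> vertex_pt G ` D \<union> face_pt G ` D"
    "u \<in> {vertex_pt G d, vertex_pt G (prod.swap d), face_pt G d}"
  shows "d \<in> D"
proof -
  from assms(2) obtain e where e: "e \<in> D" "u = vertex_pt G e \<or> u = face_pt G e" by blast
  then have "e \<in> darts G" using D_darts by blast
  have "same_orbit (vertex_rot G) e d \<or> same_orbit (vertex_rot G) e (prod.swap d) \<or> same_orbit (face_rot G) e d"
    using e(2) assms(3) vertex_pt_eq_iff[OF \<open>e \<in> darts G\<close> assms(1)]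
      vertex_pt_eq_iff[OF \<open>e \<in> darts G\<close> swap_darts[OF assms(1)]]
      face_pt_eq_iff[OF \<open>e \<in> darts G\<close> assms(1)] by auto
  then show ?thesis
    using same_orbit_D[OF e(1)] swap_D_iff by blast
qed

lemma dart_complexE:
  assumes "\<tau> \<in> dart_complex G A"
  obtains d where "d \<in> A" "\<tau> \<noteq> {}" "\<tau> \<subseteq> {vertex_pt G d, vertex_pt G (prod.swap d), face_pt G d}"
    "\<forall>B. d \<in> B \<longrightarrow> \<tau> \<in> dart_complex G B"
  using assms unfolding dart_complex_def by blast

lemma dart_complex_mem:
  assumes "d \<in> A"
  shows "{vertex_pt G d} \<in> dart_complex G A" "{face_pt G d} \<in> dart_complex G A"
    "{vertex_pt G d, vertex_pt G (prod.swap d)} \<in> dart_complex G A"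
    "{vertex_pt G d, face_pt G d} \<in> dart_complex G A"
    "{vertex_pt G d, vertex_pt G (prod.swap d), face_pt G d} \<in> dart_complex G A"
  using assms unfolding dart_complex_def by blast+

text \<open>An edge of \<open>Y_complex G\<close> starting at a point of \<open>D\<close> lies on a
  triangle of \<open>D\<close>, so paths do not leave it. Conversely each step generating
  \<open>D\<close> can be followed by edges.\<close>

lemma component_eq:
  assumes "\<sigma> = {vertex_pt G d0, vertex_pt G (prod.swap d0), face_pt G d0}"
  shows "component_of (Y_complex G) \<sigma> = dart_complex G D"
proof (intro equalityI subsetI)
  let ?W = "vertex_pt G ` D \<union> face_pt G ` D"
  fix \<tau> assume "\<tau> \<in> component_of (Y_complex G) \<sigma>"
  then obtain u v where uv: "u \<in> \<sigma>" "v \<in> \<tau>" "(u, v) \<in> (edge_rel (Y_complex G))\<^sup>*" "\<tau> \<in> Y_complex G"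
    by (auto simp: component_of_def)
  have "u \<in> ?W"
    using uv(1) assms base_D swap_D[OF base_D] by blast
  from uv(3) this have "v \<in> ?W"
  proof (induction rule: rtrancl_induct)
    case (step v w)
    then have "{v, w} \<in> dart_complex G (darts G)"
      by (simp add: edge_rel_def Y_complex_eq)
    then obtain d where d: "d \<in> darts G" "{v, w} \<subseteq> {vertex_pt G d, vertex_pt G (prod.swap d), face_pt G d}"
      by (rule dart_complexE) blast
    then have "d \<in> D"
      using pt_in_D[OF d(1), of v] step by simp
    then show ?case
      using d(2) swap_D[OF \<open>d \<in> D\<close>] by auto
  qed
  have "\<tau> \<in> dart_complex G (darts G)"
    using uv(4) by (simp add: Y_complex_eq)
  then obtain d where d: "d \<in> darts G" "\<tau> \<noteq> {}" "\<tau> \<subseteq> {vertex_pt G d, vertex_pt G (prod.swap d), face_pt G d}"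
    "\<forall>B. d \<in> B \<longrightarrow> \<tau> \<in> dart_complex G B"
    by (rule dart_complexE) blast
  then show "\<tau> \<in> dart_complex G D"
    using pt_in_D[OF d(1) \<open>v \<in> ?W\<close>] uv(2) d by blast
next
  let ?E = "edge_rel (Y_complex G)"
  fix \<tau> assume "\<tau> \<in> dart_complex G D"
  then obtain d where d: "d \<in> D" "\<tau> \<noteq> {}" "\<tau> \<subseteq> {vertex_pt G d, vertex_pt G (prod.swap d), face_pt G d}"
    "\<forall>B. d \<in> B \<longrightarrow> \<tau> \<in> dart_complex G B"
    by (rule dart_complexE) blast
  have edges: "(vertex_pt G d, face_pt G d) \<in> ?E" "(face_pt G d, vertex_pt G d) \<in> ?E"
    "(vertex_pt G d, vertex_pt G (prod.swap d)) \<in> ?E" if "d \<in> D" for d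
    using dart_complex_mem[OF D_darts[OF that]] by (simp_all add: edge_rel_def Y_complex_eq insert_commute)
  have reach: "(vertex_pt G d0, vertex_pt G d) \<in> ?E\<^sup>*" if "d \<in> D" for d
    using that
  proof (induction rule: D_induct)
    case (swap d)
    then show ?case
      using edges(3) by (meson rtrancl_into_rtrancl)
  next
    case (face_rot d)
    \<comment> \<open>The rotation step is followed through the centre of the polygon, which
      \<open>d\<close> and the rotated dart share.\<close>
    have "(face_pt G d, vertex_pt G (face_rot G d)) \<in> ?E"
      using edges(2)[OF face_rot_D[OF face_rot(1)]] face_pt_rot[OF D_darts[OF face_rot(1)]] by simp
    then show ?case
      using edges(1)[OF face_rot(1)] face_rot(2) by (meson rtrancl_into_rtrancl)
  qed simp
  have "(vertex_pt G d0, v) \<in> ?E\<^sup>*" if "v \<in> \<tau>" for v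
    using that d(3) reach[OF d(1)] reach[OF swap_D[OF d(1)]] edges(1)[OF d(1)]
    by (auto intro: rtrancl_into_rtrancl)
  moreover have "\<tau> \<in> Y_complex G"
    using d(4) D_darts[OF d(1)] by (simp add: Y_complex_eq)
  moreover have "vertex_pt G d0 \<in> \<sigma>"
    by (simp add: assms)
  ultimately show "\<tau> \<in> component_of (Y_complex G) \<sigma>"
    using d(2) unfolding component_of_def by blast
qed

section \<open>The face poset of a component\<close>

abbreviation T where "T \<equiv> dart_complex G D"

definition vcell :: "'a \<times> 'a \<Rightarrow> 'a cell face" where
  "vcell d = Cell (closed_simplex {vertex_pt G d})"

definition ecell :: "'a \<times> 'a \<Rightarrow> 'a cell face" where
  "ecell d = Cell (closed_simplex {vertex_pt G d, vertex_pt G (prod.swap d)})"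

definition fcell :: "'a \<times> 'a \<Rightarrow> 'a cell face" where
  "fcell d = Cell (closed_star T (face_pt G d))"

lemma vertex_pt_swap_ne: "d \<in> D \<Longrightarrow> vertex_pt G (prod.swap d) \<noteq> vertex_pt G d"
  using D_darts[of d] by (auto simp: vertex_pt_def darts_def dest: noncommuting_ne)

lemma T_facet:
  assumes "\<tau> \<in> T"
  obtains d where "d \<in> D" "\<tau> \<subseteq> {vertex_pt G d, vertex_pt G (prod.swap d), face_pt G d}"
  using assms by (rule dart_complexE)

lemma singleton_in_T: "{p} \<in> T \<longleftrightarrow> (\<exists>d\<in>D. p = vertex_pt G d \<or> p = face_pt G d)"
proof
  assume "{p} \<in> T"
  then obtain d where "d \<in> D" "{p} \<subseteq> {vertex_pt G d, vertex_pt G (prod.swap d), face_pt G d}"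
    by (rule T_facet)
  then show "\<exists>d\<in>D. p = vertex_pt G d \<or> p = face_pt G d"
    using swap_D[of d] by blast
qed (use dart_complex_mem in blast)

lemma vertex_pt_face_rot: "d \<in> D \<Longrightarrow> vertex_pt G (face_rot G d) = vertex_pt G (prod.swap d)"
  using vertex_pt_rot[OF face_rot_darts[OF D_darts]] vertex_rot_face_rot[OF D_darts] by simp

lemma face_pt_face_rot: "d \<in> D \<Longrightarrow> face_pt G (face_rot G d) = face_pt G d"
  using face_pt_rot[OF D_darts] .

lemma vertex_cells_eq: "vertex_cells T = (\<lambda>d. closed_simplex {vertex_pt G d}) ` D"
proof -
  have "{p} \<in> T \<and> vertex_type p = 1 \<longleftrightarrow> (\<exists>d\<in>D. p = vertex_pt G d)" for p
    unfolding singleton_in_T by auto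
  then have "vertex_cells T = {closed_simplex {p} | p. \<exists>d\<in>D. p = vertex_pt G d}"
    unfolding vertex_cells_def by simp
  also have "\<dots> = (\<lambda>d. closed_simplex {vertex_pt G d}) ` D"
    by blast
  finally show ?thesis .
qed

lemma vcell_cells: "Cell ` vertex_cells T = vcell ` D"
  unfolding vertex_cells_eq by (simp add: image_image vcell_def[abs_def])

lemma ecell_cells: "Cell ` edge_cells T = ecell ` D"
proof -
  have pair: "\<exists>d\<in>D. {p, q} = {vertex_pt G d, vertex_pt G (prod.swap d)}"
    if pq: "{p, q} \<in> T" "p \<noteq> q" "vertex_type p = 1" "vertex_type q = 1" for p q
  proof -
    from pq(1) obtain d where d: "d \<in> D" "{p, q} \<subseteq> {vertex_pt G d, vertex_pt G (prod.swap d), face_pt G d}"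
      by (rule T_facet)
    moreover have "p \<noteq> face_pt G d" "q \<noteq> face_pt G d"
      using pq(3,4) by auto
    ultimately have "{p, q} = {vertex_pt G d, vertex_pt G (prod.swap d)}"
      using pq(2) by blast
    with d(1) show ?thesis by blast
  qed
  have "edge_cells T \<subseteq> (\<lambda>d. closed_simplex {vertex_pt G d, vertex_pt G (prod.swap d)}) ` D"
  proof
    fix A assume "A \<in> edge_cells T"
    then obtain p q where "A = closed_simplex {p, q}" "{p, q} \<in> T" "p \<noteq> q" "vertex_type p = 1" "vertex_type q = 1"
      unfolding edge_cells_def by blast
    with pair[of p q] obtain d where "d \<in> D" "A = closed_simplex {vertex_pt G d, vertex_pt G (prod.swap d)}"
      by metis
    then show "A \<in> (\<lambda>d. closed_simplex {vertex_pt G d, vertex_pt G (prod.swap d)}) ` D"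
      by blast
  qed
  moreover have "closed_simplex {vertex_pt G d, vertex_pt G (prod.swap d)} \<in> edge_cells T" if "d \<in> D" for d
    using dart_complex_mem(3)[OF that] vertex_pt_swap_ne[OF that] unfolding edge_cells_def
    by (intro CollectI exI[of _ "vertex_pt G d"] exI[of _ "vertex_pt G (prod.swap d)"]) auto
  ultimately have "edge_cells T = (\<lambda>d. closed_simplex {vertex_pt G d, vertex_pt G (prod.swap d)}) ` D"
    by blast
  then show ?thesis
    by (simp add: image_image ecell_def[abs_def])
qed

lemma fcell_cells: "Cell ` polygon_cells T = fcell ` D"
proof -
  have "{p} \<in> T \<and> vertex_type p = 2 \<longleftrightarrow> (\<exists>d\<in>D. p = face_pt G d)" for p
    unfolding singleton_in_T by auto
  then have "polygon_cells T = {closed_star T p | p. \<exists>d\<in>D. p = face_pt G d}"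
    unfolding polygon_cells_def by simp
  also have "\<dots> = (\<lambda>d. closed_star T (face_pt G d)) ` D"
    by blast
  finally show ?thesis
    by (simp add: image_image fcell_def[abs_def])
qed

lemma faces_T: "faces T = {Cell {}, Greatest} \<union> vcell ` D \<union> ecell ` D \<union> fcell ` D"
  unfolding faces_def vcell_cells ecell_cells fcell_cells by auto

text \<open>A corner on the polygon is an end of some dart \<open>c\<close> of it; a terminal end is
  the initial end of \<open>face_rot G c\<close>, which belongs to the same polygon.\<close>

lemma vertex_in_face_iff:
  assumes "d \<in> D" "e \<in> D"
  shows "{vertex_pt G d} \<in> closed_star T (face_pt G e) \<longleftrightarrow>
    (\<exists>c\<in>D. vertex_pt G d = vertex_pt G c \<and> face_pt G e = face_pt G c)"
proof
  assume "{vertex_pt G d} \<in> closed_star T (face_pt G e)"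
  then have "{face_pt G e, vertex_pt G d} \<in> T"
    by (simp add: closed_star_def)
  then obtain c where c: "c \<in> D" "{face_pt G e, vertex_pt G d} \<subseteq> {vertex_pt G c, vertex_pt G (prod.swap c), face_pt G c}"
    by (rule T_facet)
  then have "vertex_pt G d = vertex_pt G c \<or> vertex_pt G d = vertex_pt G (face_rot G c)" "face_pt G e = face_pt G c"
    using vertex_pt_face_rot[OF c(1)] by auto
  then show "\<exists>c\<in>D. vertex_pt G d = vertex_pt G c \<and> face_pt G e = face_pt G c"
    using c(1) face_rot_D[OF c(1)] face_pt_face_rot[OF c(1)] by metis
next
  assume "\<exists>c\<in>D. vertex_pt G d = vertex_pt G c \<and> face_pt G e = face_pt G c"
  then show "{vertex_pt G d} \<in> closed_star T (face_pt G e)"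
    using dart_complex_mem(1,4)[of _ D] by (auto simp: closed_star_def insert_commute)
qed

text \<open>Inclusion of subcomplexes puts the edge itself, not only its ends, into the star;
  together with the centre it spans a triangle, which is the required dart.\<close>

lemma edge_in_face_iff:
  assumes "d \<in> D" "e \<in> D"
  shows "closed_simplex {vertex_pt G d, vertex_pt G (prod.swap d)} \<subseteq> closed_star T (face_pt G e) \<longleftrightarrow>
    (\<exists>c\<in>D. ecell d = ecell c \<and> face_pt G e = face_pt G c)"
proof
  assume "closed_simplex {vertex_pt G d, vertex_pt G (prod.swap d)} \<subseteq> closed_star T (face_pt G e)"
  moreover have "{vertex_pt G d, vertex_pt G (prod.swap d)} \<in> closed_simplex {vertex_pt G d, vertex_pt G (prod.swap d)}"
    by (simp add: closed_simplex_def)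
  ultimately have "{face_pt G e, vertex_pt G d, vertex_pt G (prod.swap d)} \<in> T"
    by (auto simp: closed_star_def)
  then obtain c where c: "c \<in> D" "{face_pt G e, vertex_pt G d, vertex_pt G (prod.swap d)}
      \<subseteq> {vertex_pt G c, vertex_pt G (prod.swap c), face_pt G c}"
    by (rule T_facet)
  then have "{vertex_pt G d, vertex_pt G (prod.swap d)} \<subseteq> {vertex_pt G c, vertex_pt G (prod.swap c)}"
    "face_pt G e = face_pt G c"
    by auto
  then have "{vertex_pt G d, vertex_pt G (prod.swap d)} = {vertex_pt G c, vertex_pt G (prod.swap c)}"
    using vertex_pt_swap_ne[OF assms(1)] unfolding doubleton_eq_iff by auto
  then show "\<exists>c\<in>D. ecell d = ecell c \<and> face_pt G e = face_pt G c"
    using c(1) \<open>face_pt G e = face_pt G c\<close> by (auto simp: ecell_def)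
next
  assume "\<exists>c\<in>D. ecell d = ecell c \<and> face_pt G e = face_pt G c"
  then obtain c where c: "c \<in> D" "ecell d = ecell c" "face_pt G e = face_pt G c" by blast
  have "{vertex_pt G (prod.swap c), face_pt G c} \<in> T"
    using dart_complex_mem(4)[OF face_rot_D[OF c(1)]] c(1) by (simp add: vertex_pt_face_rot face_pt_face_rot)
  then have "{{vertex_pt G c}, {vertex_pt G (prod.swap c)}, {vertex_pt G c, vertex_pt G (prod.swap c)}}
      \<subseteq> closed_star T (face_pt G c)"
    using dart_complex_mem[OF c(1)] dart_complex_mem(1)[OF swap_D[OF c(1)]]
    by (simp add: closed_star_def insert_commute)
  moreover have "closed_simplex {p, q} = {{p}, {q}, {p, q}}" for p q :: "('a \<times> nat) sheet_vertex"
    unfolding closed_simplex_def by blast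
  ultimately show "closed_simplex {vertex_pt G d, vertex_pt G (prod.swap d)} \<subseteq> closed_star T (face_pt G e)"
    using c(2,3) by (simp add: ecell_def)
qed

lemma face_in_own_star: "e \<in> D \<Longrightarrow> {face_pt G e} \<in> closed_star T (face_pt G e)"
  using dart_complex_mem(2) by (simp add: closed_star_def)

lemma vcell_eq_iff: "vcell d = vcell e \<longleftrightarrow> vertex_pt G d = vertex_pt G e"
  using closed_simplex_mono_iff[of "{vertex_pt G d}" "{vertex_pt G e}"] by (auto simp: vcell_def)

text \<open>A star contains its own centre, and two different centres are never adjacent because a
  triangle has only one type 2 corner.\<close>

lemma face_pt_eqI:
  assumes "d \<in> D" "closed_star T (face_pt G d) \<subseteq> closed_star T (face_pt G e)"
  shows "face_pt G d = face_pt G e"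
proof -
  have "{face_pt G e, face_pt G d} \<in> T"
    using face_in_own_star[OF assms(1)] assms(2) by (auto simp: closed_star_def)
  then obtain c where "{face_pt G e, face_pt G d} \<subseteq> {vertex_pt G c, vertex_pt G (prod.swap c), face_pt G c}"
    by (rule T_facet)
  then show ?thesis by simp
qed

lemma fcell_eq_iff: "d \<in> D \<Longrightarrow> fcell d = fcell e \<longleftrightarrow> face_pt G d = face_pt G e"
  using face_pt_eqI[of d e] by (auto simp: fcell_def)

text \<open>Translates inclusion of subcomplexes into sharing a dart, the form of incidence on which
  \<open>dart_map\<close> is built.\<close>

lemma face_le_cells:
  assumes "d \<in> D" "e \<in> D"
  shows "face_le (vcell d) (vcell e) \<longleftrightarrow> vcell d = vcell e"
    "face_le (vcell d) (ecell e) \<longleftrightarrow> (\<exists>c\<in>D. vcell d = vcell c \<and> ecell e = ecell c)"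
    "face_le (vcell d) (fcell e) \<longleftrightarrow> (\<exists>c\<in>D. vcell d = vcell c \<and> fcell e = fcell c)"
    "\<not> face_le (ecell d) (vcell e)"
    "face_le (ecell d) (ecell e) \<longleftrightarrow> ecell d = ecell e"
    "face_le (ecell d) (fcell e) \<longleftrightarrow> (\<exists>c\<in>D. ecell d = ecell c \<and> fcell e = fcell c)"
    "\<not> face_le (fcell d) (vcell e)" "\<not> face_le (fcell d) (ecell e)"
    "face_le (fcell d) (fcell e) \<longleftrightarrow> fcell d = fcell e"
proof -
  have vv: "closed_simplex {vertex_pt G d} \<subseteq> closed_simplex A \<longleftrightarrow> vertex_pt G d \<in> A"
    "closed_simplex {vertex_pt G d, vertex_pt G (prod.swap d)} \<subseteq> closed_simplex A \<longleftrightarrow>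
      {vertex_pt G d, vertex_pt G (prod.swap d)} \<subseteq> A" for A
    by (simp_all add: closed_simplex_mono_iff)
  have ne: "vertex_pt G (prod.swap d) \<noteq> vertex_pt G d" "vertex_pt G (prod.swap e) \<noteq> vertex_pt G e"
    using vertex_pt_swap_ne assms by simp_all
  have eeq: "ecell d = ecell c \<longleftrightarrow> {vertex_pt G d, vertex_pt G (prod.swap d)} = {vertex_pt G c, vertex_pt G (prod.swap c)}" for d c
    using closed_simplex_mono_iff[of "{vertex_pt G d, vertex_pt G (prod.swap d)}" "{vertex_pt G c, vertex_pt G (prod.swap c)}"]
      closed_simplex_mono_iff[of "{vertex_pt G c, vertex_pt G (prod.swap c)}" "{vertex_pt G d, vertex_pt G (prod.swap d)}"]
    unfolding ecell_def face.inject by blast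
  show "face_le (vcell d) (vcell e) \<longleftrightarrow> vcell d = vcell e"
    unfolding vcell_eq_iff by (simp add: vcell_def vv)
  show "face_le (vcell d) (ecell e) \<longleftrightarrow> (\<exists>c\<in>D. vcell d = vcell c \<and> ecell e = ecell c)"
  proof -
    have "face_le (vcell d) (ecell e) \<longleftrightarrow> vertex_pt G d = vertex_pt G e \<or> vertex_pt G d = vertex_pt G (prod.swap e)"
      by (simp add: vcell_def ecell_def vv)
    also have "\<dots> \<longleftrightarrow> (\<exists>c\<in>D. vertex_pt G d = vertex_pt G c \<and> {vertex_pt G e, vertex_pt G (prod.swap e)} = {vertex_pt G c, vertex_pt G (prod.swap c)})"
    proof
      assume "vertex_pt G d = vertex_pt G e \<or> vertex_pt G d = vertex_pt G (prod.swap e)"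
      then show "\<exists>c\<in>D. vertex_pt G d = vertex_pt G c \<and> {vertex_pt G e, vertex_pt G (prod.swap e)} = {vertex_pt G c, vertex_pt G (prod.swap c)}"
      proof
        assume "vertex_pt G d = vertex_pt G (prod.swap e)"
        then show ?thesis
          using swap_D[OF assms(2)] by (intro bexI[of _ "prod.swap e"]) (simp_all add: insert_commute)
      qed (use assms(2) in blast)
    qed auto
    finally show ?thesis
      unfolding vcell_eq_iff eeq .
  qed
  show "face_le (vcell d) (fcell e) \<longleftrightarrow> (\<exists>c\<in>D. vcell d = vcell c \<and> fcell e = fcell c)"
  proof -
    have "closed_simplex {vertex_pt G d} = {{vertex_pt G d}}"
      by (auto simp: closed_simplex_def)
    then show ?thesis
      using vertex_in_face_iff[OF assms] by (simp add: vcell_eq_iff fcell_eq_iff[OF assms(2)]) (simp add: vcell_def fcell_def)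
  qed
  show "\<not> face_le (ecell d) (vcell e)"
    using ne(1) by (auto simp: vcell_def ecell_def vv)
  show "face_le (ecell d) (ecell e) \<longleftrightarrow> ecell d = ecell e"
  proof -
    have "face_le (ecell d) (ecell e) \<longleftrightarrow>
        {vertex_pt G d, vertex_pt G (prod.swap d)} \<subseteq> {vertex_pt G e, vertex_pt G (prod.swap e)}"
      by (simp only: ecell_def face_le.simps vv)
    also have "\<dots> \<longleftrightarrow> {vertex_pt G d, vertex_pt G (prod.swap d)} = {vertex_pt G e, vertex_pt G (prod.swap e)}"
      using ne(1) unfolding doubleton_eq_iff by auto
    finally show ?thesis
      unfolding eeq .
  qed
  show "face_le (ecell d) (fcell e) \<longleftrightarrow> (\<exists>c\<in>D. ecell d = ecell c \<and> fcell e = fcell c)"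
    using edge_in_face_iff[OF assms] unfolding fcell_eq_iff[OF assms(2)] by (simp add: ecell_def fcell_def)
  have "{face_pt G d} \<in> closed_star T (face_pt G d)"
    using face_in_own_star[OF assms(1)] .
  moreover have "{face_pt G d} \<notin> closed_simplex {vertex_pt G a, vertex_pt G b}" for a b
    by (simp add: closed_simplex_def)
  ultimately have *: "\<not> closed_star T (face_pt G d) \<subseteq> closed_simplex {vertex_pt G a, vertex_pt G b}" for a b
    by blast
  show "\<not> face_le (fcell d) (vcell e)" "\<not> face_le (fcell d) (ecell e)"
    using *[of e e] *[of e "prod.swap e"] by (simp_all add: fcell_def vcell_def ecell_def)
  show "face_le (fcell d) (fcell e) \<longleftrightarrow> fcell d = fcell e"
    using face_pt_eqI[OF assms(1), of e] by (auto simp: fcell_def)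
qed

lemma face_le_refl: "face_le a a"
  by (cases a) auto

lemma cells_distinct:
  assumes "d \<in> D" "e \<in> D"
  shows "vcell d \<noteq> ecell e" "vcell d \<noteq> fcell e" "ecell d \<noteq> fcell e"
  using face_le_cells(4,7,8)[OF assms(2,1)] face_le_refl by metis+

lemma cells_nonempty:
  assumes "d \<in> D"
  shows "vcell d \<noteq> Cell {}" "ecell d \<noteq> Cell {}" "fcell d \<noteq> Cell {}"
  using face_in_own_star[OF assms] by (auto simp: vcell_def ecell_def fcell_def closed_simplex_def)

lemma face_rank_cells:
  assumes "d \<in> D"
  shows "face_rank T (vcell d) = 0" "face_rank T (ecell d) = 1" "face_rank T (fcell d) = 2"
proof -
  have v: "A \<in> vertex_cells T \<longleftrightarrow> Cell A \<in> vcell ` D" and e: "A \<in> edge_cells T \<longleftrightarrow> Cell A \<in> ecell ` D" for A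
    unfolding vcell_cells[symmetric] ecell_cells[symmetric] by auto
  \<comment> \<open>The rank function tests vertices, then edges, and falls through to 2; the values
    therefore depend on the three kinds of cells being disjoint.\<close>
  have rank: "face_rank T a = (if a = Cell {} then -1 else if a \<in> vcell ` D then 0 else if a \<in> ecell ` D then 1 else 2)"
    if "a \<noteq> Greatest" for a
    using that by (cases a) (auto simp: face_rank_def v e)
  have "vcell d \<noteq> Greatest" "ecell d \<noteq> Greatest" "fcell d \<noteq> Greatest"
    by (simp_all add: vcell_def ecell_def fcell_def)
  then show "face_rank T (vcell d) = 0" "face_rank T (ecell d) = 1" "face_rank T (fcell d) = 2"
    using cells_nonempty[OF assms] cells_distinct[OF assms] cells_distinct[OF _ assms] assms
    by (auto simp: rank) metis+
qed

lemma face_poset_eq: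
  "face_poset T = {Cell {}} \<times> faces T \<union> faces T \<times> {Greatest} \<union> Id_on (faces T)
    \<union> {(vcell d, ecell d) | d. d \<in> D} \<union> {(ecell d, fcell d) | d. d \<in> D} \<union> {(vcell d, fcell d) | d. d \<in> D}"
  (is "_ = ?R")
proof (intro equalityI subsetI)
  fix p assume "p \<in> face_poset T"
  then obtain a b where p: "p = (a, b)" and ab: "a \<in> faces T" "b \<in> faces T" "face_le a b"
    by (auto simp: face_poset_def)
  show "p \<in> ?R"
  proof (cases "a = Cell {} \<or> b = Greatest \<or> a = b")
    case True
    then show ?thesis using p ab by blast
  next
    case False
    have "a \<noteq> Greatest"
      using ab(3) False by (cases b) auto
    moreover have "b \<noteq> Cell {}"
    proof
      assume b: "b = Cell {}"
      then obtain A where "a = Cell A" using \<open>a \<noteq> Greatest\<close> by (cases a) auto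
      then show False using ab(3) b False by simp
    qed
    ultimately have "a \<in> vcell ` D \<union> ecell ` D \<union> fcell ` D" "b \<in> vcell ` D \<union> ecell ` D \<union> fcell ` D"
      using ab(1,2) False unfolding faces_T by auto
    then obtain d e where "d \<in> D" "e \<in> D" "a \<in> {vcell d, ecell d, fcell d}" "b \<in> {vcell e, ecell e, fcell e}"
      by blast
    then have "(\<exists>c\<in>D. a = vcell c \<and> b = ecell c) \<or> (\<exists>c\<in>D. a = ecell c \<and> b = fcell c) \<or> (\<exists>c\<in>D. a = vcell c \<and> b = fcell c)"
      using ab(3) False face_le_cells[of d e] by auto
    then show ?thesis
      using p by blast
  qed
next
  have fld: "vcell d \<in> faces T" "ecell d \<in> faces T" "fcell d \<in> faces T" if "d \<in> D" for d
    using that unfolding faces_T by blast+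
  have le: "face_le (vcell d) (ecell d)" "face_le (ecell d) (fcell d)" "face_le (vcell d) (fcell d)" if "d \<in> D" for d
    using that face_le_cells(2,3,6)[OF that that] by auto
  have least: "face_le (Cell {}) a" for a :: "'a cell face"
    by (cases a) auto
  have "Cell {} \<in> faces T" "Greatest \<in> faces T"
    by (simp_all add: faces_T)
  fix p assume "p \<in> ?R"
  then show "p \<in> face_poset T"
    unfolding face_poset_def using fld le least face_le_refl \<open>Cell {} \<in> faces T\<close> \<open>Greatest \<in> faces T\<close>
    by (elim UnE) auto
qed

lemma Field_face_poset: "Field (face_poset T) = faces T"
  using face_le_refl by (auto simp: face_poset_def Field_def)

end

sublocale group_surface \<subseteq> surface: dart_map D prod.swap "face_rot G" "vertex_rot G" d0 vcell ecell fcell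
  "Cell {}" Greatest "face_poset T" "face_rank T"
proof unfold_locales
  have fst_pt: "fst (fst (vertex_pt G d)) = fst d" for d
    by (simp add: vertex_pt_def)
  have prod_eq: "fst d \<otimes> snd d = fst e \<otimes> snd e" if "face_pt G d = face_pt G e" for d e
    using that by (simp add: face_pt_def)
  show "finite D" "d0 \<in> D" by (rule finite_D base_D)+
  show "prod.swap d \<in> D" if "d \<in> D" for d using swap_D[OF that] .
  show "prod.swap (prod.swap d) = d" for d :: "'a \<times> 'a" by simp
  show "bij_betw (face_rot G) D D" "bij_betw (vertex_rot G) D D"
    by (rule bij_face_rot_D bij_vertex_rot_D)+
  show "vertex_rot G (face_rot G d) = prod.swap d" if "d \<in> D" for d
    using vertex_rot_face_rot[OF D_darts[OF that]] .
  show "S = D" if S: "d0 \<in> S" "S \<subseteq> D" "\<And>d. d \<in> S \<Longrightarrow> prod.swap d \<in> S" "\<And>d. d \<in> S \<Longrightarrow> face_rot G d \<in> S" for S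
  proof -
    have "d \<in> S" if "d \<in> D" for d
      using that by (induction rule: D_induct) (use S in blast)+
    then show ?thesis using S(2) by blast
  qed
  show "vcell d = vcell e \<longleftrightarrow> same_orbit (vertex_rot G) d e" if "d \<in> D" "e \<in> D" for d e
    unfolding vcell_eq_iff using vertex_pt_eq_iff[OF D_darts[OF that(1)] D_darts[OF that(2)]] .
  show "fcell d = fcell e \<longleftrightarrow> same_orbit (face_rot G) d e" if "d \<in> D" "e \<in> D" for d e
    unfolding fcell_eq_iff[OF that(1)] using face_pt_eq_iff[OF D_darts[OF that(1)] D_darts[OF that(2)]] .
  show "ecell d = ecell e \<longleftrightarrow> e = d \<or> e = prod.swap d" if "d \<in> D" "e \<in> D" for d e
  proof
    assume "ecell d = ecell e"
    then have "\<Union> (closed_simplex {vertex_pt G d, vertex_pt G (prod.swap d)}) =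
        \<Union> (closed_simplex {vertex_pt G e, vertex_pt G (prod.swap e)})"
      by (simp add: ecell_def)
    moreover have "\<Union> (closed_simplex A) = A" for A :: "('a \<times> nat) sheet_vertex set"
      by (auto simp: closed_simplex_def)
    \<comment> \<open>Forgetting sheets and types leaves the two group elements; an unordered pair
      of labels determines the dart up to reversal.\<close>
    ultimately have "(\<lambda>p. fst (fst p)) ` {vertex_pt G d, vertex_pt G (prod.swap d)} =
        (\<lambda>p. fst (fst p)) ` {vertex_pt G e, vertex_pt G (prod.swap e)}"
      by simp
    then have "{fst d, snd d} = {fst e, snd e}"
      by (simp add: fst_pt)
    then show "e = d \<or> e = prod.swap d"
      by (cases d; cases e) (auto simp: doubleton_eq_iff)
  next
    assume "e = d \<or> e = prod.swap d"
    then show "ecell d = ecell e"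
      by (auto simp: ecell_def insert_commute)
  qed
  show "vcell (prod.swap d) \<noteq> vcell d" if "d \<in> D" for d
    unfolding vcell_eq_iff using vertex_pt_swap_ne[OF that] .
  show "fcell (prod.swap d) \<noteq> fcell d" if "d \<in> D" for d
    unfolding fcell_eq_iff[OF swap_D[OF that]] using prod_eq[of "prod.swap d" d] D_darts[OF that]
    by (auto simp: darts_def noncommuting_def)
  show "d = e" if "d \<in> D" "e \<in> D" "vcell d = vcell e" "fcell d = fcell e" for d e
  proof -
    \<comment> \<open>The vertex knows the first factor and the polygon knows the product;
      cancellation gives the second factor.\<close>
    have "fst d = fst e"
      using that(3) fst_pt unfolding vcell_eq_iff by metis
    moreover have "fst d \<otimes> snd d = fst e \<otimes> snd e"
      using that(4) prod_eq unfolding fcell_eq_iff[OF that(1)] by blast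
    ultimately show ?thesis
      using dart_carrier[OF D_darts[OF that(1)]] dart_carrier[OF D_darts[OF that(2)]]
      by (intro prod_eqI) simp_all
  qed
  show "Field (face_poset T) = {Cell {}, Greatest} \<union> vcell ` D \<union> ecell ` D \<union> fcell ` D"
    unfolding Field_face_poset faces_T ..
  show "face_poset T = {Cell {}} \<times> Field (face_poset T) \<union> Field (face_poset T) \<times> {Greatest} \<union> Id_on (Field (face_poset T))
    \<union> {(vcell d, ecell d) | d. d \<in> D} \<union> {(ecell d, fcell d) | d. d \<in> D} \<union> {(vcell d, fcell d) | d. d \<in> D}"
    unfolding Field_face_poset by (rule face_poset_eq)
  show "face_rank T (Cell {}) = -1" "face_rank T Greatest = 3"
    by (simp_all add: face_rank_def)
  show "face_rank T (vcell d) = 0" "face_rank T (ecell d) = 1" "face_rank T (fcell d) = 2" if "d \<in> D" for d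
    using face_rank_cells[OF that] by simp_all
qed

section \<open>Symmetries coming from the group\<close>

context group_surface begin

text \<open>One dart of \<open>D\<close> that stays in \<open>D\<close> suffices: the darts with
  this property are closed under swap and rotation, since a homomorphism commutes with both.\<close>

lemma hom_map_aut:
  assumes \<psi>: "\<psi> \<in> hom G G" and d: "d \<in> D" "map_prod \<psi> \<psi> d \<in> D"
  shows "surface.map_aut (map_prod \<psi> \<psi>)"
proof -
  interpret \<psi>: group_hom G G \<psi>
    by (unfold_locales) (rule \<psi>)
  let ?g = "map_prod \<psi> \<psi>"
  have swap: "?g (prod.swap e) = prod.swap (?g e)" for e
    by (cases e) simp
  have rot: "?g (face_rot G e) = face_rot G (?g e)" if "e \<in> D" for e
    using dart_carrier[OF D_darts[OF that]] by (cases e) (simp add: face_rot_def)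
  have "{e \<in> D. ?g e \<in> D} = D"
  proof (rule surface.subset_eq_D)
    fix e assume "e \<in> {e \<in> D. ?g e \<in> D}"
    then have e: "e \<in> D" "?g e \<in> D" by auto
    show "prod.swap e \<in> {e \<in> D. ?g e \<in> D}"
      using swap_D[OF e(1)] swap_D[OF e(2)] swap[of e] by simp
    show "face_rot G e \<in> {e \<in> D. ?g e \<in> D}"
      using face_rot_D[OF e(1)] face_rot_D[OF e(2)] rot[OF e(1)] by simp
  qed (use d in blast)+
  then show ?thesis
    unfolding surface.map_aut_def using swap rot by blast
qed

text \<open>The antiautomorphism \<open>\<theta>(a) = \<phi>(a)\<inverse>\<close> preserves triangles, exchanging their two type 1
  corners.\<close>

lemma antihom_map_refl:
  assumes \<phi>: "\<phi> \<in> hom G G" and g: "\<And>e. g e = (inv (\<phi> (snd e)), inv (\<phi> (fst e)))"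
    and d: "d \<in> D" "g d \<in> D"
  shows "surface.map_refl g"
proof -
  interpret \<phi>: group_hom G G \<phi>
    by (unfold_locales) (rule \<phi>)
  have swap: "g (prod.swap e) = prod.swap (g e)" for e
    by (simp add: g prod.swap_def)
  \<comment> \<open>Reversing after a vertex rotation is the inverse of the face rotation, as
    \<open>unrot\<close> confirms; so \<open>g\<close> reverses the walk around a polygon.\<close>
  have rot: "g (face_rot G e) = prod.swap (vertex_rot G (g e))" if "e \<in> D" for e
    using dart_carrier[OF D_darts[OF that]]
    by (simp add: g face_rot_def vertex_rot_def prod.swap_def inv_mult_group m_assoc)
  have unrot: "face_rot G (prod.swap (vertex_rot G e)) = e" if "e \<in> D" for e
    using dart_carrier[OF D_darts[OF that]]
    by (simp add: face_rot_def vertex_rot_def prod.swap_def)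
  have "{e \<in> D. g e \<in> D} = D"
  proof (rule surface.subset_eq_D)
    fix e assume "e \<in> {e \<in> D. g e \<in> D}"
    then have e: "e \<in> D" "g e \<in> D" by auto
    show "prod.swap e \<in> {e \<in> D. g e \<in> D}"
      using swap_D[OF e(1)] swap_D[OF e(2)] swap[of e] by simp
    show "face_rot G e \<in> {e \<in> D. g e \<in> D}"
      using face_rot_D[OF e(1)] swap_D[OF vertex_rot_D[OF e(2)]] rot[OF e(1)] by simp
  qed (use d in blast)+
  then have in_D: "g e \<in> D" if "e \<in> D" for e
    using that by blast
  then show ?thesis
    unfolding surface.map_refl_def using swap rot unrot by simp
qed

lemma conj_dart_equiv:
  assumes "h \<in> carrier G" "d \<in> D" "e \<in> D"
    and "e = (h \<otimes> fst d \<otimes> inv h, h \<otimes> snd d \<otimes> inv h)"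
  shows "surface.dart_equiv d e"
proof -
  have "map_prod (\<lambda>a. h \<otimes> a \<otimes> inv h) (\<lambda>a. h \<otimes> a \<otimes> inv h) d = e"
    using assms(4) by (cases d) simp
  then show ?thesis
    using hom_map_aut[OF conjugation_hom[OF assms(1)] assms(2)] assms(3)
    unfolding surface.dart_equiv_def by blast
qed

lemma turn_dart_equiv: "d \<in> D \<Longrightarrow> surface.dart_equiv d (prod.swap (face_rot G d))"
proof -
  assume d: "d \<in> D"
  have "prod.swap (face_rot G d) = (inv snd d \<otimes> fst d \<otimes> inv (inv snd d), inv snd d \<otimes> snd d \<otimes> inv (inv snd d))"
    using dart_carrier[OF D_darts[OF d]] by (simp add: face_rot_def)
  then show ?thesis
    using conj_dart_equiv[OF _ d swap_D[OF face_rot_D[OF d]], of "inv snd d"]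
      dart_carrier[OF D_darts[OF d]] by simp
qed

end

sublocale group_surface \<subseteq> surface: turning_dart_map D prod.swap "face_rot G" "vertex_rot G" d0
  vcell ecell fcell "Cell {}" Greatest "face_poset T" "face_rank T"
  by unfold_locales (rule turn_dart_equiv)

section \<open>Vertex orbits and relative conjugacy classes\<close>

context finite_group begin

lemma cyclic_subgroup_commutes:
  assumes "a \<in> carrier G" "h \<in> carrier (subgroup_generated G {a})"
  shows "h \<in> carrier G" "h \<otimes> a = a \<otimes> h"
proof -
  obtain n :: int where n: "h = a [^] n"
    using assms carrier_subgroup_generated_by_singleton by auto
  then show "h \<in> carrier G"
    using assms(1) by simp
  have "a [^] n \<otimes> a [^] (1::int) = a [^] (1::int) \<otimes> a [^] n"
    using assms(1) by (simp only: int_pow_mult[symmetric] add.commute)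
  then show "h \<otimes> a = a \<otimes> h"
    using n assms(1) by (simp add: int_pow_1)
qed

lemma vertex_rot_funpow:
  assumes "a \<in> carrier G" "b \<in> carrier G"
  shows "(vertex_rot G ^^ n) (a, b) = (a, a [^] n \<otimes> b \<otimes> inv (a [^] n))"
proof (induction n)
  case (Suc n)
  have "a \<otimes> (a [^] n \<otimes> b \<otimes> inv (a [^] n)) \<otimes> inv a = (a \<otimes> a [^] n) \<otimes> b \<otimes> inv (a \<otimes> a [^] n)"
    using assms by (simp add: m_assoc inv_mult_group)
  also have "a \<otimes> a [^] n = a [^] Suc n"
    by (rule nat_pow_Suc2[symmetric, OF assms(1)])
  finally have "vertex_rot G (a, a [^] n \<otimes> b \<otimes> inv (a [^] n)) = (a, a [^] Suc n \<otimes> b \<otimes> inv (a [^] Suc n))"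
    by (simp only: vertex_rot_def fst_conv snd_conv)
  then show ?case
    by (simp only: funpow.simps comp_apply Suc.IH)
qed (use assms in simp)

text \<open>Turning \<open>n\<close> times conjugates by the \<open>n\<close>-th power of
  \<open>a\<close>. Negative powers turn backwards, and they are reached because orbits are
  symmetric on a finite set of darts.\<close>

lemma vertex_orbit_eq:
  assumes "noncommuting G a b"
  shows "{e. same_orbit (vertex_rot G) (a, b) e} =
    (\<lambda>h. (a, h \<otimes> b \<otimes> inv h)) ` carrier (subgroup_generated G {a})"
proof -
  have car: "a \<in> carrier G" "b \<in> carrier G"
    using noncommuting_carrier[OF assms] by auto
  note pow = carrier_subgroup_generated_by_singleton[OF car(1)]
  show ?thesis
  proof (intro equalityI subsetI)
    fix e assume "e \<in> {e. same_orbit (vertex_rot G) (a, b) e}"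
    then obtain n where "e = (vertex_rot G ^^ n) (a, b)"
      by (auto simp: same_orbit_def)
    then have "e = (a, a [^] int n \<otimes> b \<otimes> inv (a [^] int n))"
      using vertex_rot_funpow[OF car] by (simp add: int_pow_int)
    then show "e \<in> (\<lambda>h. (a, h \<otimes> b \<otimes> inv h)) ` carrier (subgroup_generated G {a})"
      unfolding pow by blast
  next
    fix e assume "e \<in> (\<lambda>h. (a, h \<otimes> b \<otimes> inv h)) ` carrier (subgroup_generated G {a})"
    then obtain z :: int where e: "e = (a, a [^] z \<otimes> b \<otimes> inv (a [^] z))"
      unfolding pow by blast
    show "e \<in> {e. same_orbit (vertex_rot G) (a, b) e}"
    proof (cases z rule: int_cases2)
      case (nonneg n)
      then have "e = (vertex_rot G ^^ n) (a, b)"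
        using e vertex_rot_funpow[OF car] by (simp add: int_pow_int)
      then show ?thesis
        by (auto simp: same_orbit_def)
    next
      case (nonpos n)
      let ?h = "a [^] n"
      have h: "?h \<in> carrier G" using car by simp
      have e': "e = (a, inv ?h \<otimes> b \<otimes> ?h)"
        using e nonpos car by (simp add: int_pow_neg int_pow_int)
      have "(vertex_rot G ^^ n) e = (a, ?h \<otimes> (inv ?h \<otimes> b \<otimes> ?h) \<otimes> inv ?h)"
        unfolding e' using car h by (simp only: vertex_rot_funpow m_closed inv_closed)
      also have "\<dots> = (a, b)"
        using car h by simp
      finally have "same_orbit (vertex_rot G) e (a, b)"
        unfolding same_orbit_def by (intro exI[of _ n]) (rule sym)
      \<comment> \<open>Symmetry of the orbit relation applies only to darts. If the conjugate
        commuted with \<open>a\<close>, conjugating back by the power of \<open>a\<close> would make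
        \<open>b\<close> commute with \<open>a\<close>.\<close>
      moreover have "e \<in> darts G"
      proof -
        have "?h \<otimes> a = a \<otimes> ?h"
          using nat_pow_Suc2[OF car(1), of n] by simp
        have "noncommuting G a (inv ?h \<otimes> b \<otimes> ?h)"
        proof (rule ccontr)
          assume "\<not> noncommuting G a (inv ?h \<otimes> b \<otimes> ?h)"
          then have "a \<otimes> (inv ?h \<otimes> b \<otimes> ?h) = (inv ?h \<otimes> b \<otimes> ?h) \<otimes> a"
            using car h by (simp add: noncommuting_def)
          then have "?h \<otimes> (a \<otimes> (inv ?h \<otimes> b \<otimes> ?h)) \<otimes> inv ?h = ?h \<otimes> ((inv ?h \<otimes> b \<otimes> ?h) \<otimes> a) \<otimes> inv ?h"
            by simp
          moreover have "?h \<otimes> (a \<otimes> (inv ?h \<otimes> b \<otimes> ?h)) \<otimes> inv ?h = a \<otimes> b"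
          proof -
            have "?h \<otimes> (a \<otimes> (inv ?h \<otimes> b \<otimes> ?h)) = a \<otimes> (?h \<otimes> (inv ?h \<otimes> b \<otimes> ?h))"
              using car h \<open>?h \<otimes> a = a \<otimes> ?h\<close> by (simp only: m_assoc[symmetric] m_closed inv_closed)
            then show ?thesis
              using car h by (simp add: m_assoc)
          qed
          moreover have "?h \<otimes> ((inv ?h \<otimes> b \<otimes> ?h) \<otimes> a) \<otimes> inv ?h = b \<otimes> a"
          proof -
            have "(inv ?h \<otimes> b \<otimes> ?h) \<otimes> a = inv ?h \<otimes> (b \<otimes> a) \<otimes> ?h"
              using car h \<open>?h \<otimes> a = a \<otimes> ?h\<close> by (simp add: m_assoc)
            then show ?thesis
              using car h by simp
          qed
          ultimately show False
            using assms by (simp add: noncommuting_def)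
        qed
        then show ?thesis
          by (simp add: e' darts_def)
      qed
      ultimately show ?thesis
        using orbit_sym(2) by blast
    qed
  qed
qed

text \<open>A power \<open>h\<close> of \<open>x\<close> commutes with \<open>x\<close>, so
  conjugating xy by \<open>h\<close> affects only the factor \<open>y\<close>. Left multiplication
  by \<open>x\<close> then matches the turns about the initial vertex with the class; for
  \<open>y\<close> it is right multiplication.\<close>

lemma card_rel_conj_class:
  assumes "noncommuting G x y"
  shows "card (rel_conj_class G x (x \<otimes> y)) = card {e. same_orbit (vertex_rot G) (x, y) e}"
    "card (rel_conj_class G y (x \<otimes> y)) = card {e. same_orbit (vertex_rot G) (y, x) e}"
proof -
  have car: "x \<in> carrier G" "y \<in> carrier G"
    using noncommuting_carrier[OF assms] by auto
  have x: "h \<otimes> (x \<otimes> y) \<otimes> inv h = x \<otimes> (h \<otimes> y \<otimes> inv h)" "h \<in> carrier G"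
    if "h \<in> carrier (subgroup_generated G {x})" for h
  proof -
    have h: "h \<in> carrier G" "h \<otimes> x = x \<otimes> h"
      using cyclic_subgroup_commutes[OF car(1) that] by auto
    have "h \<otimes> (x \<otimes> y) \<otimes> inv h = (h \<otimes> x) \<otimes> y \<otimes> inv h"
      using h(1) car by (simp add: m_assoc)
    also have "\<dots> = x \<otimes> (h \<otimes> y \<otimes> inv h)"
      unfolding h(2) using h(1) car by (simp add: m_assoc)
    finally show "h \<otimes> (x \<otimes> y) \<otimes> inv h = x \<otimes> (h \<otimes> y \<otimes> inv h)" "h \<in> carrier G"
      using h(1) by auto
  qed
  have y: "h \<otimes> (x \<otimes> y) \<otimes> inv h = (h \<otimes> x \<otimes> inv h) \<otimes> y" "h \<in> carrier G"
    if "h \<in> carrier (subgroup_generated G {y})" for h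
  proof -
    have h: "h \<in> carrier G" "h \<otimes> y = y \<otimes> h"
      using cyclic_subgroup_commutes[OF car(2) that] by auto
    have "(h \<otimes> x \<otimes> inv h) \<otimes> y = h \<otimes> x \<otimes> (inv h \<otimes> (y \<otimes> h)) \<otimes> inv h"
      using h(1) car by (simp add: m_assoc)
    also have "\<dots> = h \<otimes> x \<otimes> y \<otimes> inv h"
      unfolding h(2)[symmetric] using h(1) car by (simp add: m_assoc[symmetric])
    finally show "h \<otimes> (x \<otimes> y) \<otimes> inv h = (h \<otimes> x \<otimes> inv h) \<otimes> y" "h \<in> carrier G"
      using h(1) car by (auto simp: m_assoc)
  qed
  have "rel_conj_class G x (x \<otimes> y) = (\<lambda>e. x \<otimes> snd e) ` {e. same_orbit (vertex_rot G) (x, y) e}"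
    unfolding vertex_orbit_eq[OF assms] rel_conj_class_def orbit_def Setcompr_eq_image image_image
    using x by (auto intro!: image_cong)
  moreover have "inj_on (\<lambda>e. x \<otimes> snd e) {e. same_orbit (vertex_rot G) (x, y) e}"
    unfolding vertex_orbit_eq[OF assms] using car x(2) by (auto simp: inj_on_def)
  ultimately show "card (rel_conj_class G x (x \<otimes> y)) = card {e. same_orbit (vertex_rot G) (x, y) e}"
    by (simp add: card_image)
  have "rel_conj_class G y (x \<otimes> y) = (\<lambda>e. snd e \<otimes> y) ` {e. same_orbit (vertex_rot G) (y, x) e}"
    unfolding vertex_orbit_eq[OF noncommuting_sym[OF assms]] rel_conj_class_def orbit_def Setcompr_eq_image image_image
    using y by (auto intro!: image_cong)
  moreover have "inj_on (\<lambda>e. snd e \<otimes> y) {e. same_orbit (vertex_rot G) (y, x) e}"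
    unfolding vertex_orbit_eq[OF noncommuting_sym[OF assms]] using car y(2) by (auto simp: inj_on_def)
  ultimately show "card (rel_conj_class G y (x \<otimes> y)) = card {e. same_orbit (vertex_rot G) (y, x) e}"
    by (simp add: card_image)
qed

end

context group_surface begin

lemma valency_eq:
  assumes "d \<in> D"
  shows "valency T (closed_simplex {vertex_pt G d}) = card {e. same_orbit (vertex_rot G) d e}"
proof -
  have "Cell ` {e \<in> edge_cells T. closed_simplex {vertex_pt G d} \<subseteq> e} = {a \<in> ecell ` D. (vcell d, a) \<in> face_poset T}"
  proof -
    have "(vcell d, Cell e) \<in> face_poset T \<longleftrightarrow> closed_simplex {vertex_pt G d} \<subseteq> e" if "Cell e \<in> ecell ` D" for e
      using that assms by (simp add: face_poset_def faces_T) (simp add: vcell_def)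
    then show ?thesis
      unfolding ecell_cells[symmetric] by auto
  qed
  then have "card {a \<in> ecell ` D. (vcell d, a) \<in> face_poset T} = valency T (closed_simplex {vertex_pt G d})"
    unfolding valency_def by (subst card_image[symmetric, of Cell]) (simp_all add: inj_on_def)
  then show ?thesis
    using surface.card_edges_at_vertex[OF assms] by simp
qed

text \<open>An \<open>h\<close> in the cyclic group of xy fixes xy under conjugation. If it carries
  \<open>x\<close> to \<open>y\<close>, the image of \<open>y\<close> times \<open>y\<close> on the
  left must again be xy, which forces it to be y^-1xy: conjugation by \<open>h\<close> is the
  rotation step at \<open>d0\<close>.\<close>

lemma rel_conjugate_dart_equiv:
  assumes "rel_conjugate G (fst d0 \<otimes> snd d0) (fst d0) (snd d0)"
  shows "surface.dart_equiv d0 (face_rot G d0)"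
proof -
  let ?x = "fst d0" and ?y = "snd d0"
  have car: "?x \<in> carrier G" "?y \<in> carrier G"
    using dart_carrier[OF base] by auto
  obtain h where h': "h \<in> carrier (subgroup_generated G {?x \<otimes> ?y})" "?y = h \<otimes> ?x \<otimes> inv h"
    using assms by (auto simp: rel_conjugate_def rel_conj_class_def orbit_def)
  have h: "h \<in> carrier G" "h \<otimes> (?x \<otimes> ?y) = ?x \<otimes> ?y \<otimes> h"
    by (rule cyclic_subgroup_commutes[OF m_closed[OF car] h'(1)])+
  have "?y \<otimes> (h \<otimes> ?y \<otimes> inv h) = (h \<otimes> ?x \<otimes> inv h) \<otimes> (h \<otimes> ?y \<otimes> inv h)"
    by (simp only: h'(2)[symmetric])
  also have "\<dots> = h \<otimes> (?x \<otimes> ?y) \<otimes> inv h"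
    using hom_mult[OF conjugation_hom[OF h(1)] car] by simp
  also have "\<dots> = ?y \<otimes> (inv ?y \<otimes> ?x \<otimes> ?y)"
    unfolding h(2) using h(1) car by simp
  finally have y: "h \<otimes> ?y \<otimes> inv h = inv ?y \<otimes> ?x \<otimes> ?y"
    using l_cancel[of ?y "h \<otimes> ?y \<otimes> inv h" "inv ?y \<otimes> ?x \<otimes> ?y"] car h(1)
    by (simp del: conj_cancel)
  have "face_rot G d0 = (h \<otimes> ?x \<otimes> inv h, h \<otimes> ?y \<otimes> inv h)"
    by (simp only: h'(2)[symmetric] y face_rot_def)
  then show ?thesis
    by (rule conj_dart_equiv[OF h(1) base_D face_rot_D[OF base_D]])
qed

end

theorem theorem2p34:
  fixes G :: "('a, 'b) monoid_scheme" (structure)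
    and x y \<alpha> :: 'a
    and T :: "('a \<times> nat) sheet_vertex complex"
    and P :: "'a cell face rel"
    and rk :: "'a cell face \<Rightarrow> int"
  assumes "group G" and "finite (carrier G)" and "\<not> comm_group G"
    and "x \<in> carrier G" and "y \<in> carrier G" and "x \<otimes> y \<noteq> y \<otimes> x"
    and "\<alpha> = x \<otimes> y"
    and "T = Y_component G x y"
    and "P = face_poset T" and "rk = face_rank T"
  shows "\<exists>n. (\<forall>f\<in>polygon_cells T. is_ngon n (order_section P (Cell {}) (Cell f))) \<and>
    \<comment> \<open>(1)\<close>
    (abstract_3_polytope P rk \<and> rank_transitive P rk 2 \<and> rank_transitive P rk 1) \<and>
    \<comment> \<open>(2)\<close>
    ((equivar P rk \<longleftrightarrow> (\<exists>l. \<forall>v\<in>vertex_cells T. valency T v = l)) \<and>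
     (card (rel_conj_class G x \<alpha>) = card (rel_conj_class G y \<alpha>) \<longrightarrow> equivar P rk) \<and>
     (\<forall>l. (\<forall>v\<in>vertex_cells T. valency T v = l) \<longrightarrow> has_schlafli_index P rk n l)) \<and>
    \<comment> \<open>(3)\<close>
    (rel_conjugate G \<alpha> x y \<longrightarrow>
       rank_transitive P rk 2 \<and> rank_transitive P rk 1 \<and> rank_transitive P rk 0) \<and>
    \<comment> \<open>(4)\<close>
    (rel_conjugate G \<alpha> x y \<and> (\<exists>\<phi>\<in>iso G G. \<phi> x = inv y \<and> \<phi> y = inv x) \<longrightarrow>
       flag_transitive P) \<and>
    \<comment> \<open>(5)\<close>
    (\<not> rel_conjugate G \<alpha> x y \<and>
       (\<exists>\<psi>\<in>iso G G. \<psi> x = y \<and> \<psi> y = inv y \<otimes> x \<otimes> y) \<and>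
       (\<exists>\<phi>\<in>iso G G. \<phi> x = inv y \<and> \<phi> y = inv x) \<longrightarrow>
       rank_transitive P rk 2 \<and> rank_transitive P rk 1 \<and> rank_transitive P rk 0 \<and>
       flag_transitive P)"
proof -
  define D where "D = dart_orbit G (x, y)"
  have nc: "noncommuting G x y"
    using assms(4-6) by (simp add: noncommuting_def)
  interpret group G by (rule assms(1))
  interpret finite_group G
    by unfold_locales (rule assms(2))
  interpret group_surface G "(x, y)" D
    by unfold_locales (use nc in \<open>simp_all add: darts_def D_def\<close>)
  have T: "T = dart_complex G D"
    unfolding assms(8) Y_component_def by (rule component_eq) (use lift_simplices(3)[OF nc] in simp)
  have P: "P = face_poset (dart_complex G D)" and rk: "rk = face_rank (dart_complex G D)"
    using assms(9,10) T by auto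
  obtain n where n: "\<And>d. d \<in> D \<Longrightarrow> is_ngon n (order_section P (Cell {}) (fcell d))"
    using surface.faces_ngons unfolding P by blast
  have polygons: "is_ngon n (order_section P (Cell {}) (Cell f))" if "f \<in> polygon_cells T" for f
  proof -
    have "Cell f \<in> fcell ` D"
      using that unfolding T fcell_cells[symmetric] by blast
    then show ?thesis
      using n by auto
  qed
  have valency: "(\<forall>v\<in>vertex_cells T. valency T v = l) \<longleftrightarrow>
      (\<forall>d\<in>D. card {e. same_orbit (vertex_rot G) d e} = l)" for l
  proof -
    have "(\<forall>v\<in>vertex_cells T. valency T v = l) \<longleftrightarrow> (\<forall>d\<in>D. valency T (closed_simplex {vertex_pt G d}) = l)"
      unfolding T vertex_cells_eq by blast
    then show ?thesis
      using valency_eq unfolding T by (simp cong: ball_cong)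
  qed
  have schlafli: "has_schlafli_index P rk n l" if "\<forall>v\<in>vertex_cells T. valency T v = l" for l
    using that n surface.vertex_is_ngon unfolding has_schlafli_index_def valency
    by (auto simp: P rk surface.rank_set_r)
  have equivar: "equivar P rk \<longleftrightarrow> (\<exists>l. \<forall>v\<in>vertex_cells T. valency T v = l)"
  proof
    assume "equivar P rk"
    then obtain m l where "has_schlafli_index P rk m l"
      by (auto simp: equivar_def)
    then have "is_ngon l (order_section P (vcell d) Greatest)" if "d \<in> D" for d
      using that by (auto simp: has_schlafli_index_def P rk surface.rank_set_r)
    \<comment> \<open>The section at a vertex is an \<open>l\<close>-gon by assumption and a polygon
      with as many sides as the rotation orbit has darts; a polygon has only one size.\<close>
    then have "card {e. same_orbit (vertex_rot G) d e} = l" if "d \<in> D" for d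
      using that surface.vertex_is_ngon is_ngon_unique unfolding P by blast
    then show "\<exists>l. \<forall>v\<in>vertex_cells T. valency T v = l"
      unfolding valency by blast
  qed (use schlafli in \<open>auto simp: equivar_def\<close>)
  have sizes: "equivar P rk" if "card (rel_conj_class G x \<alpha>) = card (rel_conj_class G y \<alpha>)"
  proof -
    let ?l = "card {e. same_orbit (vertex_rot G) (x, y) e}"
    have "?l = card {e. same_orbit (vertex_rot G) (prod.swap (x, y)) e}"
      using that card_rel_conj_class[OF nc] assms(7) by simp
    then have "is_ngon ?l (order_section P (vcell d) Greatest)" if "d \<in> D" for d
      using surface.vertices_ngons that unfolding P by blast
    then have "has_schlafli_index P rk n ?l"
      using n by (auto simp: has_schlafli_index_def P rk surface.rank_set_r)
    then show ?thesis
      by (auto simp: equivar_def)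
  qed
  have iso_hom: "\<psi> \<in> hom G G" if "\<psi> \<in> iso G G" for \<psi>
    using that by (simp add: iso_def)
  have reflection: "\<exists>g. surface.map_refl g \<and> g (x, y) = (x, y)"
    if \<phi>: "\<phi> \<in> iso G G" "\<phi> x = inv y" "\<phi> y = inv x" for \<phi>
  proof -
    \<comment> \<open>The values prescribed for \<open>\<phi>\<close> say exactly that
      \<open>g\<close> fixes the base dart: inverting and exchanging undoes them.\<close>
    define g where "g e = (inv (\<phi> (snd e)), inv (\<phi> (fst e)))" for e
    have "g (x, y) = (x, y)"
      using \<phi>(2,3) assms(4,5) by (simp add: g_def)
    then show ?thesis
      using antihom_map_refl[OF iso_hom[OF \<phi>(1)] g_def base_D] base_D by auto
  qed
  have turned: "surface.dart_equiv (x, y) (face_rot G (x, y))"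
    if "rel_conjugate G \<alpha> x y \<or> (\<exists>\<psi>\<in>iso G G. \<psi> x = y \<and> \<psi> y = inv y \<otimes> x \<otimes> y)"
    using that
  proof
    assume "rel_conjugate G \<alpha> x y"
    then show ?thesis
      using rel_conjugate_dart_equiv assms(7) by simp
  next
    assume "\<exists>\<psi>\<in>iso G G. \<psi> x = y \<and> \<psi> y = inv y \<otimes> x \<otimes> y"
    \<comment> \<open>The hypothesis of (5) prescribes precisely the rotated base dart as the image
      of \<open>(x, y)\<close>.\<close>
    then obtain \<psi> where \<psi>: "\<psi> \<in> iso G G" "map_prod \<psi> \<psi> (x, y) = face_rot G (x, y)"
      by (auto simp: face_rot_def)
    then show ?thesis
      using hom_map_aut[OF iso_hom[OF \<psi>(1)] base_D] face_rot_D[OF base_D]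
      unfolding surface.dart_equiv_def by auto
  qed
  have vertex_trans: "rank_transitive P rk 0" if "surface.dart_equiv (x, y) (face_rot G (x, y))"
    using surface.vertex_transitive[OF that] unfolding P rk .
  have flag_trans: "flag_transitive P"
    if "surface.dart_equiv (x, y) (face_rot G (x, y))" "\<exists>\<phi>\<in>iso G G. \<phi> x = inv y \<and> \<phi> y = inv x"
    using reflection that(2) surface.flag_transitive_r[OF that(1)] unfolding P by blast
  have "rank_transitive P rk 2" "rank_transitive P rk 1" "abstract_3_polytope P rk"
    unfolding P rk
    by (rule surface.face_transitive surface.edge_transitive surface.abstract_3_polytope_r)+
  then show ?thesis
    using polygons equivar sizes schlafli turned vertex_trans flag_trans by blast
qed

end
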